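(* Let $\mu$ be a nontrivial probability measure on the unit circle $\partial\mathbb{D}$ with Lebesgue decomposition $d\mu=w(\theta)\frac{d\theta}{2\pi}+d\mu_s$ into an absolutely continuous and a singular part. Let $\mu$ have Verblunsky coefficients $\{\alpha_n\}_{n=0}^\infty$ of the form $$\alpha_n=\sum_{l=1}^\infty c_le^{-in\phi_l}\gamma_n^{(l)}$$ (with $c_l\in\mathbb{C}$, $\phi_l\in\mathbb{R}$, $\gamma_n^{(l)}\in\mathbb{C}$), such that for some odd integer $p\ge3$ and some $\beta\in(0,\frac1{p-2})$ the following conditions hold: (i) $\sup_l\sum_{n=1}^\infty|\gamma_{n+1}^{(l)}-\gamma_n^{(l)}|<\infty$; (ii) $\sum_{n=1}^\infty\left(\sup_l|\gamma_n^{(l)}|\right)^p<\infty$; (iii) $\sum_{l=1}^\infty|c_l|^\beta<\infty$. Then there is a set $S\subset\partial\mathbb{D}$ of Hausdorff dimension at most $\beta(p-2)$ with $\mu_s(\partial\mathbb{D}\setminus S)=0$, and $w(\theta)>0$ for Lebesgue-a.e. $\theta$.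
   Context: A probability measure on $\partial\mathbb{D}$ is nontrivial if its support is not a finite set. Its Verblunsky coefficients $\alpha_n\in\mathbb{D}$ ($n\ge0$) are defined by the Szeg\H{o} recursion $\Phi_{n+1}(z)=z\Phi_n(z)-\bar\alpha_n\Phi_n^*(z)$ for the monic orthogonal polynomials $\Phi_n$ of $\mu$, where $\Phi_n^*(z)=z^n\overline{\Phi_n(1/\bar z)}$. *)

theory Defs
  imports "HOL-Probability.Probability" "HOL-Computational_Algebra.Polynomial"
begin

section \<open>Hausdorff measure and Hausdorff dimension\<close>

(* The case distinction fixes |U|^0 = 1 for every nonempty U (in HOL, 0 powr 0 = 0). *)
definition diam_pow :: "real \<Rightarrow> 'a::metric_space set \<Rightarrow> ennreal" where
  "diam_pow s U = (if U = {} then 0 else if s = 0 then 1 else ennreal (diameter U powr s))"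

(* Boundedness is required because the diameter of an unbounded set is an unspecified real. *)
definition hausdorff_premeasure :: "real \<Rightarrow> real \<Rightarrow> 'a::metric_space set \<Rightarrow> ennreal" where
  "hausdorff_premeasure s \<delta> S =
     (INF U \<in> {U :: nat \<Rightarrow> 'a set. S \<subseteq> (\<Union>i. U i) \<and> (\<forall>i. bounded (U i) \<and> diameter (U i) \<le> \<delta>)}.
        \<Sum>i. diam_pow s (U i))"

definition hausdorff_measure :: "real \<Rightarrow> 'a::metric_space set \<Rightarrow> ennreal" where
  "hausdorff_measure s S = (SUP \<delta>\<in>{0<..}. hausdorff_premeasure s \<delta> S)"

definition hausdorff_dim :: "'a::metric_space set \<Rightarrow> ennreal" where
  "hausdorff_dim S = (INF s \<in> {s. 0 \<le> s \<and> hausdorff_measure s S = 0}. ennreal s)"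

section \<open>Measures on the unit circle\<close>

abbreviation unit_circle :: "complex set" where
  "unit_circle \<equiv> sphere 0 1"

definition circle_borel :: "complex measure" where
  "circle_borel = restrict_space borel unit_circle"

definition circle_support :: "complex measure \<Rightarrow> complex set" where
  "circle_support \<mu> =
     {z \<in> unit_circle. \<forall>U. open U \<and> z \<in> U \<longrightarrow> emeasure \<mu> (U \<inter> unit_circle) > 0}"

definition nontrivial_circle_prob :: "complex measure \<Rightarrow> bool" where
  "nontrivial_circle_prob \<mu> \<longleftrightarrow>
     prob_space \<mu> \<and> sets \<mu> = sets circle_borel \<and> infinite (circle_support \<mu>)"

text \<open>The measure \<open>w(\<theta>) d\<theta>/2\<pi>\<close>, with the circle parametrised by \<open>\<theta> \<in> [0, 2\<pi>)\<close>
  through \<open>\<theta> \<mapsto> exp(i \<theta>)\<close>.\<close>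
definition arc_measure :: "(real \<Rightarrow> real) \<Rightarrow> complex measure" where
  "arc_measure w =
     distr (density lborel (\<lambda>\<theta>. ennreal (w \<theta> / (2 * pi)) * indicator {0..<2 * pi} \<theta>))
       circle_borel cis"

definition circle_singular :: "complex measure \<Rightarrow> bool" where
  "circle_singular \<nu> \<longleftrightarrow>
     (\<exists>N \<in> null_sets (arc_measure (\<lambda>_. 1)). emeasure \<nu> (unit_circle - N) = 0)"

definition circle_lebesgue_decomp ::
    "complex measure \<Rightarrow> (real \<Rightarrow> real) \<Rightarrow> complex measure \<Rightarrow> bool" where
  "circle_lebesgue_decomp \<mu> w \<mu>s \<longleftrightarrow>
     w \<in> borel_measurable borel \<and> (\<forall>\<theta>\<in>{0..<2 * pi}. 0 \<le> w \<theta>) \<and>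
     sets \<mu>s = sets circle_borel \<and> circle_singular \<mu>s \<and>
     (\<forall>A \<in> sets circle_borel. emeasure \<mu> A = emeasure (arc_measure w) A + emeasure \<mu>s A)"

section \<open>Orthogonal polynomials and Verblunsky coefficients\<close>

definition monic_orthogonal_polys :: "complex measure \<Rightarrow> (nat \<Rightarrow> complex poly) \<Rightarrow> bool" where
  "monic_orthogonal_polys \<mu> \<Phi> \<longleftrightarrow>
     (\<forall>n. degree (\<Phi> n) = n \<and> lead_coeff (\<Phi> n) = 1) \<and>
     (\<forall>m n. m \<noteq> n \<longrightarrow> (\<integral>z. cnj (poly (\<Phi> m) z) * poly (\<Phi> n) z \<partial>\<mu>) = 0)"

definition szego_star :: "complex poly \<Rightarrow> complex poly" where
  "szego_star p = reflect_poly (map_poly cnj p)"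

lemma poly_szego_star:
  assumes "z \<noteq> 0"
  shows "poly (szego_star p) z = z ^ degree p * cnj (poly p (1 / cnj z))"
  using assms
  by (simp add: szego_star_def poly_reflect_poly_nz degree_map_poly inverse_eq_divide)

(* The monic orthogonal polynomials of a nontrivial measure exist and are unique, and the
   recursion determines alpha n (evaluate it at 0), so such an alpha exists and is unique. *)
definition verblunsky_coeffs :: "complex measure \<Rightarrow> (nat \<Rightarrow> complex) \<Rightarrow> bool" where
  "verblunsky_coeffs \<mu> \<alpha> \<longleftrightarrow>
     (\<exists>\<Phi>. monic_orthogonal_polys \<mu> \<Phi> \<and>
       (\<forall>n z. poly (\<Phi> (Suc n)) z = z * poly (\<Phi> n) z - cnj (\<alpha> n) * poly (szego_star (\<Phi> n)) z))"

end

theory Submission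
  imports Defs "HOL-Real_Asymp.Real_Asymp"
begin

text \<open>
  On the circle the Szego recursion is a product of matrices in \<open>SU(1,1)\<close>, which act on the disc by hyperbolic
  isometries, so all its solutions at \<open>z\<close> are bounded as soon as the disc action
  \<open>q(n+1) - z q(n) = -z cnj(\<alpha>(n)) + \<alpha>(n) q(n) q(n+1)\<close> has an orbit up to summable errors that tends to \<open>0\<close>.
  Such an orbit is obtained by expanding in powers of \<open>\<alpha>\<close>: the terms are indexed by binary trees, only odd
  degrees occur, and terms of degree \<open>p\<close> or more are summable. Each tree of size \<open>k\<close> brings \<open>k \<le> p - 2\<close> small
  denominators \<open>z - e\<^sup>i\<^sup>x\<close>; the resulting series converges off the set where certain potentials of order
  \<open>\<beta>(p - 2)\<close> of finite discrete measures are infinite, and that set has dimension at most \<open>\<beta>(p - 2)\<close>.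

  On a set where all solutions are bounded by \<open>M\<close>, \<open>\<mu>\<close> and the arc length have the same null sets.
  Perturbing the spectral parameter shows that the reproducing kernel stays large on discs of radius \<open>O(1/n)\<close>,
  so these have measure \<open>O(1/n)\<close>; conversely the Christoffel functions are at least \<open>1/(M\<^sup>2(n+1))\<close>, and testing
  them against Fejer polynomials bounds the arc length of a compact set by its measure.
\<close>

section \<open>Hausdorff measure of potential-theoretic exceptional sets\<close>

text \<open>The comparison of null sets is used in both directions. The singular part is carried by
  a set \<open>N\<close> of arc length zero; on each level \<open>sol_bounded \<alpha> M\<close>
  such a set is also \<mu>-null, so \<mu>s lives on the complement \<open>S\<close> of the levels.
  Conversely, the points of a level that lie outside \<open>N\<close> and have \<open>w = 0\<close>
  carry no \<mu>-mass, hence their angles form a Lebesgue null set. The hypothesis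
  \<open>\<beta> * (p - 2) < 1\<close> enters twice: it gives \<open>S\<close> arc length zero, and
  it forces \<open>\<beta> \<le> 1\<close>, so that \<open>x powr \<beta>\<close> is subadditive.
  The obstacle in the expansion is that the denominators of one tree may be small simultaneously.
  Passing to powers \<beta> lets the smallest denominator stand for all of them; with up to
  \<open>p - 2\<close> of them this produces the exponent \<open>\<beta> * (p - 2)\<close>.\<close>

lemma finite_net_of_card_bound:
  fixes E :: "'a::metric_space set"
  assumes bound: "\<And>F. finite F \<Longrightarrow> F \<subseteq> E \<Longrightarrow> (\<And>x y. x \<in> F \<Longrightarrow> y \<in> F \<Longrightarrow> x \<noteq> y \<Longrightarrow> r < dist x y) \<Longrightarrow>
      real (card F) \<le> N"
    and "0 \<le> r"
  obtains F where "finite F" "F \<subseteq> E" "real (card F) \<le> N" "E \<subseteq> (\<Union>x\<in>F. cball x r)"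
proof -
  define P where "P F \<longleftrightarrow> finite F \<and> F \<subseteq> E \<and> (\<forall>x\<in>F. \<forall>y\<in>F. x \<noteq> y \<longrightarrow> r < dist x y)" for F
  have P0: "P {}" by (simp add: P_def)
  have le: "card F \<le> nat \<lfloor>N\<rfloor>" if "P F" for F
    using bound[of F] that unfolding P_def by (simp add: le_nat_floor)
  \<comment> \<open>The cardinality bound provides a separated set of maximal size; a point left
    uncovered by its balls could be added to it. In this way packing bounds become covering
    bounds.\<close>
  obtain F where F: "P F" and max: "\<And>G. P G \<Longrightarrow> card G \<le> card F"
    using ex_has_greatest_nat[of P "{}" card "Suc (nat \<lfloor>N\<rfloor>)"] P0 le by (auto simp: less_Suc_eq_le)
  have "E \<subseteq> (\<Union>x\<in>F. cball x r)"
  proof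
    fix z assume z: "z \<in> E"
    show "z \<in> (\<Union>x\<in>F. cball x r)"
    proof (rule ccontr)
      assume n: "z \<notin> (\<Union>x\<in>F. cball x r)"
      then have d: "r < dist x z" if "x \<in> F" for x using that by force
      then have "P (insert z F)" using F z unfolding P_def by (auto simp: dist_commute)
      moreover have "z \<notin> F" using d \<open>0 \<le> r\<close> by force
      ultimately show False using max[of "insert z F"] F by (simp add: P_def)
    qed
  qed
  then show thesis using that F bound[of F] by (auto simp: P_def)
qed

lemma diameter_cball_le:
  fixes x :: "'a::metric_space"
  assumes "0 \<le> r"
  shows "diameter (cball x r) \<le> 2 * r"
proof -
  have "dist y z \<le> 2 * r" if "y \<in> cball x r" "z \<in> cball x r" for y z
    using that dist_triangle2[of y z x] by (simp add: dist_commute)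
  moreover have "cball x r \<times> cball x r \<noteq> {}" using assms by auto
  ultimately show ?thesis
    unfolding diameter_def using assms by (auto intro!: cSUP_least)
qed

lemma hausdorff_measure_mono: "S \<subseteq> T \<Longrightarrow> hausdorff_measure s S \<le> hausdorff_measure s T"
  unfolding hausdorff_measure_def hausdorff_premeasure_def
  by (intro SUP_mono' INF_superset_mono) auto

lemma hausdorff_measure_eq_0I:
  assumes "0 < s"
    and cov: "\<And>e. 0 < e \<Longrightarrow> \<exists>U :: nat \<Rightarrow> 'a set. S \<subseteq> (\<Union>i. U i) \<and> (\<forall>i. bounded (U i) \<and> diameter (U i) \<le> e) \<and>
        (\<Sum>i. ennreal (diameter (U i) powr s)) \<le> ennreal e"
  shows "hausdorff_measure s (S :: 'a::metric_space set) = 0"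
proof -
  have "hausdorff_premeasure s \<delta> S = 0" if "0 < \<delta>" for \<delta>
  proof -
    have "hausdorff_premeasure s \<delta> S \<le> 0 + ennreal e" if "0 < e" for e
    proof -
      have "0 < min e \<delta>" using \<open>0 < e\<close> \<open>0 < \<delta>\<close> by simp
      from cov[OF this] obtain U :: "nat \<Rightarrow> 'a set" where U: "S \<subseteq> (\<Union>i. U i)"
        "\<forall>i. bounded (U i) \<and> diameter (U i) \<le> min e \<delta>"
        "(\<Sum>i. ennreal (diameter (U i) powr s)) \<le> ennreal (min e \<delta>)" by blast
      have "hausdorff_premeasure s \<delta> S \<le> (\<Sum>i. diam_pow s (U i))"
        unfolding hausdorff_premeasure_def by (rule INF_lower) (use U in auto)
      also have "\<dots> \<le> (\<Sum>i. ennreal (diameter (U i) powr s))"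
        by (intro suminf_le) (use \<open>0 < s\<close> in \<open>auto simp: diam_pow_def\<close>)
      also have "\<dots> \<le> ennreal e" using U(3) by (rule order_trans) (auto intro: ennreal_leI)
      finally show ?thesis by simp
    qed
    then show ?thesis using ennreal_le_epsilon[of 0 "hausdorff_premeasure s \<delta> S"] by simp
  qed
  then show ?thesis unfolding hausdorff_measure_def by (simp add: SUP_eq_const)
qed

lemma hausdorff_measure_0_coverE:
  assumes "hausdorff_measure s S = 0" "0 < s" "0 < \<delta>" "0 < e"
  obtains U :: "nat \<Rightarrow> 'a::metric_space set" where "S \<subseteq> (\<Union>i. U i)"
    "\<And>i. bounded (U i)" "\<And>i. diameter (U i) \<le> \<delta>" "(\<Sum>i. ennreal (diameter (U i) powr s)) < ennreal e"
proof -
  have "hausdorff_premeasure s \<delta> S \<le> hausdorff_measure s S"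
    unfolding hausdorff_measure_def by (rule SUP_upper) (use assms in auto)
  then have "hausdorff_premeasure s \<delta> S < ennreal e" using assms by simp
  then obtain U where U: "S \<subseteq> (\<Union>i. U i)" "\<forall>i. bounded (U i) \<and> diameter (U i) \<le> \<delta>"
    "(\<Sum>i. diam_pow s (U i)) < ennreal e"
    unfolding hausdorff_premeasure_def INF_less_iff by auto
  have "diam_pow s (U i) = ennreal (diameter (U i) powr s)" for i
    using \<open>0 < s\<close> by (auto simp: diam_pow_def)
  then show thesis using that U by auto
qed

text \<open>A Borel-Cantelli argument: the cover of scale \<open>k\<close> costs a constant times
  \<open>2 powr ((t - s) * k)\<close>, so the covers of all scales beyond a late \<open>K\<close>
  together cover the limsup set at arbitrarily small cost.\<close>

lemma hausdorff_measure_limsup_eq_0: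
  fixes E :: "nat \<Rightarrow> 'a::metric_space set"
  assumes "0 < s" "t < s" "0 \<le> C"
    and net: "\<And>k. \<exists>F. finite F \<and> real (card F) \<le> C * 2 powr (t * real k) \<and> E k \<subseteq> (\<Union>x\<in>F. cball x (2 * 2 powr (- real k)))"
  shows "hausdorff_measure s {z. \<exists>\<^sub>F k in sequentially. z \<in> E k} = 0"
proof (rule hausdorff_measure_eq_0I[OF \<open>0 < s\<close>])
  fix e :: real assume e: "0 < e"
  obtain F where F: "\<And>k. finite (F k)" "\<And>k. real (card (F k)) \<le> C * 2 powr (t * real k)"
    "\<And>k. E k \<subseteq> (\<Union>x\<in>F k. cball x (2 * 2 powr (- real k)))" using net by metis
  define x where "x k = from_nat_into (F k)" for k
  define D where "D k = (4 :: real) * 2 powr (- real k)" for k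
  define b where "b k = C * 2 powr (t * real k) * D k powr s" for k
  have b_eq: "b k = C * 4 powr s * (2 powr (t - s)) ^ k" for k
  proof -
    have "D k powr s = 4 powr s * 2 powr (- real k * s)" by (simp add: D_def powr_mult powr_powr)
    moreover have "2 powr (t * real k) * 2 powr (- real k * s) = (2 powr (t - s)) powr real k"
      by (simp add: powr_powr powr_add[symmetric] algebra_simps)
    ultimately show ?thesis by (simp add: b_def powr_realpow)
  qed
  have "2 powr (t - s) < 1" using \<open>t < s\<close> by (subst powr_less_one) auto
  then have sb: "summable b" unfolding b_eq[abs_def] by (intro summable_mult summable_geometric) simp
  have b0: "0 \<le> b k" for k using \<open>0 \<le> C\<close> by (simp add: b_def)
  have "(\<lambda>K. \<Sum>k. b (k + K)) \<longlonglongrightarrow> 0" using sb by (rule suminf_exist_split2)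
  then have ev1: "\<forall>\<^sub>F K in sequentially. (\<Sum>k. b (k + K)) < e" using e by (rule order_tendstoD)
  have "D \<longlonglongrightarrow> 0" unfolding D_def by real_asymp
  then have ev2: "\<forall>\<^sub>F K in sequentially. D K < e" using e by (rule order_tendstoD)
  obtain K where K: "(\<Sum>k. b (k + K)) < e" "D K < e"
    using eventually_happens'[OF _ eventually_conj[OF ev1 ev2]] by auto
  \<comment> \<open>The covers of the scales from \<open>K\<close> on, as one double sequence padded
    by empty sets of diameter 0; \<open>prod_decode\<close> turns it into a single sequence.\<close>
  define V where "V = (\<lambda>(k, j). if j < card (F (k + K)) then cball (x (k + K) j) (2 * 2 powr (- real (k + K))) else {})"
  define U where "U i = V (prod_decode i)" for i
  have Ddec: "D (k + K) \<le> D K" for k by (simp add: D_def)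
  have diamV: "bounded (V (k, j)) \<and> diameter (V (k, j)) \<le> (if j < card (F (k + K)) then D (k + K) else 0)" for k j
    using diameter_cball_le[of "2 * 2 powr (- real (k + K))" "x (k + K) j"] by (simp add: V_def D_def)
  have D0: "0 \<le> D k" for k by (simp add: D_def)
  show "\<exists>U. {z. \<exists>\<^sub>F k in sequentially. z \<in> E k} \<subseteq> (\<Union>i. U i) \<and> (\<forall>i. bounded (U i) \<and> diameter (U i) \<le> e) \<and>
        (\<Sum>i. ennreal (diameter (U i) powr s)) \<le> ennreal e"
  proof (intro exI[of _ U] conjI allI)
    show "{z. \<exists>\<^sub>F k in sequentially. z \<in> E k} \<subseteq> (\<Union>i. U i)"
    proof safe
      fix z assume "\<exists>\<^sub>F k in sequentially. z \<in> E k"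
      then obtain k where k: "k \<ge> K" "z \<in> E k" unfolding frequently_sequentially by blast
      then obtain y where y: "y \<in> F k" "z \<in> cball y (2 * 2 powr (- real k))" using F(3) by blast
      have "bij_betw (x k) {..<card (F k)} (F k)" unfolding x_def by (rule bij_betw_from_nat_into_finite[OF F(1)])
      then have "y \<in> x k ` {..<card (F k)}" using y(1) by (simp add: bij_betw_imp_surj_on)
      then obtain j where j: "j < card (F k)" "x k j = y" by (elim imageE) (metis lessThan_iff)
      have "z \<in> V (k - K, j)" using k j y by (simp add: V_def of_nat_diff)
      then have "z \<in> U (prod_encode (k - K, j))" by (simp add: U_def)
      then show "z \<in> (\<Union>i. U i)" by blast
    qed
    show "bounded (U i)" "diameter (U i) \<le> e" for i
    proof -
      obtain k j where kj: "prod_decode i = (k, j)" by fastforce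
      show "bounded (U i)" using diamV[of k j] by (simp add: U_def kj)
      show "diameter (U i) \<le> e" using diamV[of k j] K(2) Ddec[of k] e
        by (simp add: U_def kj split: if_splits)
    qed
    have inner: "(\<Sum>j. ennreal (diameter (V (k, j)) powr s)) \<le> ennreal (b (k + K))" for k
    proof -
      have "(\<Sum>j. ennreal (diameter (V (k, j)) powr s)) = (\<Sum>j<card (F (k + K)). ennreal (diameter (V (k, j)) powr s))"
        by (rule suminf_finite) (auto simp: V_def)
      also have "\<dots> \<le> (\<Sum>j<card (F (k + K)). ennreal (D (k + K) powr s))"
      proof (intro sum_mono ennreal_leI powr_mono2)
        fix j assume "j \<in> {..<card (F (k + K))}"
        then show "diameter (V (k, j)) \<le> D (k + K)" "0 \<le> diameter (V (k, j))"
          using diamV[of k j] by (simp_all add: diameter_ge_0)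
      qed (use \<open>0 < s\<close> in simp)
      also have "\<dots> = ennreal (real (card (F (k + K))) * D (k + K) powr s)"
        by (simp add: ennreal_mult'' ennreal_of_nat_eq_real_of_nat)
      also have "\<dots> \<le> ennreal (b (k + K))"
        unfolding b_def by (intro ennreal_leI mult_right_mono F(2)) simp
      finally show ?thesis .
    qed
    have "(\<Sum>i. ennreal (diameter (U i) powr s)) = (\<Sum>k. \<Sum>j. ennreal (diameter (V (k, j)) powr s))"
      unfolding U_def
      by (rule suminf_ennreal_2dimen[where f = "\<lambda>q. ennreal (diameter (V q) powr s)"]) simp
    also have "\<dots> \<le> (\<Sum>k. ennreal (b (k + K)))" by (intro suminf_le inner) auto
    also have "\<dots> = ennreal (\<Sum>k. b (k + K))"
      using sb b0 by (intro suminf_ennreal2) (auto simp: summable_iff_shift)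
    also have "\<dots> \<le> ennreal e" using K(1) by (intro ennreal_leI) simp
    finally show "(\<Sum>i. ennreal (diameter (U i) powr s)) \<le> ennreal e" .
  qed
qed

text \<open>The potential of a finite discrete measure is infinite only at points around which, at infinitely
  many dyadic scales, the mass of a ball exceeds a fixed power of the radius.\<close>

lemma hausdorff_measure_potential_infinite:
  fixes \<xi> :: "'i \<Rightarrow> 'a::metric_space" and m :: "'i \<Rightarrow> real"
  assumes sm: "m summable_on I" and m_pos: "\<And>i. i \<in> I \<Longrightarrow> 0 < m i" and "0 < \<kappa>" "\<kappa> < s"
  shows "hausdorff_measure s {z. (\<exists>i\<in>I. z = \<xi> i) \<or> \<not> (\<lambda>i. m i * dist z (\<xi> i) powr (- \<kappa>)) summable_on I} = 0"
proof -
  \<comment> \<open>Any exponent strictly between would do: \<open>\<kappa> < t\<close> makes the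
    dyadic potential sum converge, \<open>t < s\<close> makes the covers of the heavy points
    cheap.\<close>
  define t where "t = (\<kappa> + s) / 2"
  have t: "\<kappa> < t" "t < s" using \<open>\<kappa> < s\<close> by (auto simp: t_def)
  define J where "J z k = {i \<in> I. dist z (\<xi> i) \<le> 2 powr (- real k)}" for z k
  define mm where "mm z k = infsum m (J z k)" for z k
  define C where "C = infsum m I"
  have m0: "0 \<le> m i" if "i \<in> I" for i using m_pos[OF that] by simp
  have smJ: "m summable_on J z k" for z k by (rule summable_on_subset_banach[OF sm]) (auto simp: J_def)
  have C0: "0 \<le> C" unfolding C_def by (intro infsum_nonneg m0)
  have mm0: "0 \<le> mm z k" for z k unfolding mm_def by (intro infsum_nonneg m0) (auto simp: J_def)
  define E where "E k = {z. 2 powr (- (t * real k)) \<le> mm z k}" for k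
  have "hausdorff_measure s {z. \<exists>\<^sub>F k in sequentially. z \<in> E k} = 0"
  proof (rule hausdorff_measure_limsup_eq_0[of s t C])
    show "0 < s" "t < s" "0 \<le> C" using t assms C0 by auto
    fix k
    have "real (card F) \<le> C * 2 powr (t * real k)"
      if F: "finite F" "F \<subseteq> E k" "\<And>x y. x \<in> F \<Longrightarrow> y \<in> F \<Longrightarrow> x \<noteq> y \<Longrightarrow> 2 * 2 powr (- real k) < dist x y" for F
    proof -
      \<comment> \<open>Separation by more than two radii makes the balls disjoint, so their masses,
        each at least \<open>2 powr (- (t * real k))\<close>, add up to at most the total mass
        \<open>C\<close>.\<close>
      have disj: "J x k \<inter> J y k = {}" if "x \<in> F" "y \<in> F" "x \<noteq> y" for x y
      proof -
        have False if "i \<in> J x k" "i \<in> J y k" for i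
          using that F(3)[OF \<open>x \<in> F\<close> \<open>y \<in> F\<close> \<open>x \<noteq> y\<close>] dist_triangle2[of x y "\<xi> i"] by (auto simp: J_def)
        then show ?thesis by auto
      qed
      have "real (card F) * 2 powr (- (t * real k)) = (\<Sum>x\<in>F. 2 powr (- (t * real k)))" by simp
      also have "\<dots> \<le> (\<Sum>x\<in>F. mm x k)" using F(2) by (intro sum_mono) (auto simp: E_def)
      also have "\<dots> = infsum m (\<Union>x\<in>F. J x k)"
        unfolding mm_def by (rule sum_infsum) (use F(1) smJ disj in auto)
      also have "\<dots> \<le> C" unfolding C_def
        by (intro infsum_mono2 sm summable_on_subset_banach[OF sm] m0) (auto simp: J_def)
      finally show ?thesis by (simp add: powr_minus field_simps)
    qed
    then obtain F where "finite F" "F \<subseteq> E k" "real (card F) \<le> C * 2 powr (t * real k)"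
      "E k \<subseteq> (\<Union>x\<in>F. cball x (2 * 2 powr (- real k)))"
      using finite_net_of_card_bound[of "E k" "2 * 2 powr (- real k)"] by (metis (no_types, lifting) mult_nonneg_nonneg powr_ge_zero zero_le_numeral)
    then show "\<exists>F. finite F \<and> real (card F) \<le> C * 2 powr (t * real k) \<and> E k \<subseteq> (\<Union>x\<in>F. cball x (2 * 2 powr (- real k)))"
      by blast
  qed
  moreover have "\<exists>\<^sub>F k in sequentially. z \<in> E k"
    if z: "(\<exists>i\<in>I. z = \<xi> i) \<or> \<not> (\<lambda>i. m i * dist z (\<xi> i) powr (- \<kappa>)) summable_on I" for z
  proof (rule ccontr)
    assume "\<not> (\<exists>\<^sub>F k in sequentially. z \<in> E k)"
    then obtain K where K: "\<And>k. k \<ge> K \<Longrightarrow> mm z k < 2 powr (- (t * real k))"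
      unfolding not_frequently eventually_sequentially E_def by (auto simp: not_le)
    \<comment> \<open>An atom at \<open>z\<close> would keep the mass of every ball around
      \<open>z\<close> above \<open>m i\<close>, against the decay of \<open>mm z k\<close>.\<close>
    have ne: "z \<noteq> \<xi> i" if i: "i \<in> I" for i
    proof
      assume "z = \<xi> i"
      then have "i \<in> J z k" for k using i by (simp add: J_def)
      then have "m i \<le> mm z k" for k
        unfolding mm_def using finite_sum_le_infsum[OF smJ, where B = "{i}"] m0 by (auto simp: J_def)
      then have "m i < 2 powr (- (t * real k))" if "k \<ge> K" for k using K[OF that] by (meson le_less_trans)
      moreover have "(\<lambda>k. 2 powr (- (t * real k))) \<longlonglongrightarrow> 0" using t \<open>0 < \<kappa>\<close> by real_asymp
      then have "\<forall>\<^sub>F k in sequentially. 2 powr (- (t * real k)) < m i"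
        using m_pos[OF i] by (rule order_tendstoD)
      then obtain k where "k \<ge> K" "2 powr (- (t * real k)) < m i"
        unfolding eventually_sequentially by (meson nle_le)
      ultimately show False by (meson less_asym)
    qed
    \<comment> \<open>Bounds the contribution of the shell
      \<open>2 powr (- (k + 1)) < dist \<le> 2 powr (- k)\<close>, where
      \<open>dist powr (- \<kappa>)\<close> is at most
      \<open>2 powr (\<kappa> * (k + 1))\<close>.\<close>
    define b where "b k = 2 powr (\<kappa> * (real k + 1)) * mm z k" for k
    have b0: "0 \<le> b k" for k by (simp add: b_def mm0)
    have "summable b"
    proof (rule summable_comparison_test_ev)
      show "\<forall>\<^sub>F k in sequentially. norm (b k) \<le> 2 powr \<kappa> * (2 powr (\<kappa> - t)) ^ k"
        unfolding eventually_sequentially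
      proof (intro exI[of _ K] allI impI)
        fix k assume "k \<ge> K"
        have "b k \<le> 2 powr (\<kappa> * (real k + 1)) * 2 powr (- (t * real k))"
          unfolding b_def using K[OF \<open>k \<ge> K\<close>] by (intro mult_left_mono) auto
        also have "\<dots> = 2 powr \<kappa> * (2 powr (\<kappa> - t)) powr real k"
          by (simp add: powr_powr powr_add[symmetric] algebra_simps)
        finally show "norm (b k) \<le> 2 powr \<kappa> * (2 powr (\<kappa> - t)) ^ k" using b0[of k] by (simp add: powr_realpow)
      qed
      have "2 powr (\<kappa> - t) < 1" using t by (subst powr_less_one) auto
      then show "summable (\<lambda>k. 2 powr \<kappa> * (2 powr (\<kappa> - t)) ^ k)"
        by (intro summable_mult summable_geometric) simp
    qed
    have "(\<lambda>i. m i * dist z (\<xi> i) powr (- \<kappa>)) summable_on I"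
    proof (rule nonneg_bdd_above_summable_on)
      show "\<And>i. i \<in> I \<Longrightarrow> 0 \<le> m i * dist z (\<xi> i) powr (- \<kappa>)" by (simp add: m0)
      have "(\<Sum>i\<in>F. m i * dist z (\<xi> i) powr (- \<kappa>)) \<le> C + suminf b" if F: "finite F" "F \<subseteq> I" for F
      proof -
        \<comment> \<open>Finitely many points stay at a positive distance, so only shells with
          \<open>k < N\<close> can contain one of them. Points farther away than 1 are absorbed by
          the summand 1 in \<open>pt\<close>.\<close>
        define d where "d = Min (insert 1 ((\<lambda>i. dist z (\<xi> i)) ` F))"
        have d: "0 < d" "\<And>i. i \<in> F \<Longrightarrow> d \<le> dist z (\<xi> i)"
          unfolding d_def using F ne by (auto simp: Min_gr_iff)
        have "(\<lambda>k. 2 powr (- real k)) \<longlonglongrightarrow> 0" by real_asymp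
        then have "\<forall>\<^sub>F k in sequentially. 2 powr (- real k) < d" using d(1) by (rule order_tendstoD)
        then obtain N where N: "2 powr (- real N) < d" unfolding eventually_sequentially by blast
        have pt: "dist z (\<xi> i) powr (- \<kappa>) \<le> 1 + (\<Sum>k<N. 2 powr (\<kappa> * (real k + 1)) * indicator (J z k) i)"
          if i: "i \<in> F" for i
        proof (cases "1 < dist z (\<xi> i)")
          case True
          then have "dist z (\<xi> i) powr (- \<kappa>) \<le> 1" using \<open>0 < \<kappa>\<close> by (simp add: powr_minus inverse_le_1_iff ge_one_powr_ge_zero)
          then show ?thesis by (simp add: add_increasing2 sum_nonneg)
        next
          case False
          let ?x = "dist z (\<xi> i)"
          have x: "0 < ?x" "?x \<le> 1" "d \<le> ?x" using d(1) d(2)[OF i] False by linarith+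
          define k where "k = (LEAST j. 2 powr (- real (Suc j)) < ?x)"
          have ex: "2 powr (- real (Suc N)) < ?x" 
          proof -
            have "2 powr (- real (Suc N)) < (2::real) powr (- real N)" by (rule powr_less_mono) auto
            then show ?thesis using N x(3) by linarith
          qed
          have k1: "2 powr (- real (Suc k)) < ?x" unfolding k_def by (rule LeastI[of "\<lambda>j. 2 powr (- real (Suc j)) < ?x", OF ex])
          have k2: "?x \<le> 2 powr (- real k)"
          proof (cases k)
            case (Suc j)
            then have "\<not> 2 powr (- real (Suc j)) < ?x" unfolding k_def by (metis k_def lessI not_less_Least)
            then show ?thesis using Suc by simp
          qed (use x in simp)
          have "2 powr (- real N) < 2 powr (- real k)" using N x(3) k2 by linarith
          then have "k < N" by simp
          have "?x powr (- \<kappa>) \<le> (2 powr (- real (Suc k))) powr (- \<kappa>)"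
            using k1 \<open>0 < \<kappa>\<close> by (intro powr_mono2') auto
          also have "\<dots> = 2 powr (\<kappa> * (real k + 1)) * indicator (J z k) i"
            using k2 i F by (auto simp: powr_powr J_def algebra_simps)
          also have "\<dots> \<le> (\<Sum>k<N. 2 powr (\<kappa> * (real k + 1)) * indicator (J z k) i)"
            by (rule member_le_sum) (use \<open>k < N\<close> in auto)
          finally show ?thesis by simp
        qed
        have "(\<Sum>i\<in>F. m i * dist z (\<xi> i) powr (- \<kappa>))
            \<le> (\<Sum>i\<in>F. m i * (1 + (\<Sum>k<N. 2 powr (\<kappa> * (real k + 1)) * indicator (J z k) i)))"
          using F by (intro sum_mono mult_left_mono pt m0) auto
        also have "\<dots> = sum m F + (\<Sum>k<N. 2 powr (\<kappa> * (real k + 1)) * (\<Sum>i\<in>F. m i * indicator (J z k) i))"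
        proof -
          have "(\<Sum>k<N. 2 powr (\<kappa> * (real k + 1)) * (\<Sum>i\<in>F. m i * indicator (J z k) i))
              = (\<Sum>i\<in>F. \<Sum>k<N. m i * (2 powr (\<kappa> * (real k + 1)) * indicator (J z k) i))"
            by (subst sum.swap) (simp only: sum_distrib_left mult.left_commute)
          then show ?thesis by (simp only: distrib_left mult_1_right sum.distrib sum_distrib_left)
        qed
        also have "\<dots> \<le> C + (\<Sum>k<N. b k)"
        proof (intro add_mono sum_mono)
          show "sum m F \<le> C" unfolding C_def by (rule finite_sum_le_infsum[OF sm F]) (use m0 in auto)
          fix k
          have "(\<Sum>i\<in>F. m i * indicator (J z k) i) = (\<Sum>i\<in>F. if i \<in> J z k then m i else 0)"
            by (intro sum.cong) (auto simp: indicator_def)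
          also have "\<dots> = sum m (F \<inter> J z k)" using sum.inter_restrict[OF F(1), of m "J z k"] by simp
          also have "\<dots> \<le> mm z k" unfolding mm_def
            by (rule finite_sum_le_infsum[OF smJ]) (use F m0 in \<open>auto simp: J_def\<close>)
          finally show "2 powr (\<kappa> * (real k + 1)) * (\<Sum>i\<in>F. m i * indicator (J z k) i) \<le> b k"
            unfolding b_def by (intro mult_left_mono) auto
        qed
        also have "\<dots> \<le> C + suminf b" using \<open>summable b\<close> b0 by (intro add_left_mono sum_le_suminf) auto
        finally show ?thesis .
      qed
      then show "bdd_above (sum (\<lambda>i. m i * dist z (\<xi> i) powr (- \<kappa>)) ` {F. F \<subseteq> I \<and> finite F})"
        by (intro bdd_aboveI2[where M = "C + suminf b"]) auto
    qed
    then show False using z ne by blast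
  qed
  then have "hausdorff_measure s {z. (\<exists>i\<in>I. z = \<xi> i) \<or> \<not> (\<lambda>i. m i * dist z (\<xi> i) powr (- \<kappa>)) summable_on I}
      \<le> hausdorff_measure s {z. \<exists>\<^sub>F k in sequentially. z \<in> E k}"
    by (intro hausdorff_measure_mono Collect_mono impI)
  ultimately show ?thesis by simp
qed

lemma hausdorff_dim_leI:
  assumes "0 \<le> \<kappa>" "\<And>s. \<kappa> < s \<Longrightarrow> hausdorff_measure s S = 0"
  shows "hausdorff_dim S \<le> ennreal \<kappa>"
proof (rule ennreal_le_epsilon)
  fix e :: real assume "0 < e"
  have "hausdorff_dim S \<le> ennreal (\<kappa> + e)"
    unfolding hausdorff_dim_def by (rule INF_lower) (use assms \<open>0 < e\<close> in auto)
  then show "hausdorff_dim S \<le> ennreal \<kappa> + ennreal e" using assms(1) \<open>0 < e\<close> by (simp add: ennreal_plus)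
qed

section \<open>Formal solution indexed by trees\<close>

text \<open>A leaf is a summand of \<open>-z cnj(\<alpha>(n))\<close>; \<open>Node l A B\<close> is the contribution to \<open>\<alpha>(n) q(n) q(n+1)\<close> of the
  \<open>l\<close>-th summand of \<open>\<alpha>(n)\<close> and of the terms \<open>A\<close> and \<open>B\<close> of the series for \<open>q(n)\<close> and \<open>q(n+1)\<close>.\<close>

datatype otree = Leaf nat | Node nat otree otree

primrec tsize :: "otree \<Rightarrow> nat" where
  "tsize (Leaf k) = 1"
| "tsize (Node l A B) = 1 + tsize A + tsize B"

text \<open>Subtrees are listed with multiplicity: each occurrence contributes one denominator to
  \<open>amp\<close>.\<close>

primrec subs :: "otree \<Rightarrow> otree list" where
  "subs (Leaf k) = [Leaf k]"
| "subs (Node l A B) = Node l A B # subs A @ subs B"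

text \<open>A term oscillates like \<open>cis (n * freq \<phi> t)\<close>: the conjugated
  coefficients at the leaves rotate with \<open>+\<phi>\<close>, the unconjugated ones at the nodes
  with \<open>-\<phi>\<close>.\<close>

primrec freq :: "(nat \<Rightarrow> real) \<Rightarrow> otree \<Rightarrow> real" where
  "freq \<phi> (Leaf k) = \<phi> k"
| "freq \<phi> (Node l A B) = freq \<phi> A + freq \<phi> B - \<phi> l"

primrec weight :: "(nat \<Rightarrow> real) \<Rightarrow> otree \<Rightarrow> real" where
  "weight a (Leaf k) = a k"
| "weight a (Node l A B) = a l * weight a A * weight a B"

primrec env :: "(nat \<Rightarrow> nat \<Rightarrow> complex) \<Rightarrow> otree \<Rightarrow> nat \<Rightarrow> complex" where
  "env \<gamma> (Leaf k) n = cnj (\<gamma> k n)"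
| "env \<gamma> (Node l A B) n = \<gamma> l n * env \<gamma> A n * env \<gamma> B n"

text \<open>A term has the form \<open>amp * cis (n * freq) * env n\<close>. With the envelope
  frozen, forming \<open>q(n+1) - z q(n)\<close> multiplies it by \<open>cis freq - z\<close>,
  whence the denominators; the factor \<open>cis (freq \<phi> B)\<close> appears because
  \<open>B\<close> enters through \<open>q(n+1)\<close>.\<close>

primrec amp :: "(nat \<Rightarrow> complex) \<Rightarrow> (nat \<Rightarrow> real) \<Rightarrow> complex \<Rightarrow> otree \<Rightarrow> complex" where
  "amp c \<phi> z (Leaf k) = - z * cnj (c k) / (cis (\<phi> k) - z)"
| "amp c \<phi> z (Node l A B) = c l * amp c \<phi> z A * amp c \<phi> z B * cis (freq \<phi> B) / (cis (freq \<phi> A + freq \<phi> B - \<phi> l) - z)"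

definition trees_upto :: "nat \<Rightarrow> otree set" where
  "trees_upto d = {t. tsize t \<le> d}"

lemma tsize_pos [simp]: "0 < tsize t"
  by (cases t) auto

lemma odd_tsize: "odd (tsize t)"
  by (induction t) auto

lemma length_subs [simp]: "length (subs t) = tsize t"
  by (induction t) auto

lemma weight_pos: "(\<And>k. 0 < a k) \<Longrightarrow> 0 < weight a t"
  by (induction t) auto

lemma weight_powr: "(\<And>k. 0 < a k) \<Longrightarrow> weight (\<lambda>k. a k powr \<beta>) t = weight a t powr \<beta>"
  by (induction t) (auto simp: powr_mult weight_pos less_imp_le)

lemma trees_upto_subset:
  "trees_upto (Suc d) \<subseteq> range Leaf \<union> (\<lambda>(l, A, B). Node l A B) ` (UNIV \<times> trees_upto d \<times> trees_upto d)"
proof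
  fix t assume "t \<in> trees_upto (Suc d)"
  then show "t \<in> range Leaf \<union> (\<lambda>(l, A, B). Node l A B) ` (UNIV \<times> trees_upto d \<times> trees_upto d)"
    by (cases t) (auto simp: trees_upto_def image_iff)
qed

section \<open>Absolutely convergent sums over products and trees\<close>

lemma abs_summable_on_mult_Times:
  fixes f :: "'a \<Rightarrow> 'c::real_normed_field" and g :: "'b \<Rightarrow> 'c"
  assumes "(\<lambda>x. norm (f x)) summable_on A" "(\<lambda>x. norm (g x)) summable_on B"
  shows "(\<lambda>p. norm (f (fst p) * g (snd p))) summable_on A \<times> B"
proof -
  have "(\<lambda>y. norm (f x * g y)) summable_on B" for x
    using summable_on_cmult_right[OF assms(2), of "norm (f x)"] by (simp add: norm_mult)
  moreover have "(\<lambda>x. norm (f x) * infsum (\<lambda>y. norm (g y)) B) summable_on A"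
    by (rule summable_on_cmult_left[OF assms(1)])
  then have "(\<lambda>x. infsum (\<lambda>y. norm (f x * g y)) B) summable_on A"
    by (simp add: norm_mult infsum_cmult_right')
  ultimately show ?thesis
    using Infinite_Sum.abs_summable_on_Sigma_iff[of "\<lambda>p. f (fst p) * g (snd p)" A "\<lambda>_. B"]
    by (simp add: infsum_nonneg)
qed

lemma infsum_mult_Times:
  fixes f :: "'a \<Rightarrow> complex" and g :: "'b \<Rightarrow> complex"
  assumes "(\<lambda>x. norm (f x)) summable_on A" "(\<lambda>x. norm (g x)) summable_on B"
  shows "infsum (\<lambda>p. f (fst p) * g (snd p)) (A \<times> B) = infsum f A * infsum g B"
proof -
  have "(\<lambda>p. f (fst p) * g (snd p)) summable_on A \<times> B"
    by (rule abs_summable_summable[OF abs_summable_on_mult_Times[OF assms]])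
  then have "infsum (\<lambda>p. f (fst p) * g (snd p)) (A \<times> B) = (\<Sum>\<^sub>\<infinity>x\<in>A. \<Sum>\<^sub>\<infinity>y\<in>B. f x * g y)"
    using infsum_Sigma'_banach[of "\<lambda>x y. f x * g y" A "\<lambda>_. B"] by (simp add: case_prod_unfold)
  also have "\<dots> = infsum f A * infsum g B"
    by (simp add: infsum_cmult_right' infsum_cmult_left')
  finally show ?thesis .
qed

text \<open>Induction on the size bound: a tree that is not a leaf is an index with two smaller
  trees, and the weight factors over this triple.\<close>

lemma summable_weight:
  assumes "a summable_on UNIV" "\<And>k. 0 < a k"
  shows "weight a summable_on trees_upto d"
proof (induction d)
  case 0
  have "trees_upto 0 = {}" by (auto simp: trees_upto_def)
  then show ?case by simp
next
  case (Suc d)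
  have nn: "0 \<le> weight a t" for t using weight_pos[of a t] assms(2) by (simp add: less_imp_le)
  have a: "(\<lambda>x. norm (a x)) summable_on UNIV" and w: "(\<lambda>x. norm (weight a x)) summable_on trees_upto d"
    using assms Suc by (simp_all add: nn less_imp_le)
  have "weight a summable_on range Leaf"
    using assms(1) by (subst summable_on_reindex) (auto simp: inj_def o_def)
  moreover have "weight a summable_on (\<lambda>(l, A, B). Node l A B) ` (UNIV \<times> trees_upto d \<times> trees_upto d)"
  proof (subst summable_on_reindex)
    show "inj_on (\<lambda>(l, A, B). Node l A B) (UNIV \<times> trees_upto d \<times> trees_upto d)" by (auto simp: inj_on_def)
    have "(\<lambda>p. norm (a (fst p) * (weight a (fst (snd p)) * weight a (snd (snd p))))) summable_on UNIV \<times> trees_upto d \<times> trees_upto d"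
      by (rule abs_summable_on_mult_Times[OF a abs_summable_on_mult_Times[OF w w]])
    then show "(weight a \<circ> (\<lambda>(l, A, B). Node l A B)) summable_on UNIV \<times> trees_upto d \<times> trees_upto d"
      by (simp add: o_def case_prod_unfold mult_ac nn less_imp_le[OF assms(2)] abs_mult)
  qed
  ultimately show ?case
    using summable_on_union summable_on_subset_banach[OF _ trees_upto_subset] by blast
qed

section \<open>Small denominators\<close>

lemma norm_amp_le:
  assumes "\<And>k. norm (c k) \<le> a k" "norm z = 1"
  shows "norm (amp c \<phi> z t) \<le> weight a t * prod_list (map (\<lambda>s. inverse (norm (z - cis (freq \<phi> s)))) (subs t))"
proof (induction t)
  case (Leaf k)
  have "norm (amp c \<phi> z (Leaf k)) = norm (c k) * inverse (norm (z - cis (\<phi> k)))"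
    using assms(2) by (simp add: norm_mult norm_divide divide_inverse norm_inverse norm_minus_commute[of z])
  also have "\<dots> \<le> a k * inverse (norm (z - cis (\<phi> k)))"
    using assms(1) by (intro mult_right_mono) auto
  finally show ?case by simp
next
  case (Node l A B)
  let ?P = "\<lambda>t. prod_list (map (\<lambda>s. inverse (norm (z - cis (freq \<phi> s)))) (subs t))"
  have w0: "0 \<le> weight a t" for t
    by (induction t) (auto intro!: mult_nonneg_nonneg order_trans[OF norm_ge_zero assms(1)])
  have p0: "0 \<le> ?P t" for t by (rule prod_list_nonneg) auto
  have "norm (amp c \<phi> z (Node l A B))
      = norm (c l) * norm (amp c \<phi> z A) * norm (amp c \<phi> z B) * inverse (norm (z - cis (freq \<phi> (Node l A B))))"
    by (simp add: norm_mult norm_divide divide_inverse norm_inverse norm_minus_commute[of z])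
  also have "\<dots> \<le> a l * (weight a A * ?P A) * (weight a B * ?P B) * inverse (norm (z - cis (freq \<phi> (Node l A B))))"
    using assms(1)[of l] Node w0 p0 order_trans[OF norm_ge_zero assms(1)]
    by (intro mult_right_mono mult_mono) (auto intro!: mult_nonneg_nonneg)
  also have "\<dots> = weight a (Node l A B) * ?P (Node l A B)"
    by simp
  finally show ?case .
qed

text \<open>The largest factor dominates the product, and its \<open>d\<close>-th power is one of
  the summands. Since the factors are at least 1, the exponent may be raised from the length of the
  list to \<open>d\<close>.\<close>

lemma prod_list_le_sum_pow:
  fixes f :: "'a \<Rightarrow> real"
  assumes "\<And>x. x \<in> set xs \<Longrightarrow> 1 \<le> f x" "length xs \<le> d" "xs \<noteq> []"
  shows "prod_list (map f xs) \<le> (\<Sum>x\<in>set xs. f x ^ d)"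
proof -
  define m where "m = Max (f ` set xs)"
  have ne: "f ` set xs \<noteq> {}" using assms(3) by auto
  have le: "f x \<le> m" if "x \<in> set xs" for x using that by (simp add: m_def)
  obtain x0 where x0: "x0 \<in> set xs" "f x0 = m" using Max_in[OF _ ne] unfolding m_def by auto
  have m1: "1 \<le> m" using assms(1)[OF x0(1)] x0(2) by simp
  have "prod_list (map f ys) \<le> m ^ length ys" if "set ys \<subseteq> set xs" for ys
    using that
  proof (induction ys)
    case (Cons y ys)
    have "0 \<le> prod_list (map f ys)" using Cons assms(1) by (intro prod_list_nonneg) (force intro: order_trans[of 0 1])
    then show ?case using Cons le[of y] m1 by (auto intro!: mult_mono)
  qed simp
  from this[of xs] have "prod_list (map f xs) \<le> m ^ length xs" by simp
  also have "\<dots> \<le> m ^ d" using m1 assms(2) by (rule power_increasing[rotated])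
  also have "\<dots> \<le> (\<Sum>x\<in>set xs. f x ^ d)"
    unfolding x0(2)[symmetric] using x0(1) assms(1) by (intro member_le_sum) (auto intro!: zero_le_power intro: order_trans[of 0 1])
  finally show ?thesis .
qed

text \<open>After division by \<open>x + y\<close> both terms lie in the unit interval, where an
  exponent at most 1 does not decrease them.\<close>

lemma powr_add_le_add_powr:
  fixes x y \<beta> :: real
  assumes "0 \<le> x" "0 \<le> y" "0 < \<beta>" "\<beta> \<le> 1"
  shows "(x + y) powr \<beta> \<le> x powr \<beta> + y powr \<beta>"
proof (cases "x + y = 0")
  case False
  have *: "u / (x + y) \<le> (u / (x + y)) powr \<beta>" if "0 \<le> u" "u \<le> x + y" for u
    using that assms False powr_mono'[of \<beta> 1 "u / (x + y)"] by (cases "u = 0") auto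
  have "1 = x / (x + y) + y / (x + y)" using False by (simp flip: add_divide_distrib)
  also have "\<dots> \<le> (x / (x + y)) powr \<beta> + (y / (x + y)) powr \<beta>"
    using assms by (intro add_mono *) auto
  also have "\<dots> = (x powr \<beta> + y powr \<beta>) / (x + y) powr \<beta>"
    using assms by (simp add: powr_divide add_divide_distrib)
  finally show ?thesis using assms False by (simp add: pos_le_divide_eq)
qed (use assms in auto)

text \<open>The bound of a product by the sum of the powers of its factors removes the interaction of the
  small denominators: each of the resulting sums is a potential of a discrete measure.\<close>

lemma summable_amp:
  fixes d :: nat
  assumes c: "\<And>k. norm (c k) \<le> a k" and a: "\<And>k. 0 < a k" and z: "norm z = 1"
    and \<beta>: "0 < \<beta>" "\<beta> \<le> 1"
    and ne: "\<And>t. t \<in> trees_upto d \<Longrightarrow> z \<noteq> cis (freq \<phi> t)"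
    and pot: "(\<lambda>(t, s). weight a t powr \<beta> * dist z (cis (freq \<phi> s)) powr (- (\<beta> * real d)))
        summable_on (SIGMA t:trees_upto d. set (subs t))"
  shows "(\<lambda>t. norm (amp c \<phi> z t)) summable_on trees_upto d"
proof -
  let ?x = "\<lambda>s. norm (z - cis (freq \<phi> s))"
  have sub: "set (subs t) \<subseteq> trees_upto d" if "t \<in> trees_upto d" for t
    using that by (induction t) (auto simp: trees_upto_def)
  \<comment> \<open>Chords have length at most 2, so \<open>2 * inverse (?x s)\<close> is at least
    1, as the product estimate requires; the constant \<open>C\<close> below is the price of this
    factor 2.\<close>
  have x0: "0 < ?x s" "?x s \<le> 2" if "s \<in> trees_upto d" for s
    using ne[OF that] norm_triangle_ineq4[of z "cis (freq \<phi> s)"] z by auto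
  have w0: "0 < weight a t" for t by (rule weight_pos[OF a])
  have powr_sum: "(\<Sum>i\<in>F. g i) powr \<beta> \<le> (\<Sum>i\<in>F. g i powr \<beta>)" if "finite F" "\<And>i. i \<in> F \<Longrightarrow> 0 \<le> g i"
    for F and g :: "otree \<Rightarrow> real"
    using that
  proof (induction F)
    case (insert i F)
    have "(g i + sum g F) powr \<beta> \<le> g i powr \<beta> + sum g F powr \<beta>"
      using insert \<beta> by (intro powr_add_le_add_powr) (auto intro: sum_nonneg)
    then show ?case using insert by (simp; force)
  qed simp
  define C where "C = ((2::real) ^ d) powr \<beta>"
  have key: "norm (amp c \<phi> z t) powr \<beta> \<le> C * (\<Sum>s\<in>set (subs t). weight a t powr \<beta> * dist z (cis (freq \<phi> s)) powr (- (\<beta> * real d)))"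
    if t: "t \<in> trees_upto d" for t
  proof -
    have subt: "s \<in> trees_upto d" if "s \<in> set (subs t)" for s using sub[OF t] that by auto
    have ge0: "0 \<le> (\<Sum>s\<in>set (subs t). (2 * inverse (?x s)) ^ d)" by (intro sum_nonneg) auto
    have "prod_list (map (\<lambda>s. inverse (?x s)) (subs t)) \<le> prod_list (map (\<lambda>s. 2 * inverse (?x s)) (subs t))"
    proof -
      have "prod_list (map (\<lambda>s. inverse (?x s)) ys) \<le> prod_list (map (\<lambda>s. 2 * inverse (?x s)) ys)" for ys
        by (induction ys) (auto intro!: mult_mono prod_list_nonneg)
      then show ?thesis .
    qed
    also have "\<dots> \<le> (\<Sum>s\<in>set (subs t). (2 * inverse (?x s)) ^ d)"
      by (rule prod_list_le_sum_pow)
         (use t subt x0 in \<open>auto simp: trees_upto_def field_simps simp flip: length_0_conv\<close>)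
    finally have "norm (amp c \<phi> z t) \<le> weight a t * (\<Sum>s\<in>set (subs t). (2 * inverse (?x s)) ^ d)"
      using norm_amp_le[OF c z, where \<phi> = \<phi> and t = t] w0[of t] by (meson mult_left_mono less_imp_le order_trans)
    then have "norm (amp c \<phi> z t) powr \<beta> \<le> weight a t powr \<beta> * (\<Sum>s\<in>set (subs t). (2 * inverse (?x s)) ^ d) powr \<beta>"
      using \<beta> w0[of t] by (subst powr_mult[symmetric]) (auto intro!: powr_mono2 ge0)
    also have "\<dots> \<le> weight a t powr \<beta> * (\<Sum>s\<in>set (subs t). ((2 * inverse (?x s)) ^ d) powr \<beta>)"
      by (intro mult_left_mono powr_sum) auto
    also have "\<dots> = weight a t powr \<beta> * (\<Sum>s\<in>set (subs t). C * dist z (cis (freq \<phi> s)) powr (- (\<beta> * real d)))"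
    proof (intro arg_cong2[where f = "(*)"] sum.cong refl)
      fix s assume "s \<in> set (subs t)"
      then have x: "0 < ?x s" using subt x0 by auto
      have "((2 * inverse (?x s)) ^ d) powr \<beta> = C * ((inverse (?x s)) ^ d) powr \<beta>"
        by (simp add: C_def power_mult_distrib powr_mult)
      also have "(inverse (?x s)) ^ d = ?x s powr (- real d)"
        using x by (simp add: powr_minus powr_realpow power_inverse)
      finally show "((2 * inverse (?x s)) ^ d) powr \<beta> = C * dist z (cis (freq \<phi> s)) powr (- (\<beta> * real d))"
        by (simp add: powr_powr dist_norm mult.commute)
    qed
    finally show ?thesis by (simp add: sum_distrib_left mult_ac)
  qed
  have "(\<lambda>t. \<Sum>s\<in>set (subs t). weight a t powr \<beta> * dist z (cis (freq \<phi> s)) powr (- (\<beta> * real d))) summable_on trees_upto d"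
    using summable_on_Sigma_banach[OF pot] by simp
  then have "(\<lambda>t. norm (amp c \<phi> z t) powr \<beta>) summable_on trees_upto d"
    by (intro summable_on_comparison_test[OF summable_on_cmult_right key]) auto
  note sm = this
  \<comment> \<open>Summability of the powers \<beta> bounds each of them by \<open>S\<close>.
    Splitting \<open>x = x powr \<beta> * x powr (1 - \<beta>)\<close>, with the second factor
    bounded in terms of \<open>S\<close>, gives summability of \<open>x\<close> itself.\<close>
  define S where "S = (\<Sum>\<^sub>\<infinity>t\<in>trees_upto d. norm (amp c \<phi> z t) powr \<beta>)"
  show ?thesis
  proof (rule summable_on_comparison_test[OF summable_on_cmult_left[OF sm]])
    fix t assume t: "t \<in> trees_upto d"
    have "norm (amp c \<phi> z t) powr \<beta> \<le> S"
      unfolding S_def using finite_sum_le_infsum[OF sm, where B = "{t}"] t by simp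
    then have "(norm (amp c \<phi> z t) powr \<beta>) powr ((1 - \<beta>) / \<beta>) \<le> S powr ((1 - \<beta>) / \<beta>)"
      using \<beta> by (intro powr_mono2) auto
    then have "norm (amp c \<phi> z t) powr (1 - \<beta>) \<le> S powr ((1 - \<beta>) / \<beta>)"
      using \<beta> by (simp add: powr_powr)
    then have "norm (amp c \<phi> z t) powr \<beta> * norm (amp c \<phi> z t) powr (1 - \<beta>) \<le> norm (amp c \<phi> z t) powr \<beta> * S powr ((1 - \<beta>) / \<beta>)"
      by (intro mult_left_mono) auto
    then show "norm (amp c \<phi> z t) \<le> norm (amp c \<phi> z t) powr \<beta> * S powr ((1 - \<beta>) / \<beta>)"
      by (simp add: powr_add[symmetric])
  qed auto
qed

text \<open>Tonelli for nonnegative terms: finite sums over \<open>n\<close> commute with the sum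
  over \<open>T\<close>, and the majorant \<open>b\<close> is uniform in \<open>N\<close>.\<close>

lemma summable_infsum_exchange:
  fixes F :: "nat \<Rightarrow> 'i \<Rightarrow> real"
  assumes sm: "b summable_on T" and nn: "\<And>n t. t \<in> T \<Longrightarrow> 0 \<le> F n t"
    and bd: "\<And>N t. t \<in> T \<Longrightarrow> (\<Sum>n<N. F n t) \<le> b t"
  shows "summable (\<lambda>n. infsum (F n) T)"
proof (rule summableI_nonneg_bounded)
  have Fb: "F n t \<le> b t" if "t \<in> T" for n t
    using bd[OF that, of "Suc n"] nn[OF that] sum_nonneg[of "{..<n}" "\<lambda>n. F n t"] by simp
  have smF: "F n summable_on T" for n
    by (rule summable_on_comparison_test[OF sm Fb nn])
  show "0 \<le> infsum (F n) T" for n by (intro infsum_nonneg nn)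
  fix N
  have *: "(\<Sum>n<N. infsum (F n) T) = infsum (\<lambda>t. \<Sum>n<N. F n t) T \<and> (\<lambda>t. \<Sum>n<N. F n t) summable_on T"
    by (induction N) (auto simp: infsum_add smF intro: summable_on_add)
  show "(\<Sum>n<N. infsum (F n) T) \<le> infsum b T"
    using * bd sm by (auto intro!: infsum_mono)
qed

section \<open>Slowly varying envelopes and the truncated series\<close>

lemma norm_env_le:
  assumes "\<And>l. norm (\<gamma> l n) \<le> h n"
  shows "norm (env \<gamma> t n) \<le> h n ^ tsize t"
proof (induction t)
  case (Node l A B)
  have h0: "0 \<le> h n" using assms[of l] norm_ge_zero order_trans by blast
  then have "norm (env \<gamma> (Node l A B) n) \<le> h n * h n ^ tsize A * h n ^ tsize B"
    using Node assms[of l] by (auto simp: norm_mult intro!: mult_mono)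
  then show ?case by (simp add: power_add mult_ac)
qed (simp add: assms)

text \<open>An envelope is a product of \<open>tsize t\<close> coefficients or conjugates of modulus
  at most 1, so by the product rule its variation is at most the sum of theirs.\<close>

lemma env_variation_le:
  assumes h: "\<And>l n. norm (\<gamma> l n) \<le> 1"
    and V: "\<And>l N. (\<Sum>n<N. norm (\<gamma> l (Suc n) - \<gamma> l n)) \<le> V"
  shows "(\<Sum>n<N. norm (env \<gamma> t (Suc n) - env \<gamma> t n)) \<le> real (tsize t) * V"
proof (induction t)
  case (Leaf k)
  have "norm (env \<gamma> (Leaf k) (Suc n) - env \<gamma> (Leaf k) n) = norm (\<gamma> k (Suc n) - \<gamma> k n)" for n
    by (metis complex_cnj_diff complex_mod_cnj env.simps(1))
  then show ?case using V[where N = N and l = k] by simp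
next
  case (Node l A B)
  have e1: "norm (env \<gamma> t n) \<le> 1" for t n using norm_env_le[of \<gamma> n "\<lambda>_. 1" t] h by simp
  have m1: "norm (u * v) \<le> 1" if "norm u \<le> 1" "norm v \<le> 1" for u v :: complex
    using that by (simp add: norm_mult mult_le_one)
  have pw: "norm (env \<gamma> (Node l A B) (Suc n) - env \<gamma> (Node l A B) n)
     \<le> norm (\<gamma> l (Suc n) - \<gamma> l n) + norm (env \<gamma> A (Suc n) - env \<gamma> A n) + norm (env \<gamma> B (Suc n) - env \<gamma> B n)" for n
  proof -
    have "env \<gamma> (Node l A B) (Suc n) - env \<gamma> (Node l A B) n =
        (\<gamma> l (Suc n) - \<gamma> l n) * (env \<gamma> A (Suc n) * env \<gamma> B (Suc n))
      + (env \<gamma> A (Suc n) - env \<gamma> A n) * (\<gamma> l n * env \<gamma> B (Suc n))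
      + (env \<gamma> B (Suc n) - env \<gamma> B n) * (\<gamma> l n * env \<gamma> A n)"
      by (simp add: algebra_simps)
    moreover have nm: "norm (x * y) \<le> norm x" if "norm y \<le> 1" for x y :: complex
      using mult_left_mono[OF that, of "norm x"] by (simp add: norm_mult)
    ultimately show ?thesis
      by (simp only:) (intro norm_triangle_mono nm m1 e1 h)
  qed
  have "(\<Sum>n<N. norm (env \<gamma> (Node l A B) (Suc n) - env \<gamma> (Node l A B) n))
     \<le> (\<Sum>n<N. norm (\<gamma> l (Suc n) - \<gamma> l n)) + (\<Sum>n<N. norm (env \<gamma> A (Suc n) - env \<gamma> A n)) + (\<Sum>n<N. norm (env \<gamma> B (Suc n) - env \<gamma> B n))"
    using sum_mono[where K = "{..<N}", OF pw] by (simp only: sum.distrib)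
  also have "\<dots> \<le> V + real (tsize A) * V + real (tsize B) * V" by (intro add_mono V Node)
  finally show ?case by (simp add: algebra_simps)
qed

text \<open>The series over trees solves the recursion \<open>q(n+1) - z q(n) = -z cnj(\<alpha>(n)) + \<alpha>(n) q(n) q(n+1)\<close>
  formally; truncating at an odd size \<open>d\<close> leaves terms of odd degree larger than \<open>d\<close>, hence at least \<open>d + 2\<close>.\<close>

lemma approximate_orbit:
  fixes c :: "nat \<Rightarrow> complex" and \<phi> :: "nat \<Rightarrow> real" and \<gamma> :: "nat \<Rightarrow> nat \<Rightarrow> complex"
  assumes sc: "(\<lambda>k. norm (c k)) summable_on UNIV"
    and sa: "(\<lambda>t. norm (amp c \<phi> z t)) summable_on trees_upto d" and "odd d"
    and z: "norm z = 1" and ne: "\<And>t. t \<in> trees_upto d \<Longrightarrow> z \<noteq> cis (freq \<phi> t)"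
    and \<alpha>: "\<And>n. \<alpha> n = (\<Sum>\<^sub>\<infinity>l. c l * cis (- (real n * \<phi> l)) * \<gamma> l n)"
    and h: "\<And>l n. norm (\<gamma> l n) \<le> h n" "\<And>n. h n \<le> 1" and sh: "summable (\<lambda>n. h n ^ (d + 2))"
    and V: "\<And>l N. (\<Sum>n<N. norm (\<gamma> l (Suc n) - \<gamma> l n)) \<le> V"
  obtains q :: "nat \<Rightarrow> complex" where "q \<longlonglongrightarrow> 0"
    "summable (\<lambda>n. norm (q (Suc n) - z * q n - (- z * cnj (\<alpha> n) + \<alpha> n * q n * q (Suc n))))"
proof -
  define T where "T = trees_upto d"
  define f where "f = amp c \<phi> z"
  define q where "q n = (\<Sum>\<^sub>\<infinity>t\<in>T. f t * cis (real n * freq \<phi> t) * env \<gamma> t n)" for n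
  \<comment> \<open>\<open>P\<close> is the series at \<open>n + 1\<close> with the envelopes still
    taken at \<open>n\<close>, so that the algebra of the recursion is exact for it;
    \<open>D\<close> collects the change of the envelopes.\<close>
  define P where "P n = (\<Sum>\<^sub>\<infinity>t\<in>T. f t * cis (real (Suc n) * freq \<phi> t) * env \<gamma> t n)" for n
  define D where "D n = (\<Sum>\<^sub>\<infinity>t\<in>T. f t * cis (real (Suc n) * freq \<phi> t) * (env \<gamma> t (Suc n) - env \<gamma> t n))" for n
  have sf: "(\<lambda>t. norm (f t)) summable_on T" using sa by (simp add: f_def T_def)
  have h0: "0 \<le> h n" for n using h(1)[of 0 n] norm_ge_zero order_trans by blast
  have g1: "norm (\<gamma> l n) \<le> 1" for l n using h order_trans by blast
  have envle: "norm (env \<gamma> t n) \<le> h n ^ tsize t" for t n by (rule norm_env_le) (rule h)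
  have env1: "norm (env \<gamma> t n) \<le> 1" for t n
    using envle[of t n] h0[of n] h(2)[of n] power_le_one[of "h n" "tsize t"] by linarith
  have envh: "norm (env \<gamma> t n) \<le> h n" for t n
    using envle[of t n] h0[of n] h(2)[of n] power_decreasing[of 1 "tsize t" "h n"] tsize_pos[of t]
    by (simp add: Suc_le_eq)
  have smg: "(\<lambda>t. norm (f t * g t)) summable_on T" if "\<And>t. t \<in> T \<Longrightarrow> norm (g t) \<le> C" for g :: "otree \<Rightarrow> complex" and C
    by (rule summable_on_comparison_test[OF summable_on_cmult_left[OF sf, of C]])
       (auto simp: norm_mult intro!: mult_left_mono that)
  have sm_g: "(\<lambda>t. f t * g t) summable_on T" if "\<And>t. t \<in> T \<Longrightarrow> norm (g t) \<le> C" for g :: "otree \<Rightarrow> complex" and C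
    by (rule abs_summable_summable[OF smg[OF that]])
  have q_le: "norm (q n) \<le> h n * infsum (\<lambda>t. norm (f t)) T" for n
  proof -
    have "norm (q n) \<le> (\<Sum>\<^sub>\<infinity>t\<in>T. norm (f t * (cis (real n * freq \<phi> t) * env \<gamma> t n)))"
      unfolding q_def mult.assoc
      by (rule norm_infsum_bound[OF smg[where C = 1]]) (simp add: norm_mult env1)
    also have "\<dots> \<le> (\<Sum>\<^sub>\<infinity>t\<in>T. norm (f t) * h n)"
      by (intro infsum_mono smg[where C = 1] summable_on_cmult_left sf)
         (auto simp: norm_mult env1 intro!: mult_left_mono envh)
    finally show ?thesis by (simp only: infsum_cmult_left' mult.commute[of "h n"])
  qed
  have "h \<longlonglongrightarrow> 0"
  proof -
    have "(\<lambda>n. root (d + 2) (h n ^ (d + 2))) \<longlonglongrightarrow> root (d + 2) 0"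
      by (intro tendsto_real_root summable_LIMSEQ_zero sh)
    then show ?thesis using h0 by (simp add: real_root_power_cancel del: power_Suc)
  qed
  then have "(\<lambda>n. h n * infsum (\<lambda>t. norm (f t)) T) \<longlonglongrightarrow> 0" by (rule tendsto_mult_left_zero)
  then have q0: "q \<longlonglongrightarrow> 0"
    by (rule Lim_null_comparison[rotated]) (rule always_eventually[OF allI[OF q_le]])
  have env2: "norm (env \<gamma> t (Suc n) - env \<gamma> t n) \<le> 2" for t n
    using norm_triangle_ineq4[of "env \<gamma> t (Suc n)" "env \<gamma> t n"] env1[of t n] env1[of t "Suc n"] by linarith
  have qP: "q (Suc n) = P n + D n" for n
  proof -
    have "P n + D n = (\<Sum>\<^sub>\<infinity>t\<in>T. f t * (cis (real (Suc n) * freq \<phi> t) * env \<gamma> t n) + f t * (cis (real (Suc n) * freq \<phi> t) * (env \<gamma> t (Suc n) - env \<gamma> t n)))"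
      unfolding P_def D_def mult.assoc
    proof (rule infsum_add[symmetric])
      show "(\<lambda>t. f t * (cis (real (Suc n) * freq \<phi> t) * env \<gamma> t n)) summable_on T"
        by (rule sm_g[where C = 1]) (simp add: norm_mult env1)
      show "(\<lambda>t. f t * (cis (real (Suc n) * freq \<phi> t) * (env \<gamma> t (Suc n) - env \<gamma> t n))) summable_on T"
        by (rule sm_g[where C = 2]) (simp add: norm_mult env2)
    qed
    then show ?thesis unfolding q_def by (simp add: algebra_simps)
  qed
  have D_le: "norm (D n) \<le> (\<Sum>\<^sub>\<infinity>t\<in>T. norm (f t) * norm (env \<gamma> t (Suc n) - env \<gamma> t n))" for n
  proof -
    have "norm (D n) \<le> (\<Sum>\<^sub>\<infinity>t\<in>T. norm (f t * (cis (real (Suc n) * freq \<phi> t) * (env \<gamma> t (Suc n) - env \<gamma> t n))))"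
      unfolding D_def mult.assoc
      by (rule norm_infsum_bound[OF smg[where C = 2]])
         (simp add: norm_mult env2)
    then show ?thesis by (simp add: norm_mult)
  qed
  have "summable (\<lambda>n. \<Sum>\<^sub>\<infinity>t\<in>T. norm (f t) * norm (env \<gamma> t (Suc n) - env \<gamma> t n))"
  proof (rule summable_infsum_exchange[OF summable_on_cmult_left[OF sf, of "real d * V"]])
    fix N t assume t: "t \<in> T"
    have V0: "0 \<le> V" using V[where l = 0 and N = 0] by simp
    have "(\<Sum>n<N. norm (f t) * norm (env \<gamma> t (Suc n) - env \<gamma> t n)) = norm (f t) * (\<Sum>n<N. norm (env \<gamma> t (Suc n) - env \<gamma> t n))"
      by (simp add: sum_distrib_left)
    also have "\<dots> \<le> norm (f t) * (real (tsize t) * V)"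
      by (intro mult_left_mono env_variation_le g1 V) simp
    also have "\<dots> \<le> norm (f t) * (real d * V)"
      using t V0 by (intro mult_left_mono mult_right_mono) (auto simp: T_def trees_upto_def)
    finally show "(\<Sum>n<N. norm (f t) * norm (env \<gamma> t (Suc n) - env \<gamma> t n)) \<le> norm (f t) * (real d * V)" .
  qed simp
  then have sD: "summable (\<lambda>n. norm (D n))"
    by (rule summable_comparison_test'[where N = 0]) (use D_le in auto)
  \<comment> \<open>The triples in \<open>W\<close> index the expansion of the product
    \<open>\<alpha> n * q n * P n\<close>. Those in \<open>Wl\<close> assemble to trees of the
    truncated series; the others make up the remainder \<open>R\<close>.\<close>
  define W where "W = (UNIV :: nat set) \<times> T \<times> T"
  define w where "w n = (\<lambda>(l, A, B). c l * f A * f B * (cis (- (real n * \<phi> l) + real n * freq \<phi> A + real (Suc n) * freq \<phi> B) * \<gamma> l n * env \<gamma> A n * env \<gamma> B n))" for n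
  define Wl where "Wl = {(l, A, B). tsize (Node l A B) \<le> d}"
  have sW: "(\<lambda>x. norm (c (fst x) * (f (fst (snd x)) * f (snd (snd x))))) summable_on W"
    unfolding W_def by (rule abs_summable_on_mult_Times[OF sc abs_summable_on_mult_Times[OF sf sf]])
  have w_le: "norm (w n x) \<le> norm (c (fst x) * (f (fst (snd x)) * f (snd (snd x)))) * h n ^ tsize (Node (fst x) (fst (snd x)) (snd (snd x)))" for n x
  proof -
    obtain l A B where x: "x = (l, A, B)" by (cases x)
    have "norm (w n x) = norm (c l) * norm (f A) * norm (f B) * (norm (\<gamma> l n) * norm (env \<gamma> A n) * norm (env \<gamma> B n))"
      by (simp add: w_def x norm_mult)
    also have "\<dots> \<le> norm (c l) * norm (f A) * norm (f B) * (h n * h n ^ tsize A * h n ^ tsize B)"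
      using h0 by (intro mult_left_mono mult_mono h envle) auto
    finally show ?thesis by (simp add: x norm_mult power_add mult_ac)
  qed
  have swn: "(\<lambda>x. norm (w n x)) summable_on W" for n
  proof (rule summable_on_comparison_test[OF sW])
    fix x
    have "h n ^ tsize (Node (fst x) (fst (snd x)) (snd (snd x))) \<le> 1" by (intro power_le_one h0 h)
    then show "norm (w n x) \<le> norm (c (fst x) * (f (fst (snd x)) * f (snd (snd x))))"
      using w_le[of n x] mult_left_mono[of "h n ^ tsize (Node (fst x) (fst (snd x)) (snd (snd x)))" 1 "norm (c (fst x) * (f (fst (snd x)) * f (snd (snd x))))"] by simp
  qed simp
  have sw: "w n summable_on X" if "X \<subseteq> W" for n X
    using abs_summable_summable[OF swn] summable_on_subset_banach that by blast
  have prod: "\<alpha> n * q n * P n = infsum (w n) W" for n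
  proof -
    have a1: "(\<lambda>l. norm (c l * cis (- (real n * \<phi> l)) * \<gamma> l n)) summable_on UNIV"
      by (rule summable_on_comparison_test[OF sc]) (auto simp: norm_mult intro!: mult_left_le g1)
    have a2: "(\<lambda>t. norm (f t * cis (real n * freq \<phi> t) * env \<gamma> t n)) summable_on T"
      unfolding mult.assoc by (rule smg[where C = 1]) (simp add: norm_mult env1)
    have a3: "(\<lambda>t. norm (f t * cis (real (Suc n) * freq \<phi> t) * env \<gamma> t n)) summable_on T"
      unfolding mult.assoc by (rule smg[where C = 1]) (simp add: norm_mult env1)
    have "\<alpha> n * q n * P n = \<alpha> n * (q n * P n)" by simp
    also have "\<dots> = infsum (\<lambda>x. (c (fst x) * cis (- (real n * \<phi> (fst x))) * \<gamma> (fst x) n) *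
        ((f (fst (snd x)) * cis (real n * freq \<phi> (fst (snd x))) * env \<gamma> (fst (snd x)) n) *
         (f (snd (snd x)) * cis (real (Suc n) * freq \<phi> (snd (snd x))) * env \<gamma> (snd (snd x)) n))) W"
      unfolding \<alpha> q_def P_def W_def infsum_mult_Times[OF a2 a3, symmetric]
      by (rule infsum_mult_Times[OF a1 abs_summable_on_mult_Times[OF a2 a3], symmetric])
    also have "\<dots> = infsum (w n) W"
      by (intro infsum_cong) (simp only: w_def case_prod_unfold cis_mult[symmetric] mult_ac)
    finally show ?thesis .
  qed
  have WlW: "Wl \<subseteq> W" by (auto simp: Wl_def W_def T_def trees_upto_def)
  have lin: "P n - z * q n = - z * cnj (\<alpha> n) + infsum (w n) Wl" for n
  proof -
    \<comment> \<open>The linear part of the recursion multiplies each term by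
      \<open>cis (freq \<phi> t) - z\<close>, which cancels the denominator at the root: the leaves
      then sum to \<open>- z * cnj (\<alpha> n)\<close>, and the nodes reproduce the products
      \<open>w n\<close>.\<close>
    define G where "G t = f t * cis (real n * freq \<phi> t) * env \<gamma> t n * (cis (freq \<phi> t) - z)" for t
    have sG: "G summable_on T"
    proof -
      have "(\<lambda>t. f t * (cis (real n * freq \<phi> t) * env \<gamma> t n * (cis (freq \<phi> t) - z))) summable_on T"
      proof (rule sm_g[where C = 2])
        fix t
        have "norm (cis (freq \<phi> t) - z) \<le> 2" using norm_triangle_ineq4[of "cis (freq \<phi> t)" z] z by simp
        then have "norm (env \<gamma> t n) * norm (cis (freq \<phi> t) - z) \<le> 1 * 2"
          using env1 by (intro mult_mono) auto
        then show "norm (cis (real n * freq \<phi> t) * env \<gamma> t n * (cis (freq \<phi> t) - z)) \<le> 2" by (simp add: norm_mult)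
      qed
      then show ?thesis by (simp add: G_def[abs_def] mult.assoc)
    qed
    have G_amp: "G t = cis (real n * freq \<phi> t) * env \<gamma> t n * (f t * (cis (freq \<phi> t) - z))" for t
      by (simp add: G_def)
    have "P n - z * q n = infsum G T"
    proof -
      have "infsum G T = (\<Sum>\<^sub>\<infinity>t\<in>T. f t * cis (real (Suc n) * freq \<phi> t) * env \<gamma> t n + (- z) * (f t * cis (real n * freq \<phi> t) * env \<gamma> t n))"
        by (intro infsum_cong) (simp add: G_def algebra_simps cis_mult[symmetric])
      also have "\<dots> = P n + infsum (\<lambda>t. (- z) * (f t * cis (real n * freq \<phi> t) * env \<gamma> t n)) T"
        unfolding P_def
      proof (rule infsum_add)
        show "(\<lambda>t. f t * cis (real (Suc n) * freq \<phi> t) * env \<gamma> t n) summable_on T"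
          unfolding mult.assoc by (rule sm_g[where C = 1]) (simp add: norm_mult env1)
        show "(\<lambda>t. (- z) * (f t * cis (real n * freq \<phi> t) * env \<gamma> t n)) summable_on T"
          unfolding mult.assoc by (rule summable_on_cmult_right, rule sm_g[where C = 1]) (simp add: norm_mult env1)
      qed
      finally show ?thesis by (simp only: infsum_cmult_right' q_def[symmetric]) simp
    qed
    also have "T = range Leaf \<union> (\<lambda>(l, A, B). Node l A B) ` Wl"
    proof -
      have "d \<ge> 1" using \<open>odd d\<close> by (cases d) auto
      have "t \<in> T \<longleftrightarrow> t \<in> range Leaf \<union> (\<lambda>(l, A, B). Node l A B) ` Wl" for t
        by (cases t) (use \<open>d \<ge> 1\<close> in \<open>auto simp: T_def trees_upto_def Wl_def image_iff\<close>)
      then show ?thesis by blast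
    qed
    then have "infsum G T = infsum G (range Leaf) + infsum G ((\<lambda>(l, A, B). Node l A B) ` Wl)"
      using sG summable_on_subset_banach[OF sG] by (simp only:) (rule infsum_Un_disjoint; auto)
    also have "infsum G (range Leaf) = - z * cnj (\<alpha> n)"
    proof -
      have "infsum G (range Leaf) = infsum (\<lambda>k. (- z) * cnj (c k * cis (- (real n * \<phi> k)) * \<gamma> k n)) UNIV"
      proof (subst infsum_reindex)
        show "inj Leaf" by (auto simp: inj_def)
        show "infsum (G \<circ> Leaf) UNIV = infsum (\<lambda>k. (- z) * cnj (c k * cis (- (real n * \<phi> k)) * \<gamma> k n)) UNIV"
        proof (rule infsum_cong)
          fix k
          have "Leaf k \<in> trees_upto d" using \<open>odd d\<close> by (cases d) (auto simp: trees_upto_def)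
          from ne[OF this] have "f (Leaf k) * (cis (\<phi> k) - z) = - z * cnj (c k)"
            by (simp add: f_def)
          then show "(G \<circ> Leaf) k = (- z) * cnj (c k * cis (- (real n * \<phi> k)) * \<gamma> k n)"
            by (simp add: G_amp cis_cnj)
        qed
      qed
      also have "\<dots> = - z * cnj (\<alpha> n)"
        unfolding \<alpha> infsum_cnj[symmetric] by (rule infsum_cmult_right')
      finally show ?thesis .
    qed
    also have "infsum G ((\<lambda>(l, A, B). Node l A B) ` Wl) = infsum (w n) Wl"
    proof (subst infsum_reindex)
      show "inj_on (\<lambda>(l, A, B). Node l A B) Wl" by (auto simp: inj_on_def)
      show "infsum (G \<circ> (\<lambda>(l, A, B). Node l A B)) Wl = infsum (w n) Wl"
      proof (rule infsum_cong)
        fix x assume x: "x \<in> Wl"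
        obtain l A B where xe: "x = (l, A, B)" by (cases x)
        have "Node l A B \<in> trees_upto d" using x by (auto simp: xe Wl_def trees_upto_def)
        from ne[OF this] have "f (Node l A B) * (cis (freq \<phi> (Node l A B)) - z) = c l * f A * f B * cis (freq \<phi> B)"
          by (simp add: f_def)
        then have "G (Node l A B) = cis (real n * freq \<phi> (Node l A B)) * env \<gamma> (Node l A B) n * (c l * f A * f B * cis (freq \<phi> B))"
          by (simp only: G_amp)
        also have "\<dots> = w n x"
        proof -
          have "cis (real n * freq \<phi> (Node l A B)) * cis (freq \<phi> B)
              = cis (- (real n * \<phi> l) + real n * freq \<phi> A + real (Suc n) * freq \<phi> B)"
            by (simp add: cis_mult algebra_simps)
          then show ?thesis by (simp add: w_def xe mult_ac)
        qed
        finally show "(G \<circ> (\<lambda>(l, A, B). Node l A B)) x = w n x" by (simp add: xe)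
      qed
    qed
    finally show ?thesis by simp
  qed
  define R where "R n = infsum (w n) (W - Wl)" for n
  have R_le: "norm (R n) \<le> h n ^ (d + 2) * infsum (\<lambda>x. norm (c (fst x) * (f (fst (snd x)) * f (snd (snd x))))) W" for n
  proof -
    have sW': "(\<lambda>x. norm (c (fst x) * (f (fst (snd x)) * f (snd (snd x))))) summable_on (W - Wl)"
      by (rule summable_on_subset_banach[OF sW]) auto
    have "norm (R n) \<le> infsum (\<lambda>x. norm (w n x)) (W - Wl)"
      unfolding R_def by (rule norm_infsum_bound[OF summable_on_subset_banach[OF swn]]) auto
    also have "\<dots> \<le> (\<Sum>\<^sub>\<infinity>x\<in>W - Wl. norm (c (fst x) * (f (fst (snd x)) * f (snd (snd x)))) * h n ^ (d + 2))"
    proof (rule infsum_mono)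
      show "(\<lambda>x. norm (w n x)) summable_on (W - Wl)" by (rule summable_on_subset_banach[OF swn]) auto
      show "(\<lambda>x. norm (c (fst x) * (f (fst (snd x)) * f (snd (snd x)))) * h n ^ (d + 2)) summable_on (W - Wl)"
        by (rule summable_on_cmult_left[OF sW'])
      fix x assume x: "x \<in> W - Wl"
      let ?t = "Node (fst x) (fst (snd x)) (snd (snd x))"
      have "d < tsize ?t" using x by (auto simp: Wl_def)
      moreover have "odd (tsize ?t)" by (rule odd_tsize)
      ultimately have "d + 2 \<le> tsize ?t" using \<open>odd d\<close>
        by (metis Suc_leI add_2_eq_Suc' even_Suc le_neq_implies_less Suc_le_eq)
      then have "h n ^ tsize ?t \<le> h n ^ (d + 2)" using h0 h(2) by (intro power_decreasing)
      then show "norm (w n x) \<le> norm (c (fst x) * (f (fst (snd x)) * f (snd (snd x)))) * h n ^ (d + 2)"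
        by (rule order_trans[OF w_le mult_left_mono]) simp
    qed
    also have "\<dots> = infsum (\<lambda>x. norm (c (fst x) * (f (fst (snd x)) * f (snd (snd x))))) (W - Wl) * h n ^ (d + 2)"
      by (rule infsum_cmult_left')
    also have "\<dots> \<le> infsum (\<lambda>x. norm (c (fst x) * (f (fst (snd x)) * f (snd (snd x))))) W * h n ^ (d + 2)"
      using h0 sW sW' by (intro mult_right_mono infsum_mono2) auto
    finally show ?thesis by (simp add: mult.commute)
  qed
  have split: "infsum (w n) W = infsum (w n) Wl + R n" for n
  proof -
    have "infsum (w n) (Wl \<union> (W - Wl)) = infsum (w n) Wl + infsum (w n) (W - Wl)"
      by (rule infsum_Un_disjoint) (use WlW in \<open>auto intro: sw\<close>)
    moreover have "Wl \<union> (W - Wl) = W" using WlW by blast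
    ultimately show ?thesis by (simp add: R_def)
  qed
  define M where "M = infsum (\<lambda>t. norm (f t)) T"
  define cs where "cs = infsum (\<lambda>l. norm (c l)) UNIV"
  have \<alpha>_le: "norm (\<alpha> n) \<le> cs" for n
  proof -
    have a1: "(\<lambda>l. norm (c l * cis (- (real n * \<phi> l)) * \<gamma> l n)) summable_on UNIV"
      by (rule summable_on_comparison_test[OF sc]) (auto simp: norm_mult intro!: mult_left_le g1)
    have "norm (\<alpha> n) \<le> (\<Sum>\<^sub>\<infinity>l. norm (c l * cis (- (real n * \<phi> l)) * \<gamma> l n))"
      unfolding \<alpha> by (rule norm_infsum_bound[OF a1])
    also have "\<dots> \<le> cs" unfolding cs_def
      by (rule infsum_mono[OF a1 sc]) (auto simp: norm_mult intro!: mult_left_le g1)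
    finally show ?thesis .
  qed
  have M0: "0 \<le> M" unfolding M_def by (simp add: infsum_nonneg)
  have cs0: "0 \<le> cs" unfolding cs_def by (simp add: infsum_nonneg)
  \<comment> \<open>Substitute \<open>q (Suc n) = P n + D n\<close>: the sums over \<open>Wl\<close>
    cancel, and what remains is the envelope change, once directly and once inside the product, and
    the remainder.\<close>
  have err: "q (Suc n) - z * q n - (- z * cnj (\<alpha> n) + \<alpha> n * q n * q (Suc n)) = D n * (1 - \<alpha> n * q n) - R n" for n
  proof -
    have "\<alpha> n * q n * q (Suc n) = infsum (w n) Wl + R n + \<alpha> n * q n * D n"
      unfolding qP using prod[of n] split[of n] by (simp add: algebra_simps)
    then show ?thesis using lin[of n] qP[of n] by (simp add: algebra_simps)
  qed
  have "summable (\<lambda>n. norm (D n) * (1 + cs * M) + h n ^ (d + 2) * infsum (\<lambda>x. norm (c (fst x) * (f (fst (snd x)) * f (snd (snd x))))) W)"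
    by (intro summable_add summable_mult2 sD sh)
  then have "summable (\<lambda>n. norm (q (Suc n) - z * q n - (- z * cnj (\<alpha> n) + \<alpha> n * q n * q (Suc n))))"
  proof (rule summable_comparison_test'[where N = 0])
    fix n
    have qM: "norm (q n) \<le> M"
      using q_le[of n] mult_right_mono[OF h(2)[of n] M0] by (simp add: M_def)
    have "norm (1 - \<alpha> n * q n) \<le> 1 + cs * M"
      using norm_triangle_ineq4[of 1 "\<alpha> n * q n"] mult_mono[OF \<alpha>_le[of n] qM cs0 norm_ge_zero] by (simp add: norm_mult)
    then have "norm (D n * (1 - \<alpha> n * q n) - R n) \<le> norm (D n) * (1 + cs * M) + norm (R n)"
      by (intro order_trans[OF norm_triangle_ineq4] add_mono) (auto simp: norm_mult intro!: mult_left_mono)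
    then show "norm (norm (q (Suc n) - z * q n - (- z * cnj (\<alpha> n) + \<alpha> n * q n * q (Suc n))))
        \<le> norm (D n) * (1 + cs * M) + h n ^ (d + 2) * infsum (\<lambda>x. norm (c (fst x) * (f (fst (snd x)) * f (snd (snd x))))) W"
      unfolding err using R_le[of n] by simp
  qed
  with q0 show thesis using that by blast
qed

section \<open>Boundedness of the solutions of the recursion\<close>

text \<open>The orthonormal recursion on the circle, with the reversed component written as
  \<open>z ^ n * cnj u\<close>. This form is only real-linear in the initial value, which is why the
  two initial values 1 and \<open>\<i>\<close> are followed; the value 1 gives the orthonormal
  polynomials.\<close>

primrec circle_sol :: "(nat \<Rightarrow> complex) \<Rightarrow> complex \<Rightarrow> complex \<Rightarrow> nat \<Rightarrow> complex" where
  "circle_sol \<alpha> u0 z 0 = u0"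
| "circle_sol \<alpha> u0 z (Suc n) =
     (z * circle_sol \<alpha> u0 z n - cnj (\<alpha> n) * z ^ n * cnj (circle_sol \<alpha> u0 z n)) / sqrt (1 - (norm (\<alpha> n))\<^sup>2)"

text \<open>This is the second row of the transfer matrix: together with the definition it makes the
  pair of \<open>u\<close> and \<open>z ^ n * cnj u\<close> evolve complex-linearly.\<close>

lemma cnj_circle_sol_Suc:
  assumes "norm z = 1"
  shows "z ^ Suc n * cnj (circle_sol \<alpha> u0 z (Suc n)) =
     (z ^ n * cnj (circle_sol \<alpha> u0 z n) - \<alpha> n * z * circle_sol \<alpha> u0 z n) / sqrt (1 - (norm (\<alpha> n))\<^sup>2)"
proof -
  have zz: "z * cnj z = 1" using assms by (simp add: complex_norm_square[symmetric])
  then have zn: "z ^ n * cnj z ^ n = 1" by (simp flip: power_mult_distrib)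
  have "z ^ Suc n * (cnj z * w - a * cnj z ^ n * y) = z * cnj z * (z ^ n * w) - (z ^ n * cnj z ^ n) * (a * z * y)" for w a y
    by (simp add: algebra_simps)
  then show ?thesis by (simp add: zz zn)
qed

text \<open>If \<open>q\<close> is an exact orbit inside the disc of the Moebius maps induced by the recursion, then
  \<open>|v - z u cnj q|\<^sup>2 / (1 - |q|\<^sup>2)\<close> is conserved; for an approximate orbit it changes by summable relative errors.\<close>

lemma bounded_of_approximate_orbit:
  fixes u v q \<alpha> :: "nat \<Rightarrow> complex"
  assumes z: "norm z = 1" and \<alpha>: "\<And>n. norm (\<alpha> n) < 1" and uv: "\<And>n. norm (u n) = norm (v n)"
    and u: "\<And>n. u (Suc n) = (z * u n - cnj (\<alpha> n) * v n) / sqrt (1 - (norm (\<alpha> n))\<^sup>2)"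
    and v: "\<And>n. v (Suc n) = (v n - \<alpha> n * z * u n) / sqrt (1 - (norm (\<alpha> n))\<^sup>2)"
    and q: "q \<longlonglongrightarrow> 0"
    and err: "summable (\<lambda>n. norm (q (Suc n) - z * q n - (- z * cnj (\<alpha> n) + \<alpha> n * q n * q (Suc n))))"
  shows "\<exists>M. \<forall>n. norm (v n) \<le> M"
proof -
  define e where "e n = q (Suc n) - z * q n - (- z * cnj (\<alpha> n) + \<alpha> n * q n * q (Suc n))" for n
  have se: "summable (\<lambda>n. norm (e n))" using err by (simp add: e_def)
  have zz: "z * cnj z = 1" using z by (simp add: complex_norm_square[symmetric])
  have "\<forall>\<^sub>F n in sequentially. norm (q n) < 1 / 2"
    using tendsto_norm[OF q] by (intro order_tendstoD) auto
  moreover have "\<forall>\<^sub>F n in sequentially. norm (e n) < 1 / 8"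
    using summable_LIMSEQ_zero[OF se] by (intro order_tendstoD) auto
  ultimately have "\<forall>\<^sub>F n in sequentially. norm (q n) < 1 / 2 \<and> norm (e n) < 1 / 8" by (rule eventually_conj)
  then obtain N where N: "\<And>n. n \<ge> N \<Longrightarrow> norm (q n) < 1 / 2" "\<And>n. n \<ge> N \<Longrightarrow> norm (e n) < 1 / 8"
    unfolding eventually_sequentially by blast
  define w where "w n = v n - z * u n * cnj (q n)" for n
  define D where "D n = (norm (w n))\<^sup>2 / (1 - (norm (q n))\<^sup>2)" for n
  have v_le: "norm (v n) \<le> 2 * norm (w n)" if "n \<ge> N" for n
  proof -
    have "norm (v n) \<le> norm (w n) + norm (z * u n * cnj (q n))"
      using norm_triangle_ineq[of "w n" "z * u n * cnj (q n)"] by (simp add: w_def)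
    moreover have "norm (z * u n * cnj (q n)) \<le> norm (v n) * (1 / 2)"
      using mult_left_mono[OF less_imp_le[OF N(1)[OF that]], of "norm (v n)"] z uv[of n] by (simp add: norm_mult)
    ultimately show ?thesis by simp
  qed
  have q34: "3 / 4 \<le> 1 - (norm (q n))\<^sup>2" if "n \<ge> N" for n
    using power_mono[of "norm (q n)" "1 / 2" 2] N(1)[OF that] by (simp add: power2_eq_square)
  have D0: "0 \<le> D n" if "n \<ge> N" for n unfolding D_def using q34[OF that] by simp
  have step: "D (Suc n) \<le> D n * exp (48 * norm (e n))" if n: "n \<ge> N" for n
  proof -
    define x where "x = norm (e n / (1 - \<alpha> n * q n))"
    define r where "r = sqrt (1 - (norm (\<alpha> n))\<^sup>2)"
    \<comment> \<open>The exact image of \<open>q n\<close>: the orbit equation without error,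
      solved for the new value. The true \<open>q (Suc n)\<close> differs from it by a quotient of
      modulus \<open>x\<close>.\<close>
    define q' where "q' = z * (q n - cnj (\<alpha> n)) / (1 - \<alpha> n * q n)"
    have "(norm (\<alpha> n))\<^sup>2 < 1" using \<alpha>[of n] by (simp add: power_less_one_iff)
    then have r: "0 < r" "r\<^sup>2 = 1 - (norm (\<alpha> n))\<^sup>2" by (auto simp: r_def)
    have aq: "norm (\<alpha> n * q n) \<le> 1 / 2"
      using mult_mono[of "norm (\<alpha> n)" 1 "norm (q n)" "1 / 2"] \<alpha>[of n] N(1)[OF n] by (simp add: norm_mult)
    have half: "1 / 2 \<le> norm (1 - \<alpha> n * q n)"
      using norm_triangle_ineq2[of 1 "\<alpha> n * q n"] aq by simp
    then have nz: "1 - \<alpha> n * q n \<noteq> 0" by auto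
    then have nzc: "1 - cnj (\<alpha> n) * cnj (q n) \<noteq> 0" by (metis complex_cnj_cancel_iff complex_cnj_diff complex_cnj_mult complex_cnj_one complex_cnj_zero)
    have x2: "x \<le> 2 * norm (e n)"
      using half mult_left_mono[OF half norm_ge_zero[of "e n"]] by (simp add: x_def norm_divide divide_le_eq)
    have x4: "x \<le> 1 / 4" "0 \<le> x" using x2 N(2)[OF n] by (auto simp: x_def)
    have qq: "q (Suc n) = q' + e n / (1 - \<alpha> n * q n)"
    proof -
      have "q (Suc n) * (1 - \<alpha> n * q n) = z * (q n - cnj (\<alpha> n)) + e n"
        by (simp add: e_def algebra_simps)
      then show ?thesis using nz by (simp add: q'_def add_divide_distrib[symmetric] eq_divide_eq)
    qed
    have "norm q' \<le> norm (q (Suc n)) + x"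
      using norm_triangle_ineq4[of "q (Suc n)" "e n / (1 - \<alpha> n * q n)"] qq by (simp add: x_def)
    then have q'1: "norm q' \<le> 3 / 4" using N(1)[of "Suc n"] n x4 by simp
    have w': "v (Suc n) - z * u (Suc n) * cnj q' = r * w n / (1 - cnj (\<alpha> n) * cnj (q n))"
    proof -
      have c: "z * cnj q' = (cnj (q n) - \<alpha> n) / (1 - cnj (\<alpha> n) * cnj (q n))"
        by (simp add: q'_def zz mult.assoc[symmetric])
      have "v (Suc n) - z * u (Suc n) * cnj q'
          = (v n - \<alpha> n * z * u n) / r - (z * u n - cnj (\<alpha> n) * v n) / r * (z * cnj q')"
        by (simp add: u v r_def mult_ac)
      also have "\<dots> = ((v n - \<alpha> n * z * u n) * (1 - cnj (\<alpha> n) * cnj (q n)) - (z * u n - cnj (\<alpha> n) * v n) * (cnj (q n) - \<alpha> n))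
           / (r * (1 - cnj (\<alpha> n) * cnj (q n)))"
        unfolding c using r(1) nzc by (simp add: field_simps)
      also have "(v n - \<alpha> n * z * u n) * (1 - cnj (\<alpha> n) * cnj (q n)) - (z * u n - cnj (\<alpha> n) * v n) * (cnj (q n) - \<alpha> n)
          = (1 - \<alpha> n * cnj (\<alpha> n)) * w n"
        by (simp add: w_def algebra_simps)
      also have "1 - \<alpha> n * cnj (\<alpha> n) = complex_of_real (r\<^sup>2)"
        unfolding r(2) by (simp add: complex_norm_square[symmetric])
      finally show ?thesis using r(1) by (simp add: power2_eq_square)
    qed
    \<comment> \<open>The Schwarz-Pick identity of the Moebius map. Its factor is the square of the
      modulus of the factor of \<open>w n\<close> in \<open>w'\<close>, so the quotient is conserved
      along the exact step.\<close>
    have nq': "1 - (norm q')\<^sup>2 = r\<^sup>2 * (1 - (norm (q n))\<^sup>2) / (norm (1 - \<alpha> n * q n))\<^sup>2"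
    proof -
      have "complex_of_real ((norm (1 - \<alpha> n * q n))\<^sup>2 - (norm (q n - cnj (\<alpha> n)))\<^sup>2)
         = (1 - \<alpha> n * q n) * cnj (1 - \<alpha> n * q n) - (q n - cnj (\<alpha> n)) * cnj (q n - cnj (\<alpha> n))"
        by (simp only: of_real_diff complex_norm_square)
      also have "\<dots> = (1 - \<alpha> n * cnj (\<alpha> n)) * (1 - q n * cnj (q n))" by (simp add: algebra_simps)
      also have "\<dots> = complex_of_real (r\<^sup>2 * (1 - (norm (q n))\<^sup>2))"
        unfolding r(2) by (simp only: of_real_mult of_real_diff of_real_1 complex_norm_square)
      finally have "(norm (1 - \<alpha> n * q n))\<^sup>2 - (norm (q n - cnj (\<alpha> n)))\<^sup>2 = r\<^sup>2 * (1 - (norm (q n))\<^sup>2)"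
        by (simp only: of_real_eq_iff)
      moreover have "(norm q')\<^sup>2 = (norm (q n - cnj (\<alpha> n)))\<^sup>2 / (norm (1 - \<alpha> n * q n))\<^sup>2"
        by (simp add: q'_def norm_mult norm_divide z power_divide)
      ultimately show ?thesis using nz by (simp add: field_simps)
    qed
    have cons: "(norm (v (Suc n) - z * u (Suc n) * cnj q'))\<^sup>2 = (1 - (norm q')\<^sup>2) * D n"
    proof -
      have "norm (1 - cnj (\<alpha> n) * cnj (q n)) = norm (1 - \<alpha> n * q n)"
        by (metis complex_cnj_diff complex_cnj_mult complex_cnj_one complex_mod_cnj)
      then have "(norm (v (Suc n) - z * u (Suc n) * cnj q'))\<^sup>2 = r\<^sup>2 * (norm (w n))\<^sup>2 / (norm (1 - \<alpha> n * q n))\<^sup>2"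
        unfolding w' using r(1) by (simp add: norm_mult norm_divide power_mult_distrib power_divide)
      also have "(norm (w n))\<^sup>2 = (1 - (norm (q n))\<^sup>2) * D n" using q34[OF n] by (simp add: D_def)
      finally show ?thesis unfolding nq' by simp
    qed
    have "norm (w (Suc n)) \<le> norm (v (Suc n) - z * u (Suc n) * cnj q') + norm (z * u (Suc n) * cnj (e n / (1 - \<alpha> n * q n)))"
    proof -
      have "w (Suc n) = (v (Suc n) - z * u (Suc n) * cnj q') - z * u (Suc n) * cnj (e n / (1 - \<alpha> n * q n))"
        unfolding w_def qq complex_cnj_add by (simp only: distrib_left diff_diff_eq)
      then show ?thesis by (simp only: norm_triangle_ineq4)
    qed
    also have "norm (z * u (Suc n) * cnj (e n / (1 - \<alpha> n * q n))) = norm (v (Suc n)) * x"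
      unfolding x_def norm_mult complex_mod_cnj z uv by simp
    also have "\<dots> \<le> 2 * norm (w (Suc n)) * x" using v_le[of "Suc n"] n x4 by (intro mult_right_mono) auto
    finally have "norm (w (Suc n)) * (1 - 2 * x) \<le> norm (v (Suc n) - z * u (Suc n) * cnj q')" by (simp add: algebra_simps)
    then have "(norm (w (Suc n)) * (1 - 2 * x))\<^sup>2 \<le> (norm (v (Suc n) - z * u (Suc n) * cnj q'))\<^sup>2"
      using x4 by (intro power_mono) auto
    then have "(norm (w (Suc n)))\<^sup>2 * (1 - 2 * x)\<^sup>2 \<le> (1 - (norm q')\<^sup>2) * D n"
      unfolding cons power_mult_distrib .
    \<comment> \<open>Replacing \<open>q'\<close> by \<open>q (Suc n)\<close> changes the squared
      modulus by at most \<open>2 * x\<close>; since \<open>1 - (norm (q (Suc n)))\<^sup>2\<close>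
      is at least 3/4, the relative factor \<open>1 + 3 * x\<close> suffices.\<close>
    also have "\<dots> \<le> ((1 - (norm (q (Suc n)))\<^sup>2) * (1 + 3 * x)) * D n"
    proof (rule mult_right_mono[OF _ D0[OF n]])
      have "norm (q (Suc n)) - norm q' \<le> x"
        using norm_triangle_ineq2[of "q (Suc n)" q'] qq by (simp add: x_def)
      then have "(norm (q (Suc n)) - norm q') * (norm (q (Suc n)) + norm q') \<le> x * (norm (q (Suc n)) + norm q')"
        by (intro mult_right_mono) auto
      also have "\<dots> \<le> x * 2" using N(1)[of "Suc n"] n q'1 x4 by (intro mult_left_mono) auto
      finally have "(norm (q (Suc n)))\<^sup>2 - (norm q')\<^sup>2 \<le> 2 * x"
        by (simp add: power2_eq_square algebra_simps)
      moreover have "(3 / 4) * (3 * x) \<le> (1 - (norm (q (Suc n)))\<^sup>2) * (3 * x)"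
        using q34[of "Suc n"] n x4 by (intro mult_right_mono) auto
      ultimately show "1 - (norm q')\<^sup>2 \<le> (1 - (norm (q (Suc n)))\<^sup>2) * (1 + 3 * x)"
        unfolding distrib_left mult_1_right using x4 by linarith
    qed
    finally have "D (Suc n) * (1 - 2 * x)\<^sup>2 \<le> (1 + 3 * x) * D n"
      unfolding D_def using q34[of "Suc n"] n by (simp add: field_simps)
    \<comment> \<open>Equality holds at \<open>x = 1 / 4\<close>, the largest admissible value, so
      24 cannot be lowered; with \<open>x \<le> 2 * norm (e n)\<close> it becomes the 48 of
      \<open>step\<close>.\<close>
    moreover have "1 + 3 * x \<le> (1 + 24 * x) * (1 - 2 * x)\<^sup>2"
    proof -
      have "(1 + 24 * x) * (1 - 2 * x)\<^sup>2 - (1 + 3 * x) = x * (17 - 92 * x + 96 * x\<^sup>2)" by (simp add: power2_eq_square algebra_simps)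
      moreover have "0 \<le> 17 - 92 * x + 96 * x\<^sup>2"
      proof -
        have "17 - 92 * x + 96 * x\<^sup>2 = (1 / 4 - x) * (68 - 96 * x) + 0" by (simp add: power2_eq_square algebra_simps)
        then show ?thesis using x4 by simp
      qed
      ultimately show ?thesis using x4 by (smt (verit) mult_nonneg_nonneg)
    qed
    then have "(1 + 3 * x) * D n \<le> (1 + 24 * x) * (1 - 2 * x)\<^sup>2 * D n" using D0[OF n] by (intro mult_right_mono)
    ultimately have "D (Suc n) * (1 - 2 * x)\<^sup>2 \<le> ((1 + 24 * x) * D n) * (1 - 2 * x)\<^sup>2" by (simp add: mult_ac)
    moreover have "0 < (1 - 2 * x)\<^sup>2" using x4 by (intro zero_less_power) auto
    ultimately have "D (Suc n) \<le> (1 + 24 * x) * D n" by (simp only: mult_le_cancel_right_pos)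
    also have "\<dots> \<le> exp (48 * norm (e n)) * D n"
    proof (rule mult_right_mono[OF _ D0[OF n]])
      have "1 + 24 * x \<le> 1 + 48 * norm (e n)" using x2 by simp
      also have "\<dots> \<le> exp (48 * norm (e n))" by (rule exp_ge_add_one_self)
      finally show "1 + 24 * x \<le> exp (48 * norm (e n))" .
    qed
    finally show ?thesis by (simp add: mult.commute)
  qed
  have Dk: "D (N + k) \<le> D N * exp (48 * (\<Sum>j<k. norm (e (N + j))))" for k
  proof (induction k)
    case (Suc k)
    have "D (N + Suc k) \<le> D (N + k) * exp (48 * norm (e (N + k)))" using step[of "N + k"] by simp
    also have "\<dots> \<le> D N * exp (48 * (\<Sum>j<k. norm (e (N + j)))) * exp (48 * norm (e (N + k)))"
      by (intro mult_right_mono Suc) simp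
    finally show ?case by (simp add: exp_add[symmetric] mult.assoc distrib_left)
  qed simp
  have sN: "summable (\<lambda>j. norm (e (N + j)))" using summable_ignore_initial_segment[OF se, of N] by (simp add: add.commute)
  define B where "B = D N * exp (48 * (\<Sum>j. norm (e (N + j))))"
  have DB: "D n \<le> B" if "n \<ge> N" for n
  proof -
    have "D n \<le> D N * exp (48 * (\<Sum>j<n - N. norm (e (N + j))))" using Dk[of "n - N"] that by simp
    also have "\<dots> \<le> B" unfolding B_def
      by (intro mult_left_mono D0) (auto intro!: sum_le_suminf sN)
    finally show ?thesis .
  qed
  have "norm (v n) \<le> 2 * sqrt B" if n: "n \<ge> N" for n
  proof -
    have "(norm (w n))\<^sup>2 \<le> D n"
      unfolding D_def using q34[OF n] by (simp add: pos_le_divide_eq mult_left_le)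
    then have "norm (w n) \<le> sqrt B" using DB[OF n] by (intro real_le_rsqrt) linarith
    then show ?thesis using v_le[OF n] by linarith
  qed
  then have "norm (v n) \<le> max (2 * sqrt B) (Max ((\<lambda>n. norm (v n)) ` {..N}))" for n
    by (cases "n \<ge> N") (auto simp: le_max_iff_disj)
  then show ?thesis by blast
qed

section \<open>The exceptional set\<close>

lemma summable_on_Sigma_const:
  fixes g :: "'a \<Rightarrow> real"
  assumes "g summable_on T" "\<And>t. t \<in> T \<Longrightarrow> 0 \<le> g t" "\<And>t. t \<in> T \<Longrightarrow> finite (B t) \<and> card (B t) \<le> d"
  shows "(\<lambda>(t, s). g t) summable_on Sigma T B"
proof (rule summable_on_SigmaI[where g = "\<lambda>t. real (card (B t)) * g t"])
  show "((\<lambda>y. case (t, y) of (t, s) \<Rightarrow> g t) has_sum real (card (B t)) * g t) (B t)" if "t \<in> T" for t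
    using assms(3)[OF that] by (simp add: has_sum_finite_iff)
  show "(\<lambda>t. real (card (B t)) * g t) summable_on T"
    by (rule summable_on_comparison_test[OF summable_on_cmult_right[OF assms(1), of "real d"]])
       (use assms(2,3) in \<open>auto intro!: mult_right_mono\<close>)
qed (use assms in auto)

text \<open>One potential governs all small denominators: each pair of a tree \<open>t\<close> and
  one of its subtrees puts the mass \<open>weight a t powr \<beta>\<close> at the frequency of the
  subtree, with exponent \<open>\<beta> * d\<close>. Off the frequencies and where the potential is
  finite, the amplitudes are summable and the truncated series is the approximate orbit that bounds
  the solutions.\<close>

lemma exceptional_set:
  fixes \<alpha> :: "nat \<Rightarrow> complex" and c :: "nat \<Rightarrow> complex" and \<phi> :: "nat \<Rightarrow> real"
    and \<gamma> :: "nat \<Rightarrow> nat \<Rightarrow> complex" and d :: nat and \<beta> :: real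
  assumes \<alpha>1: "\<And>n. norm (\<alpha> n) < 1"
    and \<alpha>: "\<And>n. (\<lambda>l. c l * cis (- (real n * \<phi> l)) * \<gamma> l n) sums \<alpha> n"
    and d: "odd d" and \<beta>: "0 < \<beta>" "\<beta> \<le> 1"
    and var: "(SUP l. \<Sum>n. ennreal (norm (\<gamma> l (Suc n + 1) - \<gamma> l (Suc n)))) < \<infinity>"
    and decay: "(\<Sum>n. (SUP l. ennreal (norm (\<gamma> l (Suc n)))) ^ (d + 2)) < \<infinity>"
    and c: "summable (\<lambda>l. norm (c l) powr \<beta>)"
  obtains E where "\<And>s. \<beta> * real d < s \<Longrightarrow> hausdorff_measure s E = 0"
    "\<And>z u0. norm z = 1 \<Longrightarrow> z \<notin> E \<Longrightarrow> \<exists>M. \<forall>n. norm (circle_sol \<alpha> u0 z n) \<le> M"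
proof -
  define V where "V = enn2real (SUP l. \<Sum>n. ennreal (norm (\<gamma> l (Suc n + 1) - \<gamma> l (Suc n))))"
  define h where "h n = enn2real (SUP l. ennreal (norm (\<gamma> l (Suc n))))" for n
  \<comment> \<open>The added geometric sequence keeps the weights positive even where
    \<open>c l = 0\<close>, as the masses of the potential must be, and its powers \<beta> are
    summable too.\<close>
  define a where "a l = norm (c l) + (1 / 2) ^ l" for l
  have a0: "0 < a l" for l by (simp add: a_def add_nonneg_pos)
  have ca: "norm (c l) \<le> a l" for l by (simp add: a_def)
  have "(1 / 2) powr \<beta> < (1::real)" using \<beta> powr_less_mono2[of \<beta> "1/2" 1] by simp
  have "summable (\<lambda>l. a l powr \<beta>)"
  proof (rule summable_comparison_test')
    show "summable (\<lambda>l. norm (c l) powr \<beta> + ((1 / 2) powr \<beta>) ^ l)"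
      using \<open>(1 / 2) powr \<beta> < 1\<close> by (intro summable_add c summable_geometric) simp
    fix l :: nat
    have "a l powr \<beta> \<le> norm (c l) powr \<beta> + ((1 / 2) ^ l) powr \<beta>"
      unfolding a_def using \<beta> by (intro powr_add_le_add_powr) auto
    also have "((1 / 2) ^ l) powr \<beta> = ((1 / 2 :: real) powr \<beta>) ^ l"
      by (simp add: powr_powr mult.commute flip: powr_realpow)
    finally show "norm (a l powr \<beta>) \<le> norm (c l) powr \<beta> + ((1 / 2) powr \<beta>) ^ l" by simp
  qed
  then have sa: "(\<lambda>l. a l powr \<beta>) summable_on UNIV" by (rule summable_nonneg_imp_summable_on) simp
  define C where "C = (\<Sum>\<^sub>\<infinity>l. a l powr \<beta>)"
  have "a l \<le> a l powr \<beta> * C powr ((1 - \<beta>) / \<beta>)" for l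
  proof -
    have "a l powr \<beta> \<le> C" unfolding C_def using finite_sum_le_infsum[OF sa, where B = "{l}"] by simp
    then have "(a l powr \<beta>) powr ((1 - \<beta>) / \<beta>) \<le> C powr ((1 - \<beta>) / \<beta>)"
      using \<beta> by (intro powr_mono2) auto
    then have "a l powr \<beta> * a l powr (1 - \<beta>) \<le> a l powr \<beta> * C powr ((1 - \<beta>) / \<beta>)"
      using \<beta> by (intro mult_left_mono) (auto simp: powr_powr)
    then show ?thesis using a0[of l] by (simp add: powr_add[symmetric])
  qed
  then have "norm (c l) \<le> a l powr \<beta> * C powr ((1 - \<beta>) / \<beta>)" for l using ca order_trans by blast
  then have sc: "(\<lambda>l. norm (c l)) summable_on UNIV"
    by (intro summable_on_comparison_test[OF summable_on_cmult_left[OF sa]]) auto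
  have d1: "1 \<le> d" using d by (cases d) auto
  have V0: "0 \<le> V" unfolding V_def by (rule enn2real_nonneg)
  have V: "(\<Sum>n<N. norm (\<gamma> l (Suc (n + Suc k)) - \<gamma> l (n + Suc k))) \<le> V" for l N k
  proof -
    let ?f = "\<lambda>n. norm (\<gamma> l (Suc n + 1) - \<gamma> l (Suc n))"
    have "ennreal (\<Sum>n<N. norm (\<gamma> l (Suc (n + Suc k)) - \<gamma> l (n + Suc k))) = (\<Sum>n<N. ennreal (?f (n + k)))"
      by (simp add: sum_ennreal)
    also have "\<dots> = (\<Sum>n\<in>(\<lambda>n. n + k) ` {..<N}. ennreal (?f n))" by (simp add: sum.reindex)
    also have "\<dots> \<le> (\<Sum>n. ennreal (?f n))" by (intro sum_le_suminf) auto
    also have "\<dots> \<le> (SUP l. \<Sum>n. ennreal (norm (\<gamma> l (Suc n + 1) - \<gamma> l (Suc n))))" by (rule SUP_upper) simp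
    also have "\<dots> = ennreal V" unfolding V_def
      by (rule ennreal_enn2real[symmetric]) (rule var[unfolded infinity_ennreal_def])
    finally show ?thesis using V0 by (simp only: ennreal_le_iff)
  qed
  have hfin: "(SUP l. ennreal (norm (\<gamma> l (Suc n)))) = ennreal (h n)" for n
  proof -
    have "(SUP l. ennreal (norm (\<gamma> l (Suc n)))) ^ (d + 2) \<le> (\<Sum>n. (SUP l. ennreal (norm (\<gamma> l (Suc n)))) ^ (d + 2))"
      using sum_le_suminf[of "\<lambda>n. (SUP l. ennreal (norm (\<gamma> l (Suc n)))) ^ (d + 2)" "{n}"] by auto
    then have "(SUP l. ennreal (norm (\<gamma> l (Suc n)))) ^ (d + 2) < \<infinity>" using decay by (rule le_less_trans)
    then have "(SUP l. ennreal (norm (\<gamma> l (Suc n)))) < top" unfolding infinity_ennreal_def power_less_top_ennreal by simp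
    then show ?thesis unfolding h_def by (rule ennreal_enn2real[symmetric])
  qed
  have h0: "0 \<le> h n" for n unfolding h_def by (rule enn2real_nonneg)
  have h: "norm (\<gamma> l (Suc n)) \<le> h n" for l n
  proof -
    have "ennreal (norm (\<gamma> l (Suc n))) \<le> ennreal (h n)" unfolding hfin[symmetric] by (rule SUP_upper) simp
    then show ?thesis using h0 by (simp add: ennreal_le_iff)
  qed
  have "(\<Sum>n. ennreal (h n ^ (d + 2))) < \<infinity>"
    using decay by (simp only: hfin ennreal_power h0)
  then have sh: "summable (\<lambda>n. h n ^ (d + 2))"
    by (intro summable_suminf_not_top) (auto simp: h0)
  have "\<forall>\<^sub>F n in sequentially. h n ^ (d + 2) < 1"
    using summable_LIMSEQ_zero[OF sh] by (intro order_tendstoD) auto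
  \<comment> \<open>The disc recursion is started only at \<open>Suc k\<close>, where the
    coefficients are at most 1 in modulus; the shift by one occurs because \<open>h n\<close> bounds
    the coefficients at \<open>Suc n\<close>.\<close>
  then obtain k where k: "\<And>n. n \<ge> k \<Longrightarrow> h n ^ (d + 2) < 1" unfolding eventually_sequentially by blast
  have hk: "h n \<le> 1" if "n \<ge> k" for n
    using k[OF that] one_le_power[of "h n" "d + 2"] by (metis linorder_not_le nle_le)
  define I where "I = (SIGMA t:trees_upto d. set (subs t))"
  define \<xi> where "\<xi> = (\<lambda>(t :: otree, s). cis (freq \<phi> s))"
  define m where "m = (\<lambda>(t, s :: otree). weight a t powr \<beta>)"
  define E where "E = {z. (\<exists>i\<in>I. z = \<xi> i) \<or> \<not> (\<lambda>i. m i * dist z (\<xi> i) powr (- (\<beta> * real d))) summable_on I}"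
  have "weight (\<lambda>k. a k powr \<beta>) summable_on trees_upto d"
    by (rule summable_weight[OF sa]) (use a0 in \<open>simp add: less_imp_neq[symmetric]\<close>)
  then have sw: "(\<lambda>t. weight a t powr \<beta>) summable_on trees_upto d"
    by (simp add: weight_powr[OF a0, abs_def])
  have sm: "m summable_on I"
    unfolding m_def I_def
    by (rule summable_on_Sigma_const[OF sw, where d = d])
       (auto simp: trees_upto_def intro: order_trans[OF card_length])
  have m0: "0 < m i" for i using weight_pos[of a, OF a0] by (simp add: m_def case_prod_unfold less_imp_neq[symmetric])
  have H: "hausdorff_measure s E = 0" if "\<beta> * real d < s" for s
    unfolding E_def by (rule hausdorff_measure_potential_infinite[OF sm m0 _ that]) (use \<beta> d1 in auto)
  have "\<exists>M. \<forall>n. norm (circle_sol \<alpha> u0 z n) \<le> M" if z: "norm z = 1" "z \<notin> E" for z u0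
  proof -
    let ?k = "Suc k"
    \<comment> \<open>Restarting at a later index multiplies the coefficients by phases only, so the
      majorant \<open>a\<close> still applies and \<open>E\<close> is the set for the restarted
      recursion as well.\<close>
    define c' where "c' l = c l * cis (- (real ?k * \<phi> l))" for l
    have c'a: "norm (c' l) \<le> a l" for l using ca[of l] by (simp add: c'_def norm_mult)
    have ne: "z \<noteq> cis (freq \<phi> t)" if t: "t \<in> trees_upto d" for t
    proof -
      have "t \<in> set (subs t)" by (cases t) auto
      then have "(t, t) \<in> I" using t by (simp add: I_def)
      then show ?thesis using z(2) by (auto simp: E_def \<xi>_def)
    qed
    have pot: "(\<lambda>(t, s). weight a t powr \<beta> * dist z (cis (freq \<phi> s)) powr (- (\<beta> * real d))) summable_on I"
      using z(2) by (simp add: E_def m_def \<xi>_def case_prod_unfold)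
    have amp: "(\<lambda>t. norm (amp c' \<phi> z t)) summable_on trees_upto d"
      by (rule summable_amp[OF c'a a0 z(1) \<beta> ne pot[unfolded I_def]])
    have sc': "(\<lambda>l. norm (c' l)) summable_on UNIV" using sc by (simp add: c'_def norm_mult)
    have \<alpha>': "\<alpha> (n + ?k) = (\<Sum>\<^sub>\<infinity>l. c' l * cis (- (real n * \<phi> l)) * \<gamma> l (n + ?k))" for n
    proof -
      have eq: "c' l * cis (- (real n * \<phi> l)) = c l * cis (- (real (n + ?k) * \<phi> l))" for l
        by (simp add: c'_def mult.assoc cis_mult algebra_simps)
      have "(\<lambda>l. c l * cis (- (real (n + ?k) * \<phi> l)) * \<gamma> l (n + ?k)) summable_on UNIV"
      proof (rule abs_summable_summable, rule summable_on_comparison_test[OF summable_on_cmult_left[OF sc]])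
        show "norm (c l * cis (- (real (n + ?k) * \<phi> l)) * \<gamma> l (n + ?k)) \<le> norm (c l) * h (n + k)" for l
          using h[of l "n + k"] by (auto simp: norm_mult intro!: mult_left_mono)
      qed simp
      from has_sum_imp_sums[OF has_sum_infsum[OF this]] show ?thesis
        unfolding eq using \<alpha>[of "n + ?k"] sums_unique2 by blast
    qed
    obtain q where q: "q \<longlonglongrightarrow> 0"
      "summable (\<lambda>n. norm (q (Suc n) - z * q n - (- z * cnj (\<alpha> (n + ?k)) + \<alpha> (n + ?k) * q n * q (Suc n))))"
    proof (rule approximate_orbit[OF sc' amp d z(1) ne \<alpha>', where h = "\<lambda>n. h (n + k)" and V = V])
      show "norm (\<gamma> l (n + ?k)) \<le> h (n + k)" for l n using h[of l "n + k"] by simp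
      show "h (n + k) \<le> 1" for n by (rule hk) simp
      show "summable (\<lambda>n. h (n + k) ^ (d + 2))" using sh by (rule summable_ignore_initial_segment)
      show "(\<Sum>n<N. norm (\<gamma> l (Suc n + ?k) - \<gamma> l (n + ?k))) \<le> V" for l N using V[where N = N and l = l and k = k] by simp
    qed
    let ?u = "circle_sol \<alpha> u0 z"
    define v where "v n = z ^ n * cnj (?u n)" for n
    have nv: "norm (?u n) = norm (v n)" for n using z(1) by (simp add: v_def norm_mult norm_power)
    have "\<exists>M. \<forall>n. norm (v (n + ?k)) \<le> M"
    proof (rule bounded_of_approximate_orbit[OF z(1) _ _ _ _ q, where u = "\<lambda>n. ?u (n + ?k)"])
      show "norm (\<alpha> (n + ?k)) < 1" for n by (rule \<alpha>1)
      show "norm (?u (n + ?k)) = norm (v (n + ?k))" for n by (rule nv)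
      show "?u (Suc n + ?k) = (z * ?u (n + ?k) - cnj (\<alpha> (n + ?k)) * v (n + ?k)) / sqrt (1 - (norm (\<alpha> (n + ?k)))\<^sup>2)" for n
        by (simp only: add_Suc circle_sol.simps v_def mult.assoc)
      show "v (Suc n + ?k) = (v (n + ?k) - \<alpha> (n + ?k) * z * ?u (n + ?k)) / sqrt (1 - (norm (\<alpha> (n + ?k)))\<^sup>2)" for n
        unfolding v_def add_Suc by (rule cnj_circle_sol_Suc[OF z(1)])
    qed
    then obtain M where M: "\<And>n. norm (v (n + ?k)) \<le> M" by blast
    have "norm (?u n) \<le> max M (Max ((\<lambda>n. norm (?u n)) ` {..?k}))" for n
    proof (cases "n \<le> ?k")
      case False
      then show ?thesis using M[of "n - ?k"] nv[of n] by (simp add: le_max_iff_disj)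
    qed (simp add: le_max_iff_disj)
    then show ?thesis by blast
  qed
  with H show thesis using that by blast
qed

section \<open>Dependence on the spectral parameter\<close>

context
  fixes \<alpha> :: "nat \<Rightarrow> complex" and \<eta> :: complex
  assumes \<alpha>1: "\<And>n. norm (\<alpha> n) < 1" and \<eta>: "norm \<eta> = 1"
begin

text \<open>The normalised transfer matrix at \<eta> has determinant \<eta>. The inputs
  \<open>s\<close> and \<open>r\<close> are arbitrary, so that a step at another parameter \<zeta>
  fits as well, with \<open>s = \<zeta> * cnj \<eta> * p\<close>.\<close>

lemma wronskian_step:
  assumes "p' = (\<eta> * s - cnj (\<alpha> n) * r) / sqrt (1 - (norm (\<alpha> n))\<^sup>2)" "r' = (r - \<alpha> n * \<eta> * s) / sqrt (1 - (norm (\<alpha> n))\<^sup>2)"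
    and "u' = (\<eta> * u - cnj (\<alpha> n) * v) / sqrt (1 - (norm (\<alpha> n))\<^sup>2)" "v' = (v - \<alpha> n * \<eta> * u) / sqrt (1 - (norm (\<alpha> n))\<^sup>2)"
  shows "p' * v' - r' * u' = \<eta> * (s * v - r * u)"
proof -
  let ?R = "complex_of_real (sqrt (1 - (norm (\<alpha> n))\<^sup>2))"
  have "(norm (\<alpha> n))\<^sup>2 < 1" using \<alpha>1[of n] by (simp add: power_less_one_iff)
  then have R0: "?R \<noteq> 0" and RR: "?R * ?R = 1 - \<alpha> n * cnj (\<alpha> n)"
    by (auto simp: complex_norm_square[symmetric] simp flip: of_real_mult)
  have "p' * v' - r' * u' = ((\<eta> * s - cnj (\<alpha> n) * r) * (v - \<alpha> n * \<eta> * u) - (r - \<alpha> n * \<eta> * s) * (\<eta> * u - cnj (\<alpha> n) * v)) / (?R * ?R)"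
    unfolding assms by (simp only: times_divide_times_eq diff_divide_distrib[symmetric])
  also have "(\<eta> * s - cnj (\<alpha> n) * r) * (v - \<alpha> n * \<eta> * u) - (r - \<alpha> n * \<eta> * s) * (\<eta> * u - cnj (\<alpha> n) * v)
      = (1 - \<alpha> n * cnj (\<alpha> n)) * (\<eta> * (s * v - r * u))"
    by (simp add: algebra_simps)
  finally show ?thesis using R0 by (simp add: RR[symmetric])
qed

text \<open>The initial value \<open>\<i>\<close> gives, up to the factor \<open>\<i>\<close>, the orthonormal polynomials of the second kind.\<close>

definition wronsk :: "nat \<Rightarrow> complex" where
  "wronsk n = circle_sol \<alpha> 1 \<eta> n * (\<eta> ^ n * cnj (circle_sol \<alpha> \<i> \<eta> n)) - \<eta> ^ n * cnj (circle_sol \<alpha> 1 \<eta> n) * circle_sol \<alpha> \<i> \<eta> n"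

lemma circle_sol_Suc': "circle_sol \<alpha> u0 z (Suc n) =
     (z * circle_sol \<alpha> u0 z n - cnj (\<alpha> n) * (z ^ n * cnj (circle_sol \<alpha> u0 z n))) / sqrt (1 - (norm (\<alpha> n))\<^sup>2)"
  by (simp add: mult.assoc)

lemma wronsk_Suc: "wronsk (Suc n) = \<eta> * wronsk n"
  unfolding wronsk_def
  by (rule wronskian_step[OF circle_sol_Suc' cnj_circle_sol_Suc[OF \<eta>] circle_sol_Suc' cnj_circle_sol_Suc[OF \<eta>]])

lemma norm_wronsk: "norm (wronsk n) = 2"
proof (induction n)
  case 0
  have "wronsk 0 = - (2 * \<i>)" by (simp add: wronsk_def)
  then show ?case by (simp add: norm_mult)
qed (simp add: wronsk_Suc norm_mult \<eta>)

text \<open>The Wronskian has constant modulus 2, so the first solution cannot become small while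
  the second stays bounded.\<close>

lemma circle_sol_lower:
  assumes "norm (circle_sol \<alpha> \<i> \<eta> n) \<le> M"
  shows "1 \<le> norm (circle_sol \<alpha> 1 \<eta> n) * M"
proof -
  let ?u = "norm (circle_sol \<alpha> 1 \<eta> n)" and ?u2 = "norm (circle_sol \<alpha> \<i> \<eta> n)"
  have "2 \<le> ?u * ?u2 + ?u * ?u2"
    using norm_triangle_ineq4[of "circle_sol \<alpha> 1 \<eta> n * (\<eta> ^ n * cnj (circle_sol \<alpha> \<i> \<eta> n))" "\<eta> ^ n * cnj (circle_sol \<alpha> 1 \<eta> n) * circle_sol \<alpha> \<i> \<eta> n"]
      norm_wronsk[of n] by (simp add: wronsk_def norm_mult norm_power \<eta>)
  then have "1 \<le> ?u * ?u2" by linarith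
  also have "\<dots> \<le> ?u * M" using assms by (intro mult_left_mono) auto
  finally show ?thesis .
qed

text \<open>Variation of constants in the spectral parameter.\<close>

lemma circle_sol_perturb:
  assumes \<zeta>: "norm \<zeta> = 1"
    and M: "\<And>n. norm (circle_sol \<alpha> 1 \<eta> n) \<le> M" "\<And>n. norm (circle_sol \<alpha> \<i> \<eta> n) \<le> M"
  shows "norm (circle_sol \<alpha> 1 \<zeta> n - circle_sol \<alpha> 1 \<eta> n) \<le> M * (exp (M\<^sup>2 * (real n * norm (\<zeta> - \<eta>))) - 1)"
proof -
  define u where "u = circle_sol \<alpha> 1 \<eta>"
  define u2 where "u2 = circle_sol \<alpha> \<i> \<eta>"
  define v where "v n = \<eta> ^ n * cnj (u n)" for n
  define v2 where "v2 n = \<eta> ^ n * cnj (u2 n)" for n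
  define p where "p = circle_sol \<alpha> 1 \<zeta>"
  define r where "r n = \<zeta> ^ n * cnj (p n)" for n
  define W where "W = wronsk"
  have W: "W n = u n * v2 n - v n * u2 n" for n by (simp add: W_def wronsk_def u_def u2_def v_def v2_def)
  have W0: "W n \<noteq> 0" for n using norm_wronsk[of n] by (auto simp: W_def)
  \<comment> \<open>Coordinates of the pair \<open>(p, r)\<close> at \<zeta> in the basis of the two
    solutions at \<eta>, by Cramer's rule.\<close>
  define a where "a n = (p n * v2 n - r n * u2 n) / W n" for n
  define b where "b n = (u n * r n - v n * p n) / W n" for n
  define \<epsilon> where "\<epsilon> = norm (\<zeta> - \<eta>)"
  have M0: "0 \<le> M" using M(1)[of 0] by simp
  have nv: "norm (v n) \<le> M" "norm (v2 n) \<le> M" "norm (u n) \<le> M" "norm (u2 n) \<le> M" for n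
    using M[of n] by (simp_all add: v_def v2_def u_def u2_def norm_mult norm_power \<eta>)
  have p_eq: "p n = a n * u n + b n * u2 n" for n
  proof -
    have "p n * W n = (p n * v2 n - r n * u2 n) * u n + (u n * r n - v n * p n) * u2 n"
      by (simp add: W algebra_simps)
    then show ?thesis using W0[of n] by (simp add: a_def b_def field_simps)
  qed
  \<comment> \<open>Writing \<zeta> as \<open>\<eta> * (\<zeta> * cnj \<eta>)\<close> turns the step
    at \<zeta> into a step at \<eta> with rotated input, so only
    \<open>\<zeta> * cnj \<eta> - 1\<close> drives the coordinates.\<close>
  have \<eta>\<eta>: "\<eta> * (\<zeta> * cnj \<eta> * x) = \<zeta> * x" for x
    using \<eta> by (simp add: mult_ac complex_norm_square[symmetric] flip: mult.assoc[of \<eta> "cnj \<eta>"])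
  have rho: "p (Suc n) = (\<eta> * (\<zeta> * cnj \<eta> * p n) - cnj (\<alpha> n) * r n) / sqrt (1 - (norm (\<alpha> n))\<^sup>2)"
    "r (Suc n) = (r n - \<alpha> n * \<eta> * (\<zeta> * cnj \<eta> * p n)) / sqrt (1 - (norm (\<alpha> n))\<^sup>2)" for n
    unfolding mult.assoc[of "\<alpha> n"] \<eta>\<eta> unfolding p_def r_def
    by (rule circle_sol_Suc') (simp only: cnj_circle_sol_Suc[OF \<zeta>] mult.assoc)
  have uv: "u (Suc n) = (\<eta> * u n - cnj (\<alpha> n) * v n) / sqrt (1 - (norm (\<alpha> n))\<^sup>2)"
    "v (Suc n) = (v n - \<alpha> n * \<eta> * u n) / sqrt (1 - (norm (\<alpha> n))\<^sup>2)"
    "u2 (Suc n) = (\<eta> * u2 n - cnj (\<alpha> n) * v2 n) / sqrt (1 - (norm (\<alpha> n))\<^sup>2)"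
    "v2 (Suc n) = (v2 n - \<alpha> n * \<eta> * u2 n) / sqrt (1 - (norm (\<alpha> n))\<^sup>2)" for n
    unfolding u_def v_def u2_def v2_def by (rule circle_sol_Suc' cnj_circle_sol_Suc[OF \<eta>])+
  have WS: "W (Suc n) = \<eta> * W n" for n by (simp add: W_def wronsk_Suc)
  have \<eta>0: "\<eta> \<noteq> 0" using \<eta> by auto
  have aS: "a (Suc n) = a n + (\<zeta> * cnj \<eta> - 1) * p n * v2 n / W n" for n
    unfolding a_def WS wronskian_step[OF rho uv(3,4)] using \<eta>0 W0[of n] by (simp add: field_simps)
  have bS: "b (Suc n) = b n - (\<zeta> * cnj \<eta> - 1) * p n * v n / W n" for n
  proof -
    have "u (Suc n) * r (Suc n) - v (Suc n) * p (Suc n) = - (\<eta> * (\<zeta> * cnj \<eta> * p n * v n - r n * u n))"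
      unfolding wronskian_step[OF rho uv(1,2), symmetric] by (simp add: algebra_simps)
    then have "b (Suc n) = - (\<eta> * (\<zeta> * cnj \<eta> * p n * v n - r n * u n)) / (\<eta> * W n)"
      by (simp only: b_def WS)
    also have "\<dots> = b n - (\<zeta> * cnj \<eta> - 1) * p n * v n / W n"
      unfolding b_def using \<eta>0 W0[of n] by (simp add: field_simps)
    finally show ?thesis .
  qed
  have n\<epsilon>: "norm (\<zeta> * cnj \<eta> - 1) = \<epsilon>"
  proof -
    have "\<zeta> * cnj \<eta> - 1 = (\<zeta> - \<eta>) * cnj \<eta>" using \<eta> by (simp add: algebra_simps complex_norm_square[symmetric])
    then show ?thesis by (simp add: norm_mult \<eta> \<epsilon>_def)
  qed
  have p_le: "norm (p n) \<le> M * (norm (a n) + norm (b n))" for n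
  proof -
    have "norm (p n) \<le> norm (a n) * norm (u n) + norm (b n) * norm (u2 n)"
      unfolding p_eq by (intro norm_triangle_le) (simp add: norm_mult)
    also have "\<dots> \<le> norm (a n) * M + norm (b n) * M" by (intro add_mono mult_left_mono nv) auto
    finally show ?thesis by (simp add: algebra_simps)
  qed
  define g where "g n = norm (a n - 1) + norm (b n)" for n
  have ab: "norm (a n) + norm (b n) \<le> 1 + g n" for n
    using norm_triangle_ineq[of "a n - 1" 1] by (simp add: g_def)
  \<comment> \<open>A discrete Gronwall step: since the Wronskian has modulus 2, each of the two
    coordinates moves by at most half of \<open>M\<^sup>2 * \<epsilon> * (1 + g n)\<close>.\<close>
  have gS: "1 + g (Suc n) \<le> (1 + M\<^sup>2 * \<epsilon>) * (1 + g n)" for n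
  proof -
    have inc: "norm ((\<zeta> * cnj \<eta> - 1) * p n * y / W n) \<le> M\<^sup>2 * \<epsilon> * (1 + g n) / 2" if "norm y \<le> M" for y
    proof -
      have "norm ((\<zeta> * cnj \<eta> - 1) * p n * y / W n) = \<epsilon> * norm (p n) * norm y / 2"
        using norm_wronsk[of n] by (simp add: norm_mult norm_divide n\<epsilon> W_def)
      also have "\<dots> \<le> \<epsilon> * (M * (1 + g n)) * M / 2"
        using order_trans[OF p_le mult_left_mono[OF ab M0], of n] that M0
        by (intro divide_right_mono mult_mono) (auto simp: \<epsilon>_def g_def)
      finally show ?thesis by (simp add: power2_eq_square mult_ac)
    qed
    have "norm (a (Suc n) - 1) \<le> norm (a n - 1) + M\<^sup>2 * \<epsilon> * (1 + g n) / 2"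
      using norm_triangle_ineq[of "a n - 1" "(\<zeta> * cnj \<eta> - 1) * p n * v2 n / W n"] inc[OF nv(2)[of n]] by (simp add: aS add_diff_eq diff_add_eq)
    moreover have "norm (b (Suc n)) \<le> norm (b n) + M\<^sup>2 * \<epsilon> * (1 + g n) / 2"
      using norm_triangle_ineq4[of "b n" "(\<zeta> * cnj \<eta> - 1) * p n * v n / W n"] inc[OF nv(1)[of n]] by (simp add: bS)
    ultimately have "norm (a (Suc n) - 1) + norm (b (Suc n)) \<le> norm (a n - 1) + norm (b n) + M\<^sup>2 * \<epsilon> * (1 + g n)"
      by linarith
    then have "g (Suc n) \<le> g n + M\<^sup>2 * \<epsilon> * (1 + g n)" by (simp only: g_def)
    then show ?thesis by (simp add: distrib_right)
  qed
  have base: "a 0 = 1" "b 0 = 0"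
    using W0[of 0] W[of 0] by (simp_all add: a_def b_def p_def r_def u_def v_def u2_def v2_def)
  have "1 + g n \<le> exp (M\<^sup>2 * (real n * \<epsilon>))" for n
  proof (induction n)
    case (Suc n)
    have "1 + g (Suc n) \<le> (1 + M\<^sup>2 * \<epsilon>) * (1 + g n)" by (rule gS)
    also have "\<dots> \<le> exp (M\<^sup>2 * \<epsilon>) * exp (M\<^sup>2 * (real n * \<epsilon>))"
      by (intro mult_mono Suc exp_ge_add_one_self) (auto simp: g_def)
    also have "\<dots> = exp (M\<^sup>2 * (real (Suc n) * \<epsilon>))" by (simp add: exp_add[symmetric] algebra_simps)
    finally show ?case .
  qed (simp add: g_def base)
  then have "M * g n \<le> M * (exp (M\<^sup>2 * (real n * \<epsilon>)) - 1)"
    using M0 by (intro mult_left_mono) (simp_all add: le_diff_eq add.commute)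
  moreover have "norm (p n - u n) \<le> M * g n"
  proof -
    have "p n - u n = (a n - 1) * u n + b n * u2 n" unfolding p_eq by (simp add: algebra_simps)
    then have "norm (p n - u n) \<le> norm (a n - 1) * norm (u n) + norm (b n) * norm (u2 n)"
      by (simp only:) (intro norm_triangle_le, simp add: norm_mult)
    also have "\<dots> \<le> norm (a n - 1) * M + norm (b n) * M" by (intro add_mono mult_left_mono nv) auto
    finally show ?thesis by (simp add: g_def algebra_simps)
  qed
  ultimately show ?thesis by (simp add: p_def u_def \<epsilon>_def)
qed

end

section \<open>Arc length\<close>

lemma space_circle_borel [simp]: "space circle_borel = unit_circle"
  by (simp add: circle_borel_def space_restrict_space)

lemma cis_measurable_circle_borel [measurable]: "cis \<in> borel_measurable borel" "cis \<in> measurable borel circle_borel"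
proof -
  show *: "cis \<in> borel_measurable borel"
    by (intro borel_measurable_continuous_onI continuous_intros)
  show "cis \<in> measurable borel circle_borel"
    unfolding circle_borel_def by (rule measurable_restrict_space2) (use * in auto)
qed

lemma sets_circle_borel_subset: "A \<in> sets circle_borel \<Longrightarrow> A \<subseteq> unit_circle \<and> A \<in> sets borel"
  unfolding circle_borel_def by (auto simp: sets_restrict_space)

lemma sets_circle_borelI: "A \<in> sets borel \<Longrightarrow> A \<subseteq> unit_circle \<Longrightarrow> A \<in> sets circle_borel"
  unfolding circle_borel_def by (subst sets_restrict_space_iff) auto

lemma sets_circle_borel_Int: "A \<in> sets borel \<Longrightarrow> A \<inter> unit_circle \<in> sets circle_borel"
  by (rule sets_circle_borelI) auto

lemma sets_arc_measure [simp]: "sets (arc_measure w) = sets circle_borel"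
  by (simp add: arc_measure_def)

lemma emeasure_arc_measure:
  assumes [measurable]: "w \<in> borel_measurable borel" and A: "A \<in> sets circle_borel"
  shows "emeasure (arc_measure w) A = (\<integral>\<^sup>+\<theta>. ennreal (w \<theta> / (2 * pi)) * indicator ({0..<2 * pi} \<inter> cis -` A) \<theta> \<partial>lborel)"
proof -
  have [measurable]: "A \<in> sets borel" using sets_circle_borel_subset[OF A] by simp
  have [measurable]: "cis -` A \<in> sets borel"
    using measurable_sets_borel[OF cis_measurable_circle_borel(1) \<open>A \<in> sets borel\<close>] by simp
  have "emeasure (arc_measure w) A = emeasure (density lborel (\<lambda>\<theta>. ennreal (w \<theta> / (2 * pi)) * indicator {0..<2 * pi} \<theta>)) (cis -` A)"
    unfolding arc_measure_def by (subst emeasure_distr) (use A in auto)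
  also have "\<dots> = (\<integral>\<^sup>+\<theta>. ennreal (w \<theta> / (2 * pi)) * indicator {0..<2 * pi} \<theta> * indicator (cis -` A) \<theta> \<partial>lborel)"
    by (subst emeasure_density) auto
  also have "\<dots> = (\<integral>\<^sup>+\<theta>. ennreal (w \<theta> / (2 * pi)) * indicator ({0..<2 * pi} \<inter> cis -` A) \<theta> \<partial>lborel)"
    by (intro nn_integral_cong) (auto simp: indicator_def)
  finally show ?thesis .
qed

definition arc_len :: "complex set \<Rightarrow> ennreal" where
  "arc_len A = emeasure lborel ({0..<2 * pi} \<inter> cis -` A)"

lemma arc_sets [measurable]: "A \<in> sets borel \<Longrightarrow> {0..<2 * pi} \<inter> cis -` A \<in> sets borel"
  using measurable_sets_borel[OF cis_measurable_circle_borel(1)] by auto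

lemma arc_measure_1:
  assumes A: "A \<in> sets circle_borel"
  shows "emeasure (arc_measure (\<lambda>_. 1)) A = ennreal (1 / (2 * pi)) * arc_len A"
proof -
  have "{0..<2 * pi} \<inter> cis -` A \<in> sets borel" using sets_circle_borel_subset[OF A] by auto
  then show ?thesis unfolding arc_len_def
    by (subst emeasure_arc_measure[OF _ A]) (auto simp: nn_integral_cmult_indicator)
qed

lemma arc_measure_1_eq_0_iff:
  "A \<in> sets circle_borel \<Longrightarrow> emeasure (arc_measure (\<lambda>_. 1)) A = 0 \<longleftrightarrow> arc_len A = 0"
  by (simp add: arc_measure_1 ennreal_eq_0_iff) (metis not_le pi_gt_zero)

lemma norm_cis_diff: "norm (cis x - cis y) = 2 * \<bar>sin ((x - y) / 2)\<bar>"
proof -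
  have "(norm (cis x - cis y))\<^sup>2 = (cos x - cos y)\<^sup>2 + (sin x - sin y)\<^sup>2"
    by (simp add: cmod_power2)
  also have "\<dots> = ((cos x)\<^sup>2 + (sin x)\<^sup>2) + ((cos y)\<^sup>2 + (sin y)\<^sup>2) - 2 * (cos x * cos y + sin x * sin y)"
    by (simp add: power2_eq_square algebra_simps)
  also have "\<dots> = 2 - 2 * cos (x - y)" by (simp add: cos_diff)
  also have "x - y = 2 * ((x - y) / 2)" by simp
  also have "2 - 2 * cos (2 * ((x - y) / 2)) = (2 * sin ((x - y) / 2))\<^sup>2"
    unfolding cos_double_sin by (simp add: power2_eq_square)
  finally have "norm (cis x - cis y) = sqrt ((2 * sin ((x - y) / 2))\<^sup>2)"
    by (metis norm_ge_zero real_sqrt_unique)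
  then show ?thesis by (simp only: real_sqrt_abs abs_mult abs_numeral)
qed

lemma norm_cis_diff_le: "norm (cis x - cis y) \<le> \<bar>x - y\<bar>"
  unfolding norm_cis_diff using abs_sin_x_le_abs_x[of "(x - y) / 2"] by simp

lemma norm_cis_diff_ge:
  assumes "\<bar>x - y\<bar> \<le> pi"
  shows "\<bar>x - y\<bar> / 2 \<le> norm (cis x - cis y)"
proof -
  \<comment> \<open>Up to \<open>pi / 3\<close> the mean value theorem applies with
    \<open>cos \<ge> 1 / 2\<close>; beyond it, \<open>sin t\<close> is at least
    \<open>sqrt 3 / 2 \<ge> 0.85\<close>, while \<open>t / 2\<close> is at most 0.8.\<close>
  have *: "t / 2 \<le> sin t" if "0 \<le> t" "t \<le> pi / 2" for t
  proof (cases "t \<le> pi / 3")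
    case True
    have "\<exists>s. 0 \<le> s \<and> s \<le> t \<and> sin t - sin 0 = (t - 0) * cos s"
    proof (cases "t = 0")
      case False
      then have "0 < t" using that by simp
      from MVT2[OF this, of sin cos] obtain s where "0 < s" "s < t" "sin t - sin 0 = (t - 0) * cos s"
        by (auto intro: derivative_eq_intros)
      then show ?thesis by (intro exI[of _ s]) auto
    qed auto
    then obtain s where s: "0 \<le> s" "s \<le> t" "sin t = t * cos s" by auto
    have "cos (pi / 3) \<le> cos s" using s True that by (intro cos_monotone_0_pi_le) auto
    then have "t * (1 / 2) \<le> t * cos s" using that by (intro mult_left_mono) (auto simp: cos_60)
    then show ?thesis using s by simp
  next
    case False
    have "sin (pi / 3) \<le> sin t" using that False by (intro sin_monotone_2pi_le) auto
    then have "sqrt 3 / 2 \<le> sin t" by (simp add: sin_60)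
    moreover have "1.7 \<le> sqrt 3" by (rule real_le_rsqrt) (simp add: power2_eq_square)
    moreover have "t / 2 \<le> 3.2 / 4" using that pi_less_4 pi_approx by simp
    ultimately show ?thesis by simp
  qed
  have "\<bar>x - y\<bar> / 2 / 2 \<le> sin (\<bar>x - y\<bar> / 2)" using assms by (intro *) auto
  also have "\<dots> \<le> \<bar>sin ((x - y) / 2)\<bar>"
  proof (cases "x \<ge> y")
    case False
    then have "\<bar>x - y\<bar> / 2 = - ((x - y) / 2)" by (simp add: abs_if diff_divide_distrib)
    then have "sin (\<bar>x - y\<bar> / 2) = - sin ((x - y) / 2)" by (simp only: sin_minus)
    then show ?thesis by linarith
  qed simp
  finally show ?thesis unfolding norm_cis_diff by simp
qed

lemma arc_len_mono: "A \<subseteq> B \<Longrightarrow> B \<in> sets borel \<Longrightarrow> arc_len A \<le> arc_len B"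
  unfolding arc_len_def by (intro emeasure_mono) auto

lemma arc_len_le_diameter:
  assumes A: "A \<in> sets borel" "bounded A"
  shows "arc_len A \<le> ennreal (8 * diameter A)"
proof -
  \<comment> \<open>The lower chord bound needs angles at most \<open>pi\<close> apart, hence the
    cut into two half circles.\<close>
  have half: "emeasure lborel ({l..<l + pi} \<inter> cis -` A) \<le> ennreal (4 * diameter A)" for l
  proof (cases "{l..<l + pi} \<inter> cis -` A = {}")
    case False
    then obtain \<theta>0 where "\<theta>0 \<in> {l..<l + pi} \<inter> cis -` A" by blast
    then have \<theta>0: "\<theta>0 \<in> {l..<l + pi}" "cis \<theta>0 \<in> A" by simp_all
    have "{l..<l + pi} \<inter> cis -` A \<subseteq> {\<theta>0 - 2 * diameter A..\<theta>0 + 2 * diameter A}"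
    proof
      fix \<theta> assume \<theta>: "\<theta> \<in> {l..<l + pi} \<inter> cis -` A"
      have "\<bar>\<theta> - \<theta>0\<bar> / 2 \<le> norm (cis \<theta> - cis \<theta>0)" using \<theta> \<theta>0 by (intro norm_cis_diff_ge) auto
      also have "\<dots> \<le> diameter A" using diameter_bounded_bound[OF A(2), of "cis \<theta>" "cis \<theta>0"] \<theta> \<theta>0 by (simp add: dist_norm)
      finally show "\<theta> \<in> {\<theta>0 - 2 * diameter A..\<theta>0 + 2 * diameter A}" by (auto simp: abs_le_iff)
    qed
    then have "emeasure lborel ({l..<l + pi} \<inter> cis -` A) \<le> emeasure lborel {\<theta>0 - 2 * diameter A..\<theta>0 + 2 * diameter A}"
      by (intro emeasure_mono) auto
    also have "\<dots> = ennreal (4 * diameter A)" using diameter_ge_0[OF A(2)] by (subst emeasure_lborel_Icc) auto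
    finally show ?thesis .
  qed simp
  have m: "{l..<l + pi} \<inter> cis -` A \<in> sets lborel" for l
    using measurable_sets_borel[OF cis_measurable_circle_borel(1) A(1)] by auto
  have "{0..<2 * pi} = {0..<0 + pi} \<union> {pi..<pi + pi}" by auto
  then have "arc_len A = emeasure lborel (({0..<0 + pi} \<inter> cis -` A) \<union> ({pi..<pi + pi} \<inter> cis -` A))"
    unfolding arc_len_def by (simp add: Int_Un_distrib2)
  also have "\<dots> \<le> emeasure lborel ({0..<0 + pi} \<inter> cis -` A) + emeasure lborel ({pi..<pi + pi} \<inter> cis -` A)"
    by (intro emeasure_subadditive m)
  also have "\<dots> \<le> ennreal (4 * diameter A) + ennreal (4 * diameter A)" by (intro add_mono half)
  also have "\<dots> = ennreal (8 * diameter A)" using diameter_ge_0[OF A(2)] by (simp flip: ennreal_plus)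
  finally show ?thesis .
qed

lemma arc_len_ball_ge:
  assumes x: "x \<in> unit_circle" and r: "0 < r" "r \<le> 1"
  shows "ennreal r \<le> arc_len (ball x r)"
proof -
  obtain t where t: "x = cis t" "0 \<le> t" "t < 2 * pi"
    using x Arg2pi_eq[of x] Arg2pi_ge_0[of x] Arg2pi_lt_2pi[of x] by (metis cis_conv_exp mem_sphere_0 of_real_1 mult_1 norm_conv_dist dist_0_norm dist_commute)
  have in_ball: "dist (cis t) (cis \<theta>) < r" if "t - r < \<theta>" "\<theta> < t + r" for \<theta>
    using norm_cis_diff_le[of t \<theta>] that by (simp add: dist_norm abs_if split: if_splits)
  \<comment> \<open>Only one side of \<open>t\<close> is used, chosen so that the interval does not
    leave the parameter range \<open>{0..<2 * pi}\<close>.\<close>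
  have "\<exists>l. {l<..<l + r} \<subseteq> {0..<2 * pi} \<inter> cis -` ball x r"
  proof (cases "t \<le> pi")
    case True
    then show ?thesis using t r pi_gt3 by (intro exI[of _ t]) (auto simp: t(1) intro!: in_ball)
  next
    case False
    then show ?thesis using t r pi_gt3 by (intro exI[of _ "t - r"]) (auto simp: t(1) intro!: in_ball)
  qed
  then obtain l where l: "{l<..<l + r} \<subseteq> {0..<2 * pi} \<inter> cis -` ball x r" by blast
  have "ennreal r = emeasure lborel {l<..<l + r}" using r by simp
  also have "\<dots> \<le> arc_len (ball x r)" unfolding arc_len_def by (rule emeasure_mono[OF l]) auto
  finally show ?thesis .
qed

text \<open>The sets of a cover need not be Borel, so they are replaced by their closures.\<close>

lemma arc_len_eq_0_of_hausdorff:
  fixes S :: "complex set"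
  assumes H: "hausdorff_measure s S = 0" and s: "0 < s" "s \<le> 1" and S: "S \<in> sets borel"
  shows "arc_len S = 0"
proof -
  have "arc_len S \<le> 0 + ennreal e" if e: "0 < e" for e
  proof -
    obtain U :: "nat \<Rightarrow> complex set" where U: "S \<subseteq> (\<Union>i. U i)" "\<And>i. bounded (U i)" "\<And>i. diameter (U i) \<le> 1"
      "(\<Sum>i. ennreal (diameter (U i) powr s)) < ennreal (e / 8)"
      by (rule hausdorff_measure_0_coverE[OF H s(1), of 1 "e / 8"]) (use e in auto)
    have "arc_len S \<le> arc_len (\<Union>i. closure (U i))"
      using U(1) closure_subset by (intro arc_len_mono) (auto, blast)
    also have "\<dots> = emeasure lborel (\<Union>i. {0..<2 * pi} \<inter> cis -` closure (U i))"
      unfolding arc_len_def by (simp add: vimage_UN)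
    also have "\<dots> \<le> (\<Sum>i. arc_len (closure (U i)))"
      unfolding arc_len_def by (intro emeasure_subadditive_countably) (auto intro!: arc_sets)
    also have "\<dots> \<le> (\<Sum>i. ennreal 8 * ennreal (diameter (U i) powr s))"
    proof (intro suminf_le)
      fix i
      have d0: "0 \<le> diameter (U i)" using U(2) by (rule diameter_ge_0)
      have "arc_len (closure (U i)) \<le> ennreal (8 * diameter (closure (U i)))"
        using U(2) by (intro arc_len_le_diameter) auto
      also have "diameter (closure (U i)) = diameter (U i)" using U(2) by (rule diameter_closure)
      also have "diameter (U i) \<le> diameter (U i) powr s"
        using powr_mono'[of s 1 "diameter (U i)"] s d0 U(3)[of i] by simp
      then have "ennreal (8 * diameter (U i)) \<le> ennreal (8 * diameter (U i) powr s)" by (intro ennreal_leI) simp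
      finally show "arc_len (closure (U i)) \<le> ennreal 8 * ennreal (diameter (U i) powr s)"
        by (simp add: ennreal_mult')
    qed auto
    also have "\<dots> = ennreal 8 * (\<Sum>i. ennreal (diameter (U i) powr s))" by simp
    also have "\<dots> \<le> ennreal 8 * ennreal (e / 8)" using U(4) by (intro mult_left_mono) auto
    also have "\<dots> = ennreal (8 * (e / 8))" using e by (intro ennreal_mult[symmetric]) auto
    finally show ?thesis by simp
  qed
  then show ?thesis using ennreal_le_epsilon[of 0 "arc_len S"] by auto
qed

text \<open>Upper bounds of \<open>M\<close> on small balls centered at \<open>K\<close> are compared with the \<open>L\<close>-measure of a neighbourhood
  of \<open>K\<close> through a maximal separated subset of \<open>K\<close>.\<close>

lemma null_of_ball_bounds:
  fixes M L :: "complex measure"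
  assumes sM: "sets M = sets borel" and sL: "sets L = sets borel" and fM: "finite_measure M" and fL: "finite_measure L"
    and K: "compact K" and pos: "0 < a" "0 < b" "0 \<le> C"
    and L: "\<And>x r. x \<in> K \<Longrightarrow> 0 < r \<Longrightarrow> r \<le> 1 \<Longrightarrow> a * r \<le> measure L (ball x r)"
    and M: "\<And>x n. x \<in> K \<Longrightarrow> measure M (cball x (b / real (Suc n))) \<le> C / real (Suc n)"
    and LK: "measure L K = 0"
  shows "measure M K = 0"
proof -
  interpret M: finite_measure M by (rule fM)
  interpret L: finite_measure L by (rule fL)
  \<comment> \<open>The radius is half that of the covering balls: around an
    \<open>?r\<close>-separated subset of \<open>K\<close> the half-size balls are disjoint and stay
    inside \<open>V n\<close>.\<close>
  define V where "V n = (\<Union>x\<in>K. ball x (b / (2 * real (Suc n))))" for n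
  have "decseq V"
    unfolding decseq_Suc_iff V_def
  proof (intro allI UN_mono order_refl subset_ball)
    fix n show "b / (2 * real (Suc (Suc n))) \<le> b / (2 * real (Suc n))"
      using pos by (intro divide_left_mono) auto
  qed
  have VL: "V n \<in> sets L" for n unfolding sL V_def by (intro borel_open open_UN ballI open_ball)
  have "(\<Inter>n. V n) = K"
  proof
    show "(\<Inter>n. V n) \<subseteq> K"
    proof
      fix z assume z: "z \<in> (\<Inter>n. V n)"
      have "z \<in> closure K"
        unfolding closure_approachable
      proof (intro allI impI)
        fix e :: real assume "0 < e"
        have "(\<lambda>n. b / (2 * real (Suc n))) \<longlonglongrightarrow> 0" by real_asymp
        then have "\<forall>\<^sub>F n in sequentially. b / (2 * real (Suc n)) < e" using \<open>0 < e\<close> by (rule order_tendstoD)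
        then obtain n where n: "b / (2 * real (Suc n)) < e" unfolding eventually_sequentially by blast
        from z obtain x where "x \<in> K" "dist x z < b / (2 * real (Suc n))" by (auto simp: V_def)
        with n show "\<exists>y\<in>K. dist y z < e" by force
      qed
      then show "z \<in> K" using compact_imp_closed[OF K] by simp
    qed
    show "K \<subseteq> (\<Inter>n. V n)" using pos by (force simp: V_def)
  qed
  then have lim: "(\<lambda>n. measure L (V n)) \<longlonglongrightarrow> 0"
    using L.finite_Lim_measure_decseq[of V] VL \<open>decseq V\<close> LK by auto
  have bound: "measure M K \<le> 2 * C / (a * b) * measure L (V n)" if n: "b / real (Suc n) \<le> 1" for n
  proof -
    let ?r = "b / real (Suc n)"
    have r: "0 < ?r" using pos by simp
    have card: "real (card F) \<le> measure L (V n) * 2 / (a * ?r)"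
      if F: "finite F" "F \<subseteq> K" "\<And>x y. x \<in> F \<Longrightarrow> y \<in> F \<Longrightarrow> x \<noteq> y \<Longrightarrow> ?r < dist x y" for F
    proof -
      have "ball x (?r / 2) \<inter> ball y (?r / 2) = {}" if "x \<in> F" "y \<in> F" "x \<noteq> y" for x y
      proof -
        have False if "dist x w < ?r / 2" "dist y w < ?r / 2" for w
          using F(3)[OF \<open>x \<in> F\<close> \<open>y \<in> F\<close> \<open>x \<noteq> y\<close>] dist_triangle2[of x y w] that by linarith
        then show ?thesis by (auto simp: set_eq_iff)
      qed
      then have disj: "disjoint_family_on (\<lambda>x. ball x (?r / 2)) F" by (simp add: disjoint_family_on_def)
      have "real (card F) * (a * (?r / 2)) = (\<Sum>x\<in>F. a * (?r / 2))" by simp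
      also have "\<dots> \<le> (\<Sum>x\<in>F. measure L (ball x (?r / 2)))"
        using F r n pos by (intro sum_mono L) auto
      also have "\<dots> = measure L (\<Union>x\<in>F. ball x (?r / 2))"
        by (rule L.finite_measure_finite_Union[symmetric]) (use F disj sL in auto)
      also have "\<dots> \<le> measure L (V n)"
        using F by (intro L.finite_measure_mono VL) (auto simp: V_def mult.commute)
      finally have "real (card F) * (a * (?r / 2)) * 2 \<le> measure L (V n) * 2" by (rule mult_right_mono) simp
      moreover have "x * (a * y) = x * (a * (y / 2)) * 2" for x y :: real by simp
      ultimately have "real (card F) * (a * ?r) \<le> measure L (V n) * 2" by metis
      then show ?thesis using pos r by (simp only: pos_le_divide_eq mult_pos_pos)
    qed
    obtain F where F: "finite F" "F \<subseteq> K" "real (card F) \<le> measure L (V n) * 2 / (a * ?r)" "K \<subseteq> (\<Union>x\<in>F. cball x ?r)"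
      by (rule finite_net_of_card_bound[OF card less_imp_le[OF r]]) (assumption | rule that)+
    have "measure M K \<le> measure M (\<Union>x\<in>F. cball x ?r)"
      using F by (intro M.finite_measure_mono) (auto simp: sM)
    also have "\<dots> \<le> (\<Sum>x\<in>F. measure M (cball x ?r))"
      using F by (intro M.finite_measure_subadditive_finite) (auto simp: sM)
    also have "\<dots> \<le> (\<Sum>x\<in>F. C / real (Suc n))" using F by (intro sum_mono M) auto
    also have "\<dots> = real (card F) * (C / real (Suc n))" by simp
    also have "\<dots> \<le> measure L (V n) * 2 / (a * ?r) * (C / real (Suc n))"
      using pos by (intro mult_right_mono F) auto
    also have "\<dots> = 2 * C / (a * b) * measure L (V n)"
    proof -
      have "m * 2 / (a * (b / N)) * (C / N) = 2 * C / (a * b) * m" if "N \<noteq> 0" for m N :: real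
        using pos that by (simp add: field_simps)
      then show ?thesis by (metis nat.simps(3) of_nat_eq_0_iff)
    qed
    finally show ?thesis .
  qed
  have "(\<lambda>n. b / real (Suc n)) \<longlonglongrightarrow> 0" by real_asymp
  then have ev: "\<forall>\<^sub>F n in sequentially. b / real (Suc n) < 1" by (rule order_tendstoD) simp
  have "measure M K \<le> 2 * C / (a * b) * 0"
  proof (rule tendsto_lowerbound[OF tendsto_mult_left[OF lim]])
    show "\<forall>\<^sub>F n in sequentially. measure M K \<le> 2 * C / (a * b) * measure L (V n)"
      by (rule eventually_mono[OF ev]) (rule bound, rule less_imp_le)
  qed simp
  then show ?thesis using measure_nonneg[of M K] by simp
qed

text \<open>After expansion of the square the antiderivative is explicit: off-diagonal terms have a
  \<open>2 * pi\<close>-periodic primitive, and each of the \<open>Suc n\<close> diagonal terms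
  contributes \<open>2 * pi\<close>.\<close>

lemma nn_integral_fejer:
  "(\<integral>\<^sup>+\<theta>. ennreal ((norm (\<Sum>k\<le>n. (cis t * cis (- \<theta>)) ^ k))\<^sup>2) * indicator {0..2 * pi} \<theta> \<partial>lborel)
     = ennreal (2 * pi * real (Suc n))"
proof -
  define G where "G \<theta> = (\<Sum>j\<le>n. \<Sum>k\<le>n. if j = k then \<theta> else - sin ((real j - real k) * (t - \<theta>)) / (real j - real k))" for \<theta>
  define g where "g \<theta> = (norm (\<Sum>k\<le>n. (cis t * cis (- \<theta>)) ^ k))\<^sup>2" for \<theta>
  have g_eq: "g \<theta> = (\<Sum>j\<le>n. \<Sum>k\<le>n. cos ((real j - real k) * (t - \<theta>)))" for \<theta>
  proof -
    have "complex_of_real (g \<theta>) = (\<Sum>j\<le>n. cis (real j * (t - \<theta>))) * cnj (\<Sum>k\<le>n. cis (real k * (t - \<theta>)))"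
    proof -
      have S: "(\<Sum>k\<le>n. (cis t * cis (- \<theta>)) ^ k) = (\<Sum>k\<le>n. cis (real k * (t - \<theta>)))"
        by (rule sum.cong[OF refl]) (simp only: cis_mult Complex.DeMoivre diff_conv_add_uminus)
      show ?thesis unfolding g_def complex_norm_square S ..
    qed
    also have "\<dots> = (\<Sum>j\<le>n. \<Sum>k\<le>n. cis ((real j - real k) * (t - \<theta>)))"
      unfolding cnj_sum sum_product cis_cnj cis_mult
      by (intro sum.cong refl arg_cong[where f = cis]) (simp add: algebra_simps)
    finally have "Re (complex_of_real (g \<theta>)) = Re (\<Sum>j\<le>n. \<Sum>k\<le>n. cis ((real j - real k) * (t - \<theta>)))" by simp
    then show ?thesis by simp
  qed
  have "(\<integral>\<^sup>+\<theta>. ennreal (g \<theta>) * indicator {0..2 * pi} \<theta> \<partial>lborel) = ennreal (G (2 * pi) - G 0)"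
  proof (rule nn_integral_FTC_Icc)
    show "g \<in> borel_measurable borel" unfolding g_def by measurable
    show "0 \<le> g \<theta>" for \<theta> by (simp add: g_def)
    show "DERIV G \<theta> :> g \<theta>" for \<theta>
      unfolding g_eq G_def
    proof (intro DERIV_sum)
      fix j k :: nat
      show "((\<lambda>\<theta>. if j = k then \<theta> else - sin ((real j - real k) * (t - \<theta>)) / (real j - real k)) has_real_derivative
          cos ((real j - real k) * (t - \<theta>))) (at \<theta>)"
      proof (cases "j = k")
        case False
        have "((\<lambda>\<theta>. - sin (m * (t - \<theta>)) / m) has_real_derivative cos (m * (t - \<theta>))) (at \<theta>)" if "m \<noteq> 0" for m
          using that by (auto intro!: derivative_eq_intros)
        from this[of "real j - real k"] show ?thesis using False by simp
      qed simp
    qed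
  qed simp
  also have "G (2 * pi) - G 0 = (\<Sum>j\<le>n. \<Sum>k\<le>n. if j = k then 2 * pi else 0)"
  proof -
    have "sin ((real j - real k) * (t - 2 * pi)) = sin ((real j - real k) * t)" for j k
    proof -
      have "(real j - real k) * (t - 2 * pi) = (real j - real k) * t - 2 * pi * real_of_int (int j - int k)"
        by (simp add: algebra_simps)
      then show ?thesis by (simp only: sin_diff sin_int_2pin cos_int_2pin mult_1_right mult_zero_right diff_zero)
    qed
    then show ?thesis unfolding G_def sum_subtractf[symmetric] by (intro sum.cong) auto
  qed
  also have "\<dots> = 2 * pi * real (Suc n)" by (simp add: sum.delta)
  finally show ?thesis by (simp add: g_def)
qed

text \<open>Averaging the Christoffel bound \<open>1 \<le> B (n + 1) \<integral>|P|\<^sup>2\<close> for the Fejer polynomials centered at the points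
  of \<open>K\<close> over \<open>K\<close> gives kernels that are bounded and tend to \<open>0\<close> off \<open>K\<close>.\<close>

lemma arc_len_eq_0_of_christoffel:
  fixes \<mu> :: "complex measure"
  assumes fin: "finite_measure \<mu>" and s\<mu>: "sets \<mu> = sets circle_borel"
    and K: "compact K" "K \<subseteq> unit_circle" and \<mu>K: "emeasure \<mu> K = 0" and B: "0 \<le> B"
    and lower: "\<And>n \<eta>. \<eta> \<in> K \<Longrightarrow> 1 \<le> B * real (Suc n) * (\<integral>\<zeta>. (norm ((\<Sum>k\<le>n. (\<zeta> * cnj \<eta>) ^ k) / of_nat (Suc n)))\<^sup>2 \<partial>\<mu>)"
  shows "arc_len K = 0"
proof -
  interpret \<mu>: finite_measure \<mu> by (rule fin)
  interpret P: pair_sigma_finite lborel \<mu> by standard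
  have sp: "space \<mu> = unit_circle" using s\<mu> by (metis sets_eq_imp_space_eq space_circle_borel)
  have id_m[measurable]: "(\<lambda>\<zeta>. \<zeta>) \<in> borel_measurable \<mu>"
    using s\<mu> by (simp add: circle_borel_def measurable_def space_restrict_space sets_restrict_space sp vimage_def Int_commute image_iff) (auto simp: Int_def)
  have Kb[measurable]: "K \<in> sets borel" using K by (simp add: compact_imp_closed)
  define A where "A = {0..<2 * pi} \<inter> cis -` K"
  have A[measurable]: "A \<in> sets borel" unfolding A_def by (rule arc_sets) (rule Kb)
  define F where "F n \<theta> \<zeta> = B * real (Suc n) * (norm ((\<Sum>k\<le>n. (\<zeta> * cis (- \<theta>)) ^ k) / of_nat (Suc n)))\<^sup>2" for n \<theta> \<zeta>
  have F0: "0 \<le> F n \<theta> \<zeta>" for n \<theta> \<zeta> using B by (simp add: F_def)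
  have Fm[measurable]: "(\<lambda>(\<theta>, \<zeta>). F n \<theta> \<zeta>) \<in> borel_measurable (lborel \<Otimes>\<^sub>M \<mu>)" for n
    unfolding F_def by measurable
  \<comment> \<open>The average over the centres in \<open>K\<close>. It stays below
    \<open>2 * pi * B\<close> by the total integral of the Fejer kernel; off \<open>K\<close> the
    geometric sum is bounded by \<open>2 / d\<close>, so the factor \<open>B / real (Suc n)\<close>
    makes it vanish.\<close>
  define H where "H n \<zeta> = (\<integral>\<^sup>+\<theta>. ennreal (F n \<theta> \<zeta>) * indicator A \<theta> \<partial>lborel)" for n \<zeta>
  have Hm[measurable]: "H n \<in> borel_measurable \<mu>" for n
    unfolding H_def by measurable
  have bnd: "F n \<theta> \<zeta> \<le> B / real (Suc n) * (norm (\<Sum>k\<le>n. (\<zeta> * cis (- \<theta>)) ^ k))\<^sup>2" for n \<theta> \<zeta>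
  proof -
    have "B * real (Suc n) * (x / real (Suc n))\<^sup>2 = B / real (Suc n) * x\<^sup>2" for x
      by (simp add: power2_eq_square)
    then show ?thesis unfolding F_def norm_divide norm_of_nat by (metis order_refl)
  qed
  have H_le: "H n \<zeta> \<le> ennreal (2 * pi * B)" if \<zeta>: "\<zeta> \<in> unit_circle" for n \<zeta>
  proof -
    obtain t where t: "\<zeta> = cis t" using \<zeta> by (metis cis_Arg_unique complex_norm_eq_1_exp cis_conv_exp mem_sphere_0)
    have "H n \<zeta> \<le> (\<integral>\<^sup>+\<theta>. ennreal (B / real (Suc n)) * (ennreal ((norm (\<Sum>k\<le>n. (cis t * cis (- \<theta>)) ^ k))\<^sup>2) * indicator {0..2 * pi} \<theta>) \<partial>lborel)"
      unfolding H_def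
    proof (intro nn_integral_mono)
      fix \<theta>
      have "ennreal (F n \<theta> \<zeta>) \<le> ennreal (B / real (Suc n)) * ennreal ((norm (\<Sum>k\<le>n. (cis t * cis (- \<theta>)) ^ k))\<^sup>2)"
        unfolding t[symmetric] using B bnd[of n \<theta> \<zeta>] by (subst ennreal_mult'[symmetric]) (auto intro!: ennreal_leI)
      then show "ennreal (F n \<theta> \<zeta>) * indicator A \<theta> \<le> ennreal (B / real (Suc n)) * (ennreal ((norm (\<Sum>k\<le>n. (cis t * cis (- \<theta>)) ^ k))\<^sup>2) * indicator {0..2 * pi} \<theta>)"
        by (auto simp: A_def indicator_def)
    qed
    also have "\<dots> = ennreal (B / real (Suc n)) * ennreal (2 * pi * real (Suc n))"
      by (subst nn_integral_cmult) (measurable, simp only: nn_integral_fejer)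
    also have "\<dots> = ennreal (B / real (Suc n) * (2 * pi * real (Suc n)))"
      using B by (intro ennreal_mult[symmetric]) auto
    also have "B / real (Suc n) * (2 * pi * real (Suc n)) = 2 * pi * B" by simp
    finally show ?thesis .
  qed
  have H_lim: "(\<lambda>n. H n \<zeta>) \<longlonglongrightarrow> 0" if \<zeta>: "\<zeta> \<in> unit_circle" "\<zeta> \<notin> K" for \<zeta>
  proof -
    obtain d where d: "0 < d" "\<And>y. y \<in> K \<Longrightarrow> d \<le> dist \<zeta> y"
      using separate_point_closed[OF compact_imp_closed[OF K(1)] \<zeta>(2)] by blast
    have "F n \<theta> \<zeta> \<le> B / real (Suc n) * (2 / d)\<^sup>2" if \<theta>: "\<theta> \<in> A" for n \<theta>
    proof -
      let ?w = "\<zeta> * cis (- \<theta>)"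
      have "cis \<theta> \<in> K" using \<theta> by (simp add: A_def)
      have "1 - ?w = (cis \<theta> - \<zeta>) * cis (- \<theta>)" by (simp add: left_diff_distrib cis_mult)
      then have dw: "d \<le> norm (1 - ?w)"
        using d(2)[OF \<open>cis \<theta> \<in> K\<close>] by (simp add: norm_mult dist_norm norm_minus_commute)
      then have "?w \<noteq> 1" using d(1) by auto
      then have "norm (\<Sum>k\<le>n. ?w ^ k) = norm (1 - ?w ^ Suc n) / norm (1 - ?w)"
        by (simp add: sum_gp0 norm_divide del: power_Suc)
      also have "\<dots> \<le> 2 / d"
      proof (rule frac_le)
        show "norm (1 - ?w ^ Suc n) \<le> 2"
          using norm_triangle_ineq4[of 1 "?w ^ Suc n"] \<zeta>(1) by (simp add: norm_power norm_mult del: power_Suc)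
      qed (use d dw in auto)
      finally have "(norm (\<Sum>k\<le>n. ?w ^ k))\<^sup>2 \<le> (2 / d)\<^sup>2" by (intro power_mono) auto
      then have "B / real (Suc n) * (norm (\<Sum>k\<le>n. ?w ^ k))\<^sup>2 \<le> B / real (Suc n) * (2 / d)\<^sup>2"
        using B by (intro mult_left_mono) auto
      with bnd[of n \<theta> \<zeta>] show ?thesis by linarith
    qed
    then have "H n \<zeta> \<le> (\<integral>\<^sup>+\<theta>. ennreal (B / real (Suc n) * (2 / d)\<^sup>2) * indicator A \<theta> \<partial>lborel)" for n
      unfolding H_def by (intro nn_integral_mono) (auto simp: indicator_def intro!: ennreal_leI)
    moreover have "(\<integral>\<^sup>+\<theta>. ennreal (B / real (Suc n) * (2 / d)\<^sup>2) * indicator A \<theta> \<partial>lborel) \<le> ennreal (B / real (Suc n) * (2 / d)\<^sup>2) * ennreal (2 * pi)" for n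
    proof -
      have "emeasure lborel A \<le> emeasure lborel {0..<2 * pi}" by (intro emeasure_mono) (auto simp: A_def)
      then have "emeasure lborel A \<le> ennreal (2 * pi)" by simp
      then show ?thesis by (subst nn_integral_cmult_indicator) (auto intro: mult_left_mono)
    qed
    ultimately have *: "H n \<zeta> \<le> ennreal (B / real (Suc n) * (2 / d)\<^sup>2 * (2 * pi))" for n
      using B by (simp add: ennreal_mult[symmetric]) (meson order_trans)
    have "(\<lambda>n. B / real (Suc n) * (2 / d)\<^sup>2 * (2 * pi)) \<longlonglongrightarrow> 0" by real_asymp
    then have "(\<lambda>n. ennreal (B / real (Suc n) * (2 / d)\<^sup>2 * (2 * pi))) \<longlonglongrightarrow> ennreal 0" by (rule tendsto_ennrealI)
    then have lim: "(\<lambda>n. ennreal (B / real (Suc n) * (2 / d)\<^sup>2 * (2 * pi))) \<longlonglongrightarrow> 0" by (simp only: ennreal_0)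
    show ?thesis
    proof (rule tendsto_sandwich[OF _ _ tendsto_const lim])
      show "\<forall>\<^sub>F n in sequentially. H n \<zeta> \<le> ennreal (B / real (Suc n) * (2 / d)\<^sup>2 * (2 * pi))"
        by (intro always_eventually allI *)
    qed simp
  qed
  have "K \<in> sets \<mu>" using K(2) Kb s\<mu> by (simp add: sets_circle_borelI)
  then have AEK: "AE \<zeta> in \<mu>. \<zeta> \<notin> K" using \<mu>K by (intro AE_I[of _ _ K]) auto
  have lim: "(\<lambda>n. \<integral>\<^sup>+\<zeta>. H n \<zeta> \<partial>\<mu>) \<longlonglongrightarrow> (\<integral>\<^sup>+\<zeta>. 0 \<partial>\<mu>)"
  proof (rule nn_integral_dominated_convergence[where w = "\<lambda>_. ennreal (2 * pi * B)"])
    show "AE \<zeta> in \<mu>. H n \<zeta> \<le> ennreal (2 * pi * B)" for n by (rule AE_I2) (simp add: sp H_le)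
    show "AE \<zeta> in \<mu>. (\<lambda>n. H n \<zeta>) \<longlonglongrightarrow> 0" using AEK AE_space by eventually_elim (simp add: sp H_lim)
    show "(\<integral>\<^sup>+\<zeta>. ennreal (2 * pi * B) \<partial>\<mu>) < \<infinity>"
    proof -
      have "emeasure \<mu> (space \<mu>) < \<top>"
        using \<mu>.emeasure_finite[of "space \<mu>"] by (simp only: infinity_ennreal_def top.not_eq_extremum not_False_eq_True)
      then show ?thesis by (simp add: ennreal_mult_less_top)
    qed
  qed auto
  have "arc_len K \<le> (\<integral>\<^sup>+\<zeta>. H n \<zeta> \<partial>\<mu>)" for n
  proof -
    have "arc_len K = (\<integral>\<^sup>+\<theta>. indicator A \<theta> \<partial>lborel)" by (simp add: arc_len_def A_def[symmetric])
    also have "\<dots> \<le> (\<integral>\<^sup>+\<theta>. (\<integral>\<^sup>+\<zeta>. ennreal (F n \<theta> \<zeta>) * indicator A \<theta> \<partial>\<mu>) \<partial>lborel)"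
    proof (intro nn_integral_mono)
      fix \<theta>
      show "indicator A \<theta> \<le> (\<integral>\<^sup>+\<zeta>. ennreal (F n \<theta> \<zeta>) * indicator A \<theta> \<partial>\<mu>)"
      proof (cases "\<theta> \<in> A")
        case True
        then have "cis \<theta> \<in> K" by (simp add: A_def)
        from lower[OF this, of n] have l: "1 \<le> (\<integral>\<zeta>. F n \<theta> \<zeta> \<partial>\<mu>)" by (simp add: F_def cis_cnj)
        \<comment> \<open>A non-integrable function has Bochner integral 0, so the lower bound 1
          itself yields integrability.\<close>
        then have "integrable \<mu> (F n \<theta>)" using not_integrable_integral_eq by fastforce
        then have "(\<integral>\<^sup>+\<zeta>. ennreal (F n \<theta> \<zeta>) \<partial>\<mu>) = ennreal (\<integral>\<zeta>. F n \<theta> \<zeta> \<partial>\<mu>)"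
          by (rule nn_integral_eq_integral) (simp add: F0)
        then show ?thesis using True l by (simp add: ennreal_ge_1)
      qed simp
    qed
    also have "\<dots> = (\<integral>\<^sup>+\<zeta>. H n \<zeta> \<partial>\<mu>)"
      unfolding H_def by (rule P.Fubini'[symmetric]) measurable
    finally show ?thesis .
  qed
  then have "arc_len K \<le> (\<integral>\<^sup>+\<zeta>. 0 \<partial>\<mu>)" by (intro LIMSEQ_le_const[OF lim]) auto
  then show ?thesis by simp
qed

section \<open>Orthogonal polynomials\<close>

locale opuc =
  fixes \<mu> :: "complex measure" and \<alpha> :: "nat \<Rightarrow> complex" and \<Phi> :: "nat \<Rightarrow> complex poly"
  assumes nontrivial: "nontrivial_circle_prob \<mu>"
    and orth: "monic_orthogonal_polys \<mu> \<Phi>"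
    and szego: "\<And>n z. poly (\<Phi> (Suc n)) z = z * poly (\<Phi> n) z - cnj (\<alpha> n) * poly (szego_star (\<Phi> n)) z"
begin

sublocale prob_space \<mu>
  using nontrivial by (simp add: nontrivial_circle_prob_def)

lemma sets_mu: "sets \<mu> = sets circle_borel"
  using nontrivial by (simp add: nontrivial_circle_prob_def)

lemma space_mu: "space \<mu> = unit_circle"
  using sets_mu by (metis sets_eq_imp_space_eq space_circle_borel)

lemma id_measurable_mu [measurable]: "(\<lambda>z. z) \<in> borel_measurable \<mu>"
proof -
  have "(\<lambda>z. z) \<in> measurable circle_borel (borel :: complex measure)"
    unfolding circle_borel_def by (rule measurable_restrict_space1) simp
  then show ?thesis by (subst measurable_cong_sets[OF sets_mu refl])
qed

lemma continuous_integrable: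
  fixes f :: "complex \<Rightarrow> 'b::{banach, second_countable_topology}"
  assumes "continuous_on UNIV f"
  shows "integrable \<mu> f"
proof -
  have [measurable]: "f \<in> borel_measurable borel" by (rule borel_measurable_continuous_onI[OF assms])
  have "compact (f ` unit_circle)"
    by (intro compact_continuous_image continuous_on_subset[OF assms]) auto
  then have "bounded (f ` unit_circle)" by (rule compact_imp_bounded)
  then obtain B where B: "\<forall>x\<in>f ` unit_circle. norm x \<le> B" unfolding bounded_iff by (rule exE)
  have "AE z in \<mu>. norm (f z) \<le> B" by (intro AE_I2) (rule bspec[OF B imageI], simp only: space_mu)
  moreover have "f \<in> borel_measurable \<mu>" using measurable_compose[OF id_measurable_mu, of f borel] by simp
  ultimately show ?thesis by (rule integrable_const_bound)
qed

lemma degree_Phi: "degree (\<Phi> n) = n"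
  using orth unfolding monic_orthogonal_polys_def by blast

lemma lead_Phi: "lead_coeff (\<Phi> n) = 1"
  using orth unfolding monic_orthogonal_polys_def by blast

lemma orth_Phi: "m \<noteq> n \<Longrightarrow> (\<integral>z. cnj (poly (\<Phi> m) z) * poly (\<Phi> n) z \<partial>\<mu>) = 0"
  using orth unfolding monic_orthogonal_polys_def by blast

lemma poly_in_span:
  assumes "degree q < n"
  shows "\<exists>b. q = (\<Sum>k<n. smult (b k) (\<Phi> k))"
  using assms
proof (induction n arbitrary: q)
  case (Suc n)
  define r where "r = q - smult (coeff q n) (\<Phi> n)"
  have cn: "coeff r n = 0" using lead_Phi[of n] by (simp add: r_def degree_Phi)
  have dr: "degree r \<le> n" unfolding r_def using Suc.prems by (intro degree_diff_le) (auto simp: degree_Phi)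
  have "\<exists>b. r = (\<Sum>k<n. smult (b k) (\<Phi> k))"
  proof (cases "n = 0")
    case True
    then have "r = 0" using dr cn by (simp add: degree_eq_zeroE[of r]) (metis coeff_pCons_0 degree_eq_zeroE pCons_0_0)
    then show ?thesis using True by simp
  next
    case False
    have "degree r < n"
    proof (rule ccontr)
      assume "\<not> degree r < n"
      then have "degree r = n" using dr by simp
      then have "r = 0" using cn by (metis leading_coeff_0_iff)
      then show False using \<open>degree r = n\<close> False by simp
    qed
    then show ?thesis by (rule Suc.IH)
  qed
  then obtain b where b: "r = (\<Sum>k<n. smult (b k) (\<Phi> k))" by blast
  have "q = (\<Sum>k<Suc n. smult ((b(n := coeff q n)) k) (\<Phi> k))"
    using b by (simp add: r_def algebra_simps)
  then show ?case by blast
qed simp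

lemma orth_lower:
  assumes "degree q < n"
  shows "(\<integral>z. cnj (poly q z) * poly (\<Phi> n) z \<partial>\<mu>) = 0"
proof -
  obtain b where b: "q = (\<Sum>k<n. smult (b k) (\<Phi> k))" using poly_in_span[OF assms] by blast
  have "(\<integral>z. cnj (poly q z) * poly (\<Phi> n) z \<partial>\<mu>) = (\<integral>z. (\<Sum>k<n. cnj (b k) * (cnj (poly (\<Phi> k) z) * poly (\<Phi> n) z)) \<partial>\<mu>)"
    by (simp only: b poly_sum poly_smult cnj_sum complex_cnj_mult sum_distrib_right mult.assoc)
  also have "\<dots> = (\<Sum>k<n. cnj (b k) * (\<integral>z. cnj (poly (\<Phi> k) z) * poly (\<Phi> n) z \<partial>\<mu>))"
    by (subst Bochner_Integration.integral_sum) (auto intro!: continuous_integrable continuous_intros)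
  also have "\<dots> = 0" by (intro sum.neutral) (auto simp: orth_Phi)
  finally show ?thesis .
qed

definition sqnorm :: "nat \<Rightarrow> real" where
  "sqnorm n = (\<integral>z. (norm (poly (\<Phi> n) z))\<^sup>2 \<partial>\<mu>)"

text \<open>Otherwise the polynomial would vanish almost everywhere, hence by continuity on the
  whole support, which is infinite for a nontrivial measure.\<close>

lemma sqnorm_pos: "0 < sqnorm n"
proof -
  have "0 \<le> sqnorm n" unfolding sqnorm_def by simp
  moreover have "sqnorm n \<noteq> 0"
  proof
    assume 0: "sqnorm n = 0"
    have int: "integrable \<mu> (\<lambda>z. (norm (poly (\<Phi> n) z))\<^sup>2)"
      by (intro continuous_integrable continuous_intros)
    have "AE z in \<mu>. (norm (poly (\<Phi> n) z))\<^sup>2 = 0"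
      using 0 integral_nonneg_eq_0_iff_AE[OF int] by (simp add: sqnorm_def)
    then have ae: "AE z in \<mu>. poly (\<Phi> n) z = 0" by simp
    have "circle_support \<mu> \<subseteq> {z. poly (\<Phi> n) z = 0}"
    proof
      fix z assume z: "z \<in> circle_support \<mu>"
      show "z \<in> {z. poly (\<Phi> n) z = 0}"
      proof (rule ccontr)
        assume "z \<notin> {z. poly (\<Phi> n) z = 0}"
        define U where "U = {w. poly (\<Phi> n) w \<noteq> 0}"
        have "open U" unfolding U_def
          by (intro open_Collect_neq continuous_intros)
        moreover have "z \<in> U" using \<open>z \<notin> _\<close> by (simp add: U_def)
        ultimately have pos: "emeasure \<mu> (U \<inter> unit_circle) > 0" using z by (simp add: circle_support_def)
        have "U \<inter> unit_circle \<in> sets \<mu>" unfolding sets_mu using \<open>open U\<close> by (intro sets_circle_borel_Int) auto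
        moreover have "AE w in \<mu>. w \<notin> U \<inter> unit_circle" using ae by eventually_elim (simp add: U_def)
        ultimately have "emeasure \<mu> (U \<inter> unit_circle) = 0"
          using AE_iff_null_sets[of "U \<inter> unit_circle" \<mu>] by blast
        then show False using pos by simp
      qed
    qed
    moreover have "finite {z. poly (\<Phi> n) z = 0}" using lead_Phi[of n] by (intro poly_roots_finite) auto
    ultimately show False
      using nontrivial finite_subset unfolding nontrivial_circle_prob_def by blast
  qed
  ultimately show ?thesis by simp
qed

lemma degree_szego_star: "degree (szego_star (\<Phi> n)) \<le> n"
  unfolding szego_star_def using degree_reflect_poly_le[of "map_poly cnj (\<Phi> n)"]
  by (simp add: degree_map_poly degree_Phi)

lemma poly_szego_star_circle:
  assumes "norm z = 1"
  shows "poly (szego_star (\<Phi> n)) z = z ^ n * cnj (poly (\<Phi> n) z)"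
proof -
  have "z * cnj z = 1" using assms by (simp add: complex_norm_square[symmetric])
  moreover have "z \<noteq> 0" using assms by auto
  ultimately have "1 / cnj z = z" by (simp add: divide_eq_eq)
  then show ?thesis using poly_szego_star[OF \<open>z \<noteq> 0\<close>, of "\<Phi> n"] by (simp add: degree_Phi)
qed

text \<open>Pythagoras for \<open>z * \<Phi> n = \<Phi> (Suc n) + cnj (\<alpha> n) * szego_star
  (\<Phi> n)\<close>: the reversed polynomial has degree at most \<open>n\<close>, hence is
  orthogonal to \<open>\<Phi> (Suc n)\<close>, and on the circle it has the modulus of
  \<open>\<Phi> n\<close>.\<close>

lemma sqnorm_Suc: "sqnorm (Suc n) = (1 - (norm (\<alpha> n))\<^sup>2) * sqnorm n"
proof -
  define s where "s z = poly (szego_star (\<Phi> n)) z" for z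
  define f where "f z = poly (\<Phi> (Suc n)) z" for z
  have cont: "continuous_on UNIV s" "continuous_on UNIV f" unfolding s_def f_def by (intro continuous_intros)+
  have pt: "(norm (poly (\<Phi> n) z))\<^sup>2 = (norm (f z))\<^sup>2 + (norm (\<alpha> n))\<^sup>2 * (norm (poly (\<Phi> n) z))\<^sup>2 + 2 * Re (cnj (cnj (\<alpha> n) * s z) * f z)"
    if z: "norm z = 1" for z
  proof -
    have ns: "norm (s z) = norm (poly (\<Phi> n) z)" using z by (simp add: s_def poly_szego_star_circle norm_mult norm_power)
    have "z * poly (\<Phi> n) z = f z + cnj (\<alpha> n) * s z" using szego[of n z] by (simp add: f_def s_def)
    then have "norm (poly (\<Phi> n) z) = norm (f z + cnj (\<alpha> n) * s z)" using z by (metis mult_1 norm_mult)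
    moreover have "(norm (x + y))\<^sup>2 = (norm x)\<^sup>2 + (norm y)\<^sup>2 + 2 * Re (cnj y * x)" for x y
      unfolding cmod_power2 by (simp add: power2_eq_square algebra_simps)
    ultimately have "(norm (poly (\<Phi> n) z))\<^sup>2 = (norm (f z))\<^sup>2 + (norm (cnj (\<alpha> n) * s z))\<^sup>2 + 2 * Re (cnj (cnj (\<alpha> n) * s z) * f z)"
      by (simp only:)
    then show ?thesis by (simp add: norm_mult power_mult_distrib ns)
  qed
  have o: "(\<integral>z. cnj (cnj (\<alpha> n) * s z) * f z \<partial>\<mu>) = 0"
  proof -
    have "(\<integral>z. cnj (cnj (\<alpha> n) * s z) * f z \<partial>\<mu>) = (\<integral>z. \<alpha> n * (cnj (s z) * f z) \<partial>\<mu>)" by (simp add: mult_ac)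
    also have "\<dots> = \<alpha> n * (\<integral>z. cnj (s z) * f z \<partial>\<mu>)" by simp
    also have "(\<integral>z. cnj (s z) * f z \<partial>\<mu>) = 0"
      unfolding s_def f_def using degree_szego_star[of n] by (intro orth_lower) simp
    finally show ?thesis by simp
  qed
  have i1: "integrable \<mu> (\<lambda>z. cnj (cnj (\<alpha> n) * s z) * f z)" by (intro continuous_integrable continuous_intros cont)
  have i2: "integrable \<mu> (\<lambda>z. (norm (f z))\<^sup>2)" "integrable \<mu> (\<lambda>z. (norm (\<alpha> n))\<^sup>2 * (norm (poly (\<Phi> n) z))\<^sup>2)"
    by (intro continuous_integrable continuous_intros cont)+
  have "sqnorm n = (\<integral>z. (norm (f z))\<^sup>2 + (norm (\<alpha> n))\<^sup>2 * (norm (poly (\<Phi> n) z))\<^sup>2 + 2 * Re (cnj (cnj (\<alpha> n) * s z) * f z) \<partial>\<mu>)"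
    unfolding sqnorm_def by (rule Bochner_Integration.integral_cong[OF refl]) (rule pt, simp add: space_mu)
  also have "\<dots> = sqnorm (Suc n) + (norm (\<alpha> n))\<^sup>2 * sqnorm n + 2 * Re (\<integral>z. cnj (cnj (\<alpha> n) * s z) * f z \<partial>\<mu>)"
  proof -
    define g where "g z = cnj (cnj (\<alpha> n) * s z) * f z" for z
    have ig: "integrable \<mu> g" using i1 by (simp only: g_def[abs_def])
    have "(\<integral>z. (norm (f z))\<^sup>2 + (norm (\<alpha> n))\<^sup>2 * (norm (poly (\<Phi> n) z))\<^sup>2 + 2 * Re (g z) \<partial>\<mu>)
        = (\<integral>z. (norm (f z))\<^sup>2 \<partial>\<mu>) + (\<integral>z. (norm (\<alpha> n))\<^sup>2 * (norm (poly (\<Phi> n) z))\<^sup>2 \<partial>\<mu>) + (\<integral>z. 2 * Re (g z) \<partial>\<mu>)"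
      using i2 ig by (simp only: Bochner_Integration.integral_add Bochner_Integration.integrable_add integrable_mult_right integrable_Re)
    also have "(\<integral>z. 2 * Re (g z) \<partial>\<mu>) = 2 * Re (\<integral>z. g z \<partial>\<mu>)" using ig by simp
    finally show ?thesis by (simp only: g_def sqnorm_def f_def integral_mult_right_zero)
  qed
  finally show ?thesis unfolding o by (simp add: algebra_simps)
qed

lemma norm_alpha_less_1: "norm (\<alpha> n) < 1"
proof -
  have "0 < (1 - (norm (\<alpha> n))\<^sup>2) * sqnorm n" using sqnorm_pos[of "Suc n"] by (simp add: sqnorm_Suc)
  then have "(norm (\<alpha> n))\<^sup>2 < 1" using sqnorm_pos[of n] by (simp add: zero_less_mult_iff)
  then show ?thesis by (simp add: power_less_one_iff)
qed

abbreviation sol :: "complex \<Rightarrow> nat \<Rightarrow> complex" where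
  "sol z n \<equiv> circle_sol \<alpha> 1 z n"

lemma Phi_0: "\<Phi> 0 = 1"
  using degree_Phi[of 0] lead_Phi[of 0] by (metis degree_eq_zeroE lead_coeff_pCons(2) one_pCons pCons_0_0 coeff_pCons_0)

lemma sol_eq_poly:
  assumes z: "norm z = 1"
  shows "sol z n = poly (\<Phi> n) z / sqrt (sqnorm n)"
proof (induction n)
  case 0
  have "sqnorm 0 = 1" by (simp add: sqnorm_def Phi_0 prob_space)
  then show ?case by (simp add: Phi_0)
next
  case (Suc n)
  have "sol z (Suc n) = (z * poly (\<Phi> n) z - cnj (\<alpha> n) * z ^ n * cnj (poly (\<Phi> n) z)) / sqrt (sqnorm n) / sqrt (1 - (norm (\<alpha> n))\<^sup>2)"
    by (simp add: Suc diff_divide_distrib)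
  also have "z * poly (\<Phi> n) z - cnj (\<alpha> n) * z ^ n * cnj (poly (\<Phi> n) z) = poly (\<Phi> (Suc n)) z"
    by (simp add: szego poly_szego_star_circle[OF z] mult.assoc)
  finally show ?case by (simp add: sqnorm_Suc real_sqrt_mult)
qed

lemma parseval:
  "(\<integral>z. (norm (\<Sum>k\<le>n. b k * sol z k))\<^sup>2 \<partial>\<mu>) = (\<Sum>k\<le>n. (norm (b k))\<^sup>2)"
proof -
  define e where "e k z = poly (\<Phi> k) z / sqrt (sqnorm k)" for k z
  have cont: "continuous_on UNIV (e k)" for k
    unfolding e_def using sqnorm_pos[of k] by (intro continuous_intros) auto
  have on: "(\<integral>z. cnj (e j z) * e k z \<partial>\<mu>) = (if j = k then 1 else 0)" for j k
  proof -
    have "(\<integral>z. cnj (e j z) * e k z \<partial>\<mu>) = (\<integral>z. (cnj (poly (\<Phi> j) z) * poly (\<Phi> k) z) / (sqrt (sqnorm j) * sqrt (sqnorm k)) \<partial>\<mu>)"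
      by (simp add: e_def)
    also have "\<dots> = (\<integral>z. cnj (poly (\<Phi> j) z) * poly (\<Phi> k) z \<partial>\<mu>) / (sqrt (sqnorm j) * sqrt (sqnorm k))"
      by (rule Bochner_Integration.integral_divide_zero)
    also have "\<dots> = (if j = k then 1 else 0)"
    proof (cases "j = k")
      case True
      have "(\<integral>z. cnj (poly (\<Phi> k) z) * poly (\<Phi> k) z \<partial>\<mu>) = (\<integral>z. complex_of_real ((norm (poly (\<Phi> k) z))\<^sup>2) \<partial>\<mu>)"
        by (simp only: complex_norm_square mult.commute)
      also have "\<dots> = complex_of_real (sqnorm k)" unfolding sqnorm_def by (rule integral_complex_of_real)
      finally show ?thesis using True sqnorm_pos[of k] by (simp flip: of_real_mult)
    qed (simp add: orth_Phi)
    finally show ?thesis .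
  qed
  have "complex_of_real (\<integral>z. (norm (\<Sum>k\<le>n. b k * sol z k))\<^sup>2 \<partial>\<mu>) = complex_of_real (\<integral>z. (norm (\<Sum>k\<le>n. b k * e k z))\<^sup>2 \<partial>\<mu>)"
    by (intro arg_cong[where f = complex_of_real] Bochner_Integration.integral_cong refl)
       (simp add: space_mu sol_eq_poly e_def)
  also have "\<dots> = (\<integral>z. complex_of_real ((norm (\<Sum>k\<le>n. b k * e k z))\<^sup>2) \<partial>\<mu>)"
    by (rule integral_complex_of_real[symmetric])
  also have "\<dots> = (\<integral>z. (\<Sum>j\<le>n. \<Sum>k\<le>n. (b j * cnj (b k)) * (cnj (e k z) * e j z)) \<partial>\<mu>)"
    unfolding complex_norm_square cnj_sum sum_product complex_cnj_mult by (simp only: mult_ac)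
  also have "\<dots> = (\<Sum>j\<le>n. \<Sum>k\<le>n. (b j * cnj (b k)) * (\<integral>z. cnj (e k z) * e j z \<partial>\<mu>))"
    by (subst Bochner_Integration.integral_sum, (intro continuous_integrable continuous_intros cont)[1],
        subst Bochner_Integration.integral_sum, (intro continuous_integrable continuous_intros cont)[1])
       simp
  also have "\<dots> = (\<Sum>j\<le>n. b j * cnj (b j))"
    by (simp add: on if_distrib[of "(*) _"] cong: if_cong)
  also have "\<dots> = complex_of_real (\<Sum>k\<le>n. (norm (b k))\<^sup>2)"
    by (simp only: complex_norm_square of_real_sum)
  finally show ?thesis by (simp only: of_real_eq_iff)
qed

text \<open>Expansion in the orthonormal polynomials and Cauchy-Schwarz. Bounded solutions turn the
  kernel sum into at most \<open>M\<^sup>2 * real (Suc n)\<close>, which is the lower bound for the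
  Christoffel function.\<close>

lemma christoffel_lower:
  assumes "degree P \<le> n" "norm \<eta> = 1"
  shows "(norm (poly P \<eta>))\<^sup>2 \<le> (\<Sum>k\<le>n. (norm (sol \<eta> k))\<^sup>2) * (\<integral>z. (norm (poly P z))\<^sup>2 \<partial>\<mu>)"
proof -
  obtain b where b: "P = (\<Sum>k<Suc n. smult (b k) (\<Phi> k))" using poly_in_span[of P "Suc n"] assms(1) by auto
  define a where "a k = b k * sqrt (sqnorm k)" for k
  have Pz: "poly P z = (\<Sum>k\<le>n. a k * sol z k)" if "norm z = 1" for z
    using sqnorm_pos by (simp add: b poly_sum sol_eq_poly[OF that] a_def lessThan_Suc_atMost less_imp_neq[symmetric])
  have "(norm (poly P \<eta>))\<^sup>2 \<le> (\<Sum>k\<le>n. norm (a k) * norm (sol \<eta> k))\<^sup>2"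
    unfolding Pz[OF assms(2)] by (intro power_mono sum_norm_le) (auto simp: norm_mult)
  also have "\<dots> \<le> (\<Sum>k\<le>n. (norm (a k))\<^sup>2) * (\<Sum>k\<le>n. (norm (sol \<eta> k))\<^sup>2)"
    by (rule Cauchy_Schwarz_ineq_sum)
  also have "(\<Sum>k\<le>n. (norm (a k))\<^sup>2) = (\<integral>z. (norm (poly P z))\<^sup>2 \<partial>\<mu>)"
    unfolding parseval[symmetric] by (intro Bochner_Integration.integral_cong refl) (simp add: space_mu Pz)
  finally show ?thesis by (simp add: mult.commute)
qed

text \<open>On \<open>ball \<eta> (c / n)\<close> the reproducing kernel at \<open>\<eta>\<close> is still of size \<open>n\<close>, while its square integrates to
  \<open>O(n)\<close>; hence the ball has measure \<open>O(1 / n)\<close>.\<close>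

lemma measure_ball_upper:
  assumes \<eta>: "norm \<eta> = 1" and M1: "1 \<le> M"
    and M: "\<And>n. norm (circle_sol \<alpha> 1 \<eta> n) \<le> M" "\<And>n. norm (circle_sol \<alpha> \<i> \<eta> n) \<le> M"
    and b: "0 \<le> b" "M * (exp (M\<^sup>2 * b) - 1) \<le> 1 / (2 * M)"
  shows "measure \<mu> (cball \<eta> (b / real (Suc n)) \<inter> unit_circle) \<le> 4 * M ^ 6 / real (Suc n)"
proof -
  let ?I = "cball \<eta> (b / real (Suc n)) \<inter> unit_circle" and ?N = "real (Suc n)"
  have I: "?I \<in> sets \<mu>" unfolding sets_mu by (rule sets_circle_borel_Int) auto
  define k where "k z = (\<Sum>j\<le>n. cnj (sol \<eta> j) * sol z j)" for z
  have ge: "(?N / (2 * M\<^sup>2))\<^sup>2 \<le> (norm (k z))\<^sup>2" if z: "z \<in> ?I" for z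
  proof (rule power_mono)
    have nz: "norm z = 1" using z by simp
    have d: "norm (z - \<eta>) \<le> b / ?N" using z by (simp add: dist_norm norm_minus_commute)
    \<comment> \<open>For \<open>j \<le> n\<close> the accumulated perturbation
      \<open>real j * norm (z - \<eta>)\<close> is at most \<open>b\<close>, whatever
      \<open>n\<close> is.\<close>
    have diff: "norm (sol z j - sol \<eta> j) \<le> 1 / (2 * M)" if "j \<le> n" for j
    proof -
      have "real j * norm (z - \<eta>) \<le> ?N * (b / ?N)" using that d by (intro mult_mono) auto
      then have "M * (exp (M\<^sup>2 * (real j * norm (z - \<eta>))) - 1) \<le> M * (exp (M\<^sup>2 * b) - 1)"
        using M1 by (intro mult_left_mono diff_right_mono) (auto intro!: mult_left_mono)
      then show ?thesis
        using circle_sol_perturb[OF norm_alpha_less_1 \<eta> nz M, of j] b(2) by linarith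
    qed
    \<comment> \<open>At \<eta> the solution has modulus at least \<open>1 / M\<close> by the
      Wronskian; the perturbation is at most half of that, so no term of the kernel can change sign
      or cancel another.\<close>
    have trm: "1 / (2 * M\<^sup>2) \<le> Re (cnj (sol \<eta> j) * sol z j)" if "j \<le> n" for j
    proof -
      have u: "1 / M \<le> norm (sol \<eta> j)"
        using circle_sol_lower[OF norm_alpha_less_1 \<eta> M(2)[of j]] M1 by (simp add: pos_divide_le_eq)
      have "cnj (sol \<eta> j) * sol z j = complex_of_real ((norm (sol \<eta> j))\<^sup>2) + cnj (sol \<eta> j) * (sol z j - sol \<eta> j)"
        unfolding complex_norm_square by (simp add: algebra_simps)
      then have "Re (cnj (sol \<eta> j) * sol z j) = (norm (sol \<eta> j))\<^sup>2 + Re (cnj (sol \<eta> j) * (sol z j - sol \<eta> j))"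
        by (metis Re_complex_of_real plus_complex.simps(1))
      moreover have "\<bar>Re (cnj (sol \<eta> j) * (sol z j - sol \<eta> j))\<bar> \<le> norm (sol \<eta> j) * (1 / (2 * M))"
        using mult_left_mono[OF diff[OF that], of "norm (sol \<eta> j)"] abs_Re_le_cmod[of "cnj (sol \<eta> j) * (sol z j - sol \<eta> j)"]
        by (simp add: norm_mult)
      ultimately have "norm (sol \<eta> j) * (norm (sol \<eta> j) - 1 / (2 * M)) \<le> Re (cnj (sol \<eta> j) * sol z j)"
        by (simp add: power2_eq_square right_diff_distrib)
      moreover have "1 / M * (1 / M - 1 / (2 * M)) \<le> norm (sol \<eta> j) * (norm (sol \<eta> j) - 1 / (2 * M))"
        using u M1 by (intro mult_mono) (auto simp: field_simps)
      moreover have "1 / M * (1 / M - 1 / (2 * M)) = 1 / (2 * M\<^sup>2)"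
        using M1 by (simp add: field_simps power2_eq_square)
      ultimately show ?thesis by linarith
    qed
    have "?N / (2 * M\<^sup>2) = (\<Sum>j\<le>n. 1 / (2 * M\<^sup>2))" by simp
    also have "\<dots> \<le> (\<Sum>j\<le>n. Re (cnj (sol \<eta> j) * sol z j))" by (intro sum_mono trm) simp
    also have "\<dots> = Re (k z)" by (simp add: k_def)
    also have "\<dots> \<le> norm (k z)" by (rule complex_Re_le_cmod)
    finally show "?N / (2 * M\<^sup>2) \<le> norm (k z)" .
  qed simp
  \<comment> \<open>A polynomial that agrees with \<open>k\<close> on the circle; its continuity on
    the plane gives integrability of the square.\<close>
  define K where "K z = (\<Sum>j\<le>n. cnj (sol \<eta> j) * (poly (\<Phi> j) z / sqrt (sqnorm j)))" for z
  have Kk: "K z = k z" if "z \<in> unit_circle" for z using that by (simp add: K_def k_def sol_eq_poly)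
  have contK: "continuous_on UNIV K" unfolding K_def using sqnorm_pos by (intro continuous_intros) (auto simp: less_imp_neq[symmetric])
  have "(?N / (2 * M\<^sup>2))\<^sup>2 * measure \<mu> ?I = (\<integral>z. (?N / (2 * M\<^sup>2))\<^sup>2 * indicator ?I z \<partial>\<mu>)"
    using I by simp
  also have "\<dots> \<le> (\<integral>z. (norm (K z))\<^sup>2 \<partial>\<mu>)"
  proof (rule integral_mono)
    show "integrable \<mu> (\<lambda>z. (?N / (2 * M\<^sup>2))\<^sup>2 * indicator ?I z)"
      by (intro integrable_mult_right integrable_real_indicator I)
         (simp only: infinity_ennreal_def top.not_eq_extremum[symmetric] emeasure_finite[unfolded infinity_ennreal_def] not_False_eq_True)
    show "integrable \<mu> (\<lambda>z. (norm (K z))\<^sup>2)" by (intro continuous_integrable continuous_intros contK)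
    show "(?N / (2 * M\<^sup>2))\<^sup>2 * indicator ?I z \<le> (norm (K z))\<^sup>2" if "z \<in> space \<mu>" for z
      using ge[of z] Kk[of z] that by (auto simp: space_mu indicator_def)
  qed
  also have "\<dots> = (\<integral>z. (norm (k z))\<^sup>2 \<partial>\<mu>)"
    by (intro Bochner_Integration.integral_cong refl) (simp add: space_mu Kk)
  also have "\<dots> = (\<Sum>j\<le>n. (norm (sol \<eta> j))\<^sup>2)" unfolding k_def parseval by simp
  also have "\<dots> \<le> (\<Sum>j\<le>n. M\<^sup>2)" by (intro sum_mono power_mono M) auto
  also have "\<dots> = ?N * M\<^sup>2" by simp
  finally have fin: "(?N / (2 * M\<^sup>2))\<^sup>2 * measure \<mu> ?I \<le> ?N * M\<^sup>2" .
  \<comment> \<open>Chebyshev's inequality: the kernel is at least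
    \<open>?N / (2 * M\<^sup>2)\<close> on the ball, while its square integrates to at most
    \<open>?N * M\<^sup>2\<close>; the quotient is the source of \<open>4 * M ^ 6\<close>.\<close>
  have "measure \<mu> ?I \<le> (?N * M\<^sup>2) / (?N / (2 * M\<^sup>2))\<^sup>2"
    using fin M1 by (subst pos_le_divide_eq) (auto simp: mult.commute intro!: zero_less_power divide_pos_pos)
  also have "\<dots> = 4 * M ^ 6 / ?N"
  proof -
    have "(N * M\<^sup>2) / (N / (2 * M\<^sup>2))\<^sup>2 = 4 * M ^ 6 / N" if "N \<noteq> 0" for N :: real
      using that M1 by (simp add: field_simps power2_eq_square eval_nat_numeral)
    then show ?thesis by (metis nat.simps(3) of_nat_eq_0_iff)
  qed
  finally show ?thesis .
qed

end

section \<open>Null sets on the levels of bounded solutions\<close>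

lemma continuous_on_circle_sol: "continuous_on UNIV (\<lambda>z. circle_sol \<alpha> u0 z n)"
proof (induction n)
  case (Suc n)
  show ?case
    unfolding circle_sol.simps divide_inverse by (intro continuous_intros Suc)
qed simp

text \<open>Both initial values are controlled because the Wronskian bound and the perturbation
  estimate involve both solutions. A uniform \<open>M\<close> makes the levels closed and the
  constants of the measure estimates uniform on them.\<close>

definition sol_bounded :: "(nat \<Rightarrow> complex) \<Rightarrow> real \<Rightarrow> complex set" where
  "sol_bounded \<alpha> M = {z \<in> unit_circle. \<forall>n. norm (circle_sol \<alpha> 1 z n) \<le> M \<and> norm (circle_sol \<alpha> \<i> z n) \<le> M}"

lemma closed_sol_bounded: "closed (sol_bounded \<alpha> M)"
proof -
  have "sol_bounded \<alpha> M = unit_circle \<inter> (\<Inter>n. {z. norm (circle_sol \<alpha> 1 z n) \<le> M} \<inter> {z. norm (circle_sol \<alpha> \<i> z n) \<le> M})"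
    by (auto simp: sol_bounded_def)
  moreover have "closed {z. norm (circle_sol \<alpha> u z n) \<le> M}" for u n
    by (intro closed_Collect_le continuous_intros continuous_on_circle_sol)
  ultimately show ?thesis by (simp only:) (intro closed_Int closed_INT ballI closed_sphere)
qed

lemma arc_len_Int_circle: "arc_len (A \<inter> unit_circle) = arc_len A"
proof -
  have "{0..<2 * pi} \<inter> cis -` (A \<inter> unit_circle) = {0..<2 * pi} \<inter> cis -` A" by auto
  then show ?thesis by (simp add: arc_len_def)
qed

lemma arc_len_finite: "arc_len A \<le> ennreal (2 * pi)"
proof -
  have "arc_len A \<le> emeasure lborel {0..<2 * pi}" unfolding arc_len_def by (intro emeasure_mono) auto
  then show ?thesis by simp
qed

context opuc
begin

lemma null_compact_of_arc_len:
  assumes K: "compact K" "K \<subseteq> sol_bounded \<alpha> M" and "1 \<le> M" and "arc_len K = 0"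
  shows "emeasure \<mu> K = 0"
proof -
  \<comment> \<open>Both measures are pushed forward to the Borel sets of the plane, where the ball
    comparison is stated.\<close>
  define P where "P = distr \<mu> borel (\<lambda>z. z)"
  define L where "L = distr (arc_measure (\<lambda>_. 1)) borel (\<lambda>z. z)"
  have idm: "(\<lambda>z. z) \<in> measurable (arc_measure (\<lambda>_. 1)) borel"
    using id_measurable_mu by (subst measurable_cong_sets[OF sets_arc_measure refl], subst (asm) measurable_cong_sets[OF sets_mu refl])
  have spL: "space (arc_measure (\<lambda>_. 1)) = unit_circle"
    by (metis sets_arc_measure sets_eq_imp_space_eq space_circle_borel)
  have P: "emeasure P A = emeasure \<mu> (A \<inter> unit_circle)" if "A \<in> sets borel" for A
    unfolding P_def using that by (subst emeasure_distr) (auto simp: space_mu Int_commute)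
  have L: "emeasure L A = ennreal (1 / (2 * pi)) * arc_len A" if "A \<in> sets borel" for A
    unfolding L_def using that idm
    by (subst emeasure_distr) (auto simp: spL arc_measure_1 sets_circle_borel_Int arc_len_Int_circle)
  define b where "b = ln (1 + 1 / (2 * M\<^sup>2)) / M\<^sup>2"
  have b: "0 < b" "M * (exp (M\<^sup>2 * b) - 1) \<le> 1 / (2 * M)"
  proof -
    have "0 < 1 / (2 * M\<^sup>2)" using \<open>1 \<le> M\<close> by simp
    then have "0 < ln (1 + 1 / (2 * M\<^sup>2))" by (intro ln_gt_zero) linarith
    then show "0 < b" using \<open>1 \<le> M\<close> by (simp add: b_def)
    have "M\<^sup>2 * b = ln (1 + 1 / (2 * M\<^sup>2))" using \<open>1 \<le> M\<close> by (simp add: b_def)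
    moreover have "exp (ln (1 + 1 / (2 * M\<^sup>2))) = 1 + 1 / (2 * M\<^sup>2)"
      by (rule exp_ln) (use \<open>0 < 1 / (2 * M\<^sup>2)\<close> in linarith)
    ultimately have "exp (M\<^sup>2 * b) = 1 + 1 / (2 * M\<^sup>2)" by simp
    then show "M * (exp (M\<^sup>2 * b) - 1) \<le> 1 / (2 * M)" using \<open>1 \<le> M\<close> by (simp add: power2_eq_square)
  qed
  have "measure P K = 0"
  proof (rule null_of_ball_bounds[where L = L and a = "1 / (2 * pi)" and b = b and C = "4 * M ^ 6"])
    show "sets P = sets borel" "sets L = sets borel" by (simp_all add: P_def L_def)
    show "finite_measure P"
      by (rule finite_measureI) (simp add: P_def emeasure_distr space_mu emeasure_eq_measure)
    have "emeasure L UNIV \<noteq> \<infinity>"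
      using arc_len_finite[of UNIV] by (auto simp: L ennreal_mult_eq_top_iff top_unique)
    then show "finite_measure L" by (intro finite_measureI) (simp add: L_def)
    show "compact K" by fact
    show "1 / (2 * pi) * r \<le> measure L (ball x r)" if "x \<in> K" "0 < r" "r \<le> 1" for x r
    proof -
      have "x \<in> unit_circle" using that K(2) by (auto simp: sol_bounded_def)
      then have "ennreal (1 / (2 * pi)) * ennreal r \<le> emeasure L (ball x r)"
        using that by (subst L) (auto intro!: mult_left_mono arc_len_ball_ge)
      then have "ennreal (1 / (2 * pi) * r) \<le> ennreal (measure L (ball x r))"
        using \<open>finite_measure L\<close> that by (subst ennreal_mult) (auto simp: finite_measure.emeasure_eq_measure)
      then show ?thesis by (simp add: ennreal_le_iff)
    qed
    show "measure P (cball x (b / real (Suc n))) \<le> 4 * M ^ 6 / real (Suc n)" if "x \<in> K" for x n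
    proof -
      have x: "norm x = 1" "\<And>n. norm (circle_sol \<alpha> 1 x n) \<le> M" "\<And>n. norm (circle_sol \<alpha> \<i> x n) \<le> M"
        using that K(2) by (auto simp: sol_bounded_def)
      have "measure P (cball x (b / real (Suc n))) = measure \<mu> (cball x (b / real (Suc n)) \<inter> unit_circle)"
        by (simp add: measure_def P del: of_nat_Suc)
      also have "\<dots> \<le> 4 * M ^ 6 / real (Suc n)"
        by (rule measure_ball_upper[OF x(1) \<open>1 \<le> M\<close> x(2,3) less_imp_le[OF b(1)] b(2)])
      finally show ?thesis .
    qed
    have "K \<in> sets borel" using K by (simp add: compact_imp_closed)
    then show "measure L K = 0" using assms(4) by (simp add: measure_def L)
  qed (use \<open>1 \<le> M\<close> b in auto)
  moreover have "finite_measure P"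
    by (rule finite_measureI) (simp add: P_def emeasure_distr space_mu emeasure_eq_measure)
  ultimately have "emeasure P K = 0" by (simp add: finite_measure.emeasure_eq_measure)
  moreover have "K \<in> sets borel" "K \<inter> unit_circle = K" using K by (auto simp: compact_imp_closed sol_bounded_def)
  ultimately show ?thesis by (simp add: P)
qed

lemma arc_len_compact_of_null:
  assumes K: "compact K" "K \<subseteq> sol_bounded \<alpha> M" and "1 \<le> M" and \<mu>K: "emeasure \<mu> K = 0"
  shows "arc_len K = 0"
proof (rule arc_len_eq_0_of_christoffel[OF _ sets_mu K(1) _ \<mu>K, where B = "M\<^sup>2"])
  show "finite_measure \<mu>" by unfold_locales
  show "K \<subseteq> unit_circle" using K(2) by (auto simp: sol_bounded_def)
  fix n \<eta> assume "\<eta> \<in> K"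
  then have \<eta>: "norm \<eta> = 1" "\<And>n. norm (sol \<eta> n) \<le> M" using K(2) by (auto simp: sol_bounded_def)
  \<comment> \<open>The Fejer-type polynomial of degree at most \<open>n\<close> centered at \<eta>,
    normalised to the value 1 there.\<close>
  define P where "P = smult (1 / of_nat (Suc n)) (\<Sum>k\<le>n. monom ((cnj \<eta>) ^ k) k)"
  have Pz: "poly P z = (\<Sum>k\<le>n. (z * cnj \<eta>) ^ k) / of_nat (Suc n)" for z
    by (simp add: P_def poly_sum poly_monom power_mult_distrib mult.commute del: of_nat_Suc)
  have "\<eta> * cnj \<eta> = 1" using \<eta>(1) by (simp add: complex_norm_square[symmetric])
  then have P\<eta>: "poly P \<eta> = 1" by (simp add: Pz del: of_nat_Suc)
  have "degree P \<le> n" unfolding P_def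
    by (intro order_trans[OF degree_smult_le] degree_sum_le) (auto intro: order_trans[OF degree_monom_le])
  from christoffel_lower[OF this \<eta>(1)]
  have "1 \<le> (\<Sum>k\<le>n. (norm (sol \<eta> k))\<^sup>2) * (\<integral>z. (norm (poly P z))\<^sup>2 \<partial>\<mu>)" by (simp add: P\<eta>)
  also have "\<dots> \<le> (\<Sum>k\<le>n. M\<^sup>2) * (\<integral>z. (norm (poly P z))\<^sup>2 \<partial>\<mu>)"
    by (intro mult_right_mono sum_mono power_mono \<eta>) auto
  also have "(\<Sum>k\<le>n. M\<^sup>2) = M\<^sup>2 * real (Suc n)" by simp
  finally show "1 \<le> M\<^sup>2 * real (Suc n) * (\<integral>z. (norm ((\<Sum>k\<le>n. (z * cnj \<eta>) ^ k) / of_nat (Suc n)))\<^sup>2 \<partial>\<mu>)"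
    by (simp only: Pz)
qed simp

text \<open>Inner regularity of the finite Borel measure \<open>P\<close> carries the statement from
  compact subsets, where the ball comparison applies, to Borel sets.\<close>

lemma null_of_arc_len:
  assumes A: "A \<in> sets borel" "A \<subseteq> sol_bounded \<alpha> M" and "1 \<le> M" and "arc_len A = 0"
  shows "emeasure \<mu> A = 0"
proof -
  define P where "P = distr \<mu> borel (\<lambda>z. z)"
  have P: "emeasure P A = emeasure \<mu> A" if "A \<in> sets borel" "A \<subseteq> unit_circle" for A
  proof -
    have "(\<lambda>z. z) -` A \<inter> space \<mu> = A" using that(2) by (auto simp: space_mu)
    then show ?thesis unfolding P_def using that by (subst emeasure_distr) auto
  qed
  have c: "A \<subseteq> unit_circle" using A(2) by (auto simp: sol_bounded_def)
  have "emeasure P (space P) \<noteq> \<infinity>" by (simp add: P_def emeasure_distr space_mu emeasure_eq_measure)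
  then have "emeasure P A = (SUP K \<in> {K. K \<subseteq> A \<and> compact K}. emeasure P K)"
    by (intro inner_regular A) (simp_all add: P_def)
  also have "\<dots> \<le> 0"
  proof (rule SUP_least)
    fix K assume K: "K \<in> {K. K \<subseteq> A \<and> compact K}"
    then have "arc_len K = 0" using arc_len_mono[of K A] A(1) assms(4) by simp
    then have "emeasure \<mu> K = 0" using K A(2) by (intro null_compact_of_arc_len[OF _ _ \<open>1 \<le> M\<close>]) auto
    then show "emeasure P K \<le> 0" using K c by (subst P) (auto simp: compact_imp_closed)
  qed
  finally show ?thesis using P[OF A(1) c] by simp
qed

end

section \<open>Singular part and density\<close>

lemma cis_inj_on: "inj_on cis {0..<2 * pi}"
proof (rule inj_onI)
  fix x y assume *: "x \<in> {0..<2 * pi}" "y \<in> {0..<2 * pi}" "cis x = cis y"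
  have "Arg2pi (cis t) = t" if "t \<in> {0..<2 * pi}" for t
    using that by (intro Arg2pi_unique[of 1]) (auto simp: cis_conv_exp)
  then show "x = y" using * by metis
qed

theorem theorem1p5:
  fixes \<mu> \<mu>s :: "complex measure"
    and w :: "real \<Rightarrow> real"
    and \<alpha> :: "nat \<Rightarrow> complex"
    and c :: "nat \<Rightarrow> complex"
    and \<phi> :: "nat \<Rightarrow> real"
    and \<gamma> :: "nat \<Rightarrow> nat \<Rightarrow> complex"
    and p :: nat
    and \<beta> :: real
  assumes "nontrivial_circle_prob \<mu>"
    and "circle_lebesgue_decomp \<mu> w \<mu>s"
    and "verblunsky_coeffs \<mu> \<alpha>"
    and "\<And>n. (\<lambda>l. c (Suc l) * cis (- (real n * \<phi> (Suc l))) * \<gamma> (Suc l) n) sums \<alpha> n"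
    and "odd p" and "p \<ge> 3"
    and "0 < \<beta>" and "\<beta> < 1 / (real p - 2)"
    and "(SUP l\<in>{1..}. \<Sum>n. ennreal (norm (\<gamma> l (Suc n + 1) - \<gamma> l (Suc n)))) < \<infinity>"
    and "(\<Sum>n. (SUP l\<in>{1..}. ennreal (norm (\<gamma> l (Suc n)))) ^ p) < \<infinity>"
    and "(\<Sum>l. ennreal (norm (c (Suc l)) powr \<beta>)) < \<infinity>"
  shows "(\<exists>S \<in> sets circle_borel.
            hausdorff_dim S \<le> ennreal (\<beta> * (real p - 2)) \<and> emeasure \<mu>s (unit_circle - S) = 0)
       \<and> (AE \<theta> in lborel. \<theta> \<in> {0..<2 * pi} \<longrightarrow> w \<theta> > 0)"
proof -
  obtain \<Phi> where \<Phi>: "monic_orthogonal_polys \<mu> \<Phi>"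
    "\<And>n z. poly (\<Phi> (Suc n)) z = z * poly (\<Phi> n) z - cnj (\<alpha> n) * poly (szego_star (\<Phi> n)) z"
    using assms(3) unfolding verblunsky_coeffs_def by blast
  interpret opuc \<mu> \<alpha> \<Phi> by unfold_locales (use assms(1) \<Phi> in auto)
  \<comment> \<open>The largest odd tree size below \<open>p\<close>; all neglected trees then have
    size at least \<open>d + 2 = p\<close>.\<close>
  define d where "d = p - 2"
  have d: "odd d" "p = d + 2" "real p - 2 = real d" "1 \<le> d" using assms(5,6) by (auto simp: d_def of_nat_diff)
  have \<beta>d: "\<beta> * real d < 1" using assms(8) d(4) unfolding d(3) by (simp add: pos_less_divide_eq)
  moreover have "\<beta> * 1 \<le> \<beta> * real d" using d(4) assms(7) by (intro mult_left_mono) auto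
  ultimately have \<beta>1: "\<beta> \<le> 1" by simp
  have img: "f ` {1..} = range (\<lambda>l. f (Suc l))" for f :: "nat \<Rightarrow> ennreal"
  proof -
    have "{1..} = range Suc" by (auto simp: image_iff Suc_le_eq gr0_conv_Suc)
    then show ?thesis by (simp add: image_image)
  qed
  obtain E where E: "\<And>s. \<beta> * real d < s \<Longrightarrow> hausdorff_measure s E = 0"
    "\<And>z u0. norm z = 1 \<Longrightarrow> z \<notin> E \<Longrightarrow> \<exists>M. \<forall>n. norm (circle_sol \<alpha> u0 z n) \<le> M"
  proof (rule exceptional_set[of \<alpha> "\<lambda>l. c (Suc l)" "\<lambda>l. \<phi> (Suc l)" "\<lambda>l. \<gamma> (Suc l)" d \<beta>])
    show "(SUP l. \<Sum>n. ennreal (norm (\<gamma> (Suc l) (Suc n + 1) - \<gamma> (Suc l) (Suc n)))) < \<infinity>"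
      using assms(9) unfolding img .
    show "(\<Sum>n. (SUP l. ennreal (norm (\<gamma> (Suc l) (Suc n)))) ^ (d + 2)) < \<infinity>"
      using assms(10) unfolding img d(2) .
    show "summable (\<lambda>l. norm (c (Suc l)) powr \<beta>)"
      by (rule summable_suminf_not_top) (use assms(11) in auto)
  qed (use norm_alpha_less_1 assms(4,7) \<beta>1 d in blast)+
  \<comment> \<open>As a countable union of closed levels \<open>G\<close> is Borel, hence so is its
    complement \<open>S\<close>; the latter inherits the Hausdorff bounds from \<open>E\<close>,
    which contains it.\<close>
  define G where "G = (\<Union>M. sol_bounded \<alpha> (real (Suc M)))"
  define S where "S = unit_circle - G"
  have Ub: "unit_circle \<in> sets (borel :: complex measure)" by (intro borel_closed closed_sphere)
  have Gb: "sol_bounded \<alpha> M \<in> sets borel" for M using closed_sol_bounded by (rule borel_closed)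
  have GM: "G \<in> sets borel" unfolding G_def using Gb by (intro sets.countable_UN) auto
  have Gc: "G \<subseteq> unit_circle" by (auto simp: G_def sol_bounded_def)
  have Sb: "S \<in> sets borel" unfolding S_def using GM Ub by (rule sets.Diff[rotated])
  have Sc: "S \<in> sets circle_borel" using Sb by (intro sets_circle_borelI) (auto simp: S_def)
  have "S \<subseteq> E"
  proof
    fix z assume z: "z \<in> S"
    show "z \<in> E"
    proof (rule ccontr)
      assume "z \<notin> E"
      have nz: "norm z = 1" using z by (simp add: S_def)
      obtain M1 where M1: "\<And>n. norm (circle_sol \<alpha> 1 z n) \<le> M1" using E(2)[OF nz \<open>z \<notin> E\<close>, of 1] by blast
      obtain M2 where M2: "\<And>n. norm (circle_sol \<alpha> \<i> z n) \<le> M2" using E(2)[OF nz \<open>z \<notin> E\<close>, of \<i>] by blast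
      obtain k :: nat where "max M1 M2 \<le> real k" using real_arch_simple by blast
      then have "z \<in> sol_bounded \<alpha> (real (Suc k))"
        using nz order_trans[OF M1, of "real (Suc k)"] order_trans[OF M2, of "real (Suc k)"] by (auto simp: sol_bounded_def)
      then show False using z by (auto simp: S_def G_def)
    qed
  qed
  then have HS: "hausdorff_measure s S = 0" if "\<beta> * real d < s" for s
    using hausdorff_measure_mono[of S E s] E(1)[OF that] by simp
  have dimS: "hausdorff_dim S \<le> ennreal (\<beta> * (real p - 2))"
    unfolding d(3) by (rule hausdorff_dim_leI[OF _ HS]) (use assms(7) in auto)
  \<comment> \<open>Exponent 1 is admissible because \<open>\<beta> * real d < 1\<close>.\<close>
  have arcS: "arc_len S = 0" by (rule arc_len_eq_0_of_hausdorff[OF HS[OF \<beta>d] _ _ Sb]) auto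
  obtain N where N: "N \<in> null_sets (arc_measure (\<lambda>_. 1))" "emeasure \<mu>s (unit_circle - N) = 0"
    and w[measurable]: "w \<in> borel_measurable borel" and w0: "\<And>\<theta>. \<theta> \<in> {0..<2 * pi} \<Longrightarrow> 0 \<le> w \<theta>" and s\<mu>s: "sets \<mu>s = sets circle_borel"
    and dec: "\<And>A. A \<in> sets circle_borel \<Longrightarrow> emeasure \<mu> A = emeasure (arc_measure w) A + emeasure \<mu>s A"
    using assms(2) unfolding circle_lebesgue_decomp_def circle_singular_def by blast
  have Nc: "N \<in> sets circle_borel" and arcN: "arc_len N = 0"
    using N(1) by (auto simp: null_sets_def arc_measure_1_eq_0_iff)
  have Nb: "N \<in> sets borel" using sets_circle_borel_subset[OF Nc] by simp
  have cNc: "unit_circle - N \<in> sets circle_borel" using Nb Ub by (intro sets_circle_borelI sets.Diff) auto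
  have "emeasure \<mu>s (unit_circle - S) = 0"
  proof -
    have "unit_circle - N \<in> null_sets \<mu>s" using N(2) cNc s\<mu>s by auto
    \<comment> \<open>Arc length zero implies \<mu>-measure zero on a level, and \<mu>s is dominated
      by \<mu>.\<close>
    moreover have "sol_bounded \<alpha> (real (Suc M)) \<inter> N \<in> null_sets \<mu>s" for M
    proof -
      have "arc_len (sol_bounded \<alpha> (real (Suc M)) \<inter> N) = 0" using arc_len_mono[OF _ Nb, of "sol_bounded \<alpha> (real (Suc M)) \<inter> N"] arcN by simp
      then have "emeasure \<mu> (sol_bounded \<alpha> (real (Suc M)) \<inter> N) = 0"
        using Gb Nb by (intro null_of_arc_len[where M = "real (Suc M)"]) auto
      moreover have "sol_bounded \<alpha> (real (Suc M)) \<inter> N \<in> sets circle_borel"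
        using Gb Nb by (intro sets_circle_borelI) (auto simp: sol_bounded_def)
      ultimately show ?thesis using dec s\<mu>s by (auto simp: null_sets_def)
    qed
    ultimately have "(unit_circle - N) \<union> (\<Union>M. sol_bounded \<alpha> (real (Suc M)) \<inter> N) \<in> null_sets \<mu>s"
      by (intro null_sets.Un null_sets_UN)
    moreover have "unit_circle - S \<subseteq> (unit_circle - N) \<union> (\<Union>M. sol_bounded \<alpha> (real (Suc M)) \<inter> N)"
      using Gc by (auto simp: S_def G_def)
    moreover have "unit_circle - S \<in> sets \<mu>s" unfolding s\<mu>s using Sb Ub by (intro sets_circle_borelI sets.Diff) auto
    ultimately show ?thesis by (meson null_setsD1 null_sets_subset)
  qed
  moreover have "AE \<theta> in lborel. \<theta> \<in> {0..<2 * pi} \<longrightarrow> w \<theta> > 0"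
  proof -
    \<comment> \<open>Off \<open>N\<close> there is no singular mass, so where the density vanishes
      \<mu> vanishes too, and on a level this forces arc length zero. The angles over
      \<open>N\<close> and over \<open>S\<close> are null sets and are discarded separately.\<close>
    define Z where "Z M = {0..<2 * pi} \<inter> {\<theta>. w \<theta> = 0} \<inter> ({0..<2 * pi} \<inter> cis -` (sol_bounded \<alpha> (real (Suc M)) - N))" for M
    have Zb: "Z M \<in> sets borel" for M
      unfolding Z_def using Gb Nb by (intro sets.Int arc_sets sets.Diff) auto
    have Z0: "emeasure lborel (Z M) = 0" for M
    proof -
      \<comment> \<open>Inner regularity is applied to a finite measure, hence the restriction of
        \<open>lborel\<close> to an interval containing \<open>Z M\<close>.\<close>
      define Q where "Q = density lborel (indicator {0..2 * pi} :: real \<Rightarrow> ennreal)"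
      have Q: "emeasure Q A = emeasure lborel ({0..2 * pi} \<inter> A)" if "A \<in> sets borel" for A
        unfolding Q_def using that by (subst emeasure_density) (auto simp: indicator_inter_arith[symmetric])
      have "emeasure Q (space Q) \<noteq> \<infinity>" using Q[of UNIV] by (simp add: Q_def)
      then have "emeasure Q (Z M) = (SUP K \<in> {K. K \<subseteq> Z M \<and> compact K}. emeasure Q K)"
        by (intro inner_regular Zb) (simp_all add: Q_def)
      also have "\<dots> \<le> 0"
      proof (rule SUP_least)
        fix K assume K: "K \<in> {K. K \<subseteq> Z M \<and> compact K}"
        define K' where "K' = cis ` K"
        have cK': "compact K'" unfolding K'_def using K by (intro compact_continuous_image continuous_intros) auto
        have K'G: "K' \<subseteq> sol_bounded \<alpha> (real (Suc M))" and K'N: "K' \<inter> N = {}" using K by (auto simp: K'_def Z_def)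
        have K'c: "K' \<in> sets circle_borel" using cK' by (intro sets_circle_borelI) (auto simp: compact_imp_closed K'_def)
        \<comment> \<open>By injectivity of \<open>cis\<close> on the half-open interval, the angles
          of \<open>K'\<close> are those of \<open>K\<close>; hence the absolutely continuous part
          gives \<open>K'\<close> measure zero.\<close>
        have pre: "w \<theta> = 0" if "\<theta> \<in> {0..<2 * pi} \<inter> cis -` K'" for \<theta>
        proof -
          have "cis \<theta> \<in> cis ` K" using that by (simp add: K'_def)
          then obtain \<theta>' where "cis \<theta> = cis \<theta>'" "\<theta>' \<in> K" by (rule imageE)
          moreover have "\<theta>' \<in> {0..<2 * pi}" "w \<theta>' = 0" using K \<open>\<theta>' \<in> K\<close> by (auto simp: Z_def)
          ultimately show ?thesis using inj_onD[OF cis_inj_on, of \<theta> \<theta>'] that by auto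
        qed
        have "emeasure (arc_measure w) K' = (\<integral>\<^sup>+(\<theta>::real). 0 \<partial>lborel)"
          unfolding emeasure_arc_measure[OF w K'c] by (rule nn_integral_cong) (use pre in \<open>auto simp: indicator_def\<close>)
        moreover have "emeasure \<mu>s K' \<le> emeasure \<mu>s (unit_circle - N)"
          using K'N cNc by (intro emeasure_mono) (auto simp: s\<mu>s K'_def)
        ultimately have "emeasure \<mu> K' = 0" using dec[OF K'c] N(2) by simp
        then have "arc_len K' = 0" by (rule arc_len_compact_of_null[OF cK' K'G, rotated]) simp
        moreover have "emeasure Q K \<le> arc_len K'"
        proof -
          have Kb: "K \<in> sets borel" using K by (auto simp: compact_imp_closed)
          have "K \<subseteq> {0..<2 * pi} \<inter> cis -` K'" using K by (auto simp: K'_def Z_def)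
          then show ?thesis unfolding Q[OF Kb] arc_len_def
            using sets_circle_borel_subset[OF K'c] by (intro emeasure_mono) auto
        qed
        ultimately show "emeasure Q K \<le> 0" by simp
      qed
      also have "emeasure Q (Z M) = emeasure lborel (Z M)"
        unfolding Q[OF Zb] by (rule arg_cong[where f = "emeasure lborel"]) (auto simp: Z_def)
      finally show ?thesis by simp
    qed
    have "AE \<theta> in lborel. \<forall>M. \<theta> \<notin> Z M"
      unfolding AE_all_countable using Z0 Zb by (auto intro!: AE_not_in simp: null_sets_def)
    moreover have "AE \<theta> in lborel. \<theta> \<notin> {0..<2 * pi} \<inter> cis -` S"
      using arcS Sb by (intro AE_not_in) (auto simp: null_sets_def arc_len_def arc_sets)
    moreover have "AE \<theta> in lborel. \<theta> \<notin> {0..<2 * pi} \<inter> cis -` N"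
      using arcN Nb by (intro AE_not_in) (auto simp: null_sets_def arc_len_def arc_sets)
    ultimately show ?thesis
    proof eventually_elim
      case (elim \<theta>)
      show ?case
      proof
        assume \<theta>: "\<theta> \<in> {0..<2 * pi}"
        then have "cis \<theta> \<in> G" "cis \<theta> \<notin> N" using elim by (auto simp: S_def)
        then obtain M where "cis \<theta> \<in> sol_bounded \<alpha> (real (Suc M))" by (auto simp: G_def)
        then have "w \<theta> \<noteq> 0" using elim(1) \<theta> \<open>cis \<theta> \<notin> N\<close> by (auto simp: Z_def)
        then show "0 < w \<theta>" using w0[OF \<theta>] by simp
      qed
    qed
  qed
  ultimately show ?thesis using Sc dimS by blast
qed

end
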